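(* Let $\phi\in\mathbb M(\mathcal A(\hat{\mathbf R}^d))$ and $F_\phi\in\mathbb M(\mathcal L^1(\mathbf R^d))$ the corresponding multiplier. The following are equivalent: (a) there exists a transformable Radon measure $\iota F_\phi$ on $\mathbf R^d$ whose Fourier transform is $\phi(t)\,dt$; (b) $\hat k*\phi\in B(\hat{\mathbf R}^d)$ for every $k\in C_c(\mathbf R^d)\cap B(\mathbf R^d)$; (c) $F_\phi$ is locally bounded.
   Context: $G=\mathbf R^d$ with dual $\hat{\mathbf R}^d$, pairing $e^{ix\cdot t}$; $\hat f(t)=(2\pi)^{-d}\int e^{-ix\cdot t}f(x)dx$ for $f\in L^1(\mathbf R^d)$ (and for measures analogously), $\check h(t)=(2\pi)^{-d}\int e^{ix\cdot t}h(x)dx$, Lebesgue measures $dx,dt$. $V=\{t:|t|<1/4\}$. For $E\subseteq\hat{\mathbf R}^d$, $\mathrm{span}(E)$ is the span of the characters $x\mapsto e^{ix\cdot s}$, $s\in E$, each $p=\sum\hat p(s)e^{ix\cdot s}$ uniquely, $\|p\|_\infty=\sup|p|$. For $\phi\in C_b(\hat{\mathbf R}^d)$: $\|\phi\|^{\bar V,s}=\sup\{|\sum_{s'\in\bar V+s}\hat p(s')\phi(s')|:p\in\mathrm{span}(\bar V+s),\|p\|_\infty\le1\}$, $\|\phi\|^{\bar V}=\sup_s\|\phi\|^{\bar V,s}$. On $M(\mathbf R^d)$ put $\|\mu\|_{\bar V}=\|\hat\mu\|^{\bar V}$; $\mathcal L^1(\mathbf R^d)$ is the closure of $L^1(\mathbf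 R^d)$ in the completion of $(M(\mathbf R^d),\|\cdot\|_{\bar V})$, with generalized Fourier transform $\hat f=\lim\widehat{f_n}$ for $f=\lim f_n$; $\mathcal A(\hat{\mathbf R}^d)$ is its image with norm $\|\cdot\|^{\bar V}$, and $\mathbb M(\mathcal A(\hat{\mathbf R}^d))=\{\phi\in C_b:\phi\psi\in\mathcal A\ \forall\psi\in\mathcal A\}$. For such $\phi$, $F_\phi$ is the multiplier of $\mathcal L^1(\mathbf R^d)$ with $\widehat{F_\phi*f}=\phi\hat f$. $f\in\mathcal L^1(\mathbf R^d)$ is locally integrable if there are $f_n\in L^1(\mathbf R^d)$ with $f_n\to f$ in $\|\cdot\|_{\bar V}$ and $\{hf_n\}$ Cauchy in $L^1$ for every $h\in C_c(\mathbf R^d)$; then $hf:=\lim hf_n\in L^1$ (independent of the choice). $\mathcal L^1(\mathbf R^d)_{(0)}$ is the set of locally integrable elements. Let $B_n=\{x:|x|\le1/n\}$, $e_0=c\,1_{B_4}*1_{B_4}*1_{B_4}*1_{B_4}$ with $c>0$ such that $\|e_0\|_1=1$, and $e_n(x)=n^de_0(nx)$. $F_\phi$ is locally bounded if (i) $F_\phi*e_n\in\mathcal L^1(\mathbf R^d)_{(0)}$ for all $n\in\mathbf N$, and (ii) $\sup_n\|h(F_\phi*e_n)\|_1<\infty$ for every $h\in C_c(\mathbf R^d)$. $B(\hat{\mathbf R}^d)=\{\hat\mu:\mu\in M(\mathbf R^d)\}$ and $B(\mathbf R^d)$ the Fourier–Stieltjes algebra on $\mathbf R^d$; for $k\in C_c(\mathbf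 R^d)\cap B(\mathbf R^d)$, $\hat k\in L^1(\hat{\mathbf R}^d)$ and $\hat k*\phi(t)=\int\phi(t-s)\hat k(s)ds$. A Radon measure $\nu$ on $\mathbf R^d$ is transformable if there is a Radon measure $\hat\nu$ on $\hat{\mathbf R}^d$ with $\int h*h^*d\nu=\int|\check h|^2d\hat\nu$ for all $h\in C_c(\mathbf R^d)$, $h^*(x)=\overline{h(-x)}$; $\hat\nu$ is its Fourier transform. *)

theory Defs
  imports "HOL-Analysis.Analysis"
begin

text \<open>Throughout, R^d and its dual are both modelled by a Euclidean space 'a,
  with pairing x, t maps to exp(i (x \<bullet> t)); d = DIM('a).\<close>

definition ft_const :: "'a::euclidean_space itself \<Rightarrow> complex" where
  "ft_const _ = complex_of_real (inverse ((2 * pi) ^ DIM('a)))"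

definition FT :: "('a::euclidean_space \<Rightarrow> complex) \<Rightarrow> 'a \<Rightarrow> complex" where
  "FT f t = ft_const TYPE('a) * (\<integral>x. cis (- (x \<bullet> t)) * f x \<partial>lborel)"

definition IFT :: "('a::euclidean_space \<Rightarrow> complex) \<Rightarrow> 'a \<Rightarrow> complex" where
  "IFT h t = ft_const TYPE('a) * (\<integral>x. cis (x \<bullet> t) * h x \<partial>lborel)"

definition FT_meas :: "'a::euclidean_space measure \<Rightarrow> 'a \<Rightarrow> complex" where
  "FT_meas \<mu> t = ft_const TYPE('a) * (\<integral>x. cis (- (x \<bullet> t)) \<partial>\<mu>)"

text \<open>A complex bounded (Radon) measure on R^d is represented as
  mu1 - mu2 + i (mu3 - mu4) with finite positive Borel measures mu_j.\<close>
definition fin_borel :: "'a::euclidean_space measure \<Rightarrow> bool" where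
  "fin_borel \<mu> \<longleftrightarrow> finite_measure \<mu> \<and> sets \<mu> = sets borel"

definition B_hat :: "('a::euclidean_space \<Rightarrow> complex) set" where
  "B_hat = {\<psi>. \<exists>\<mu>1 \<mu>2 \<mu>3 \<mu>4. fin_borel \<mu>1 \<and> fin_borel \<mu>2 \<and> fin_borel \<mu>3 \<and> fin_borel \<mu>4 \<and>
      (\<forall>t. \<psi> t = FT_meas \<mu>1 t - FT_meas \<mu>2 t + \<i> * (FT_meas \<mu>3 t - FT_meas \<mu>4 t))}"

text \<open>Fourier--Stieltjes algebra B(R^d): functions x maps to int exp(i x.t) d mu(t),
  mu a bounded complex measure on the dual group.\<close>
definition B_FS :: "('a::euclidean_space \<Rightarrow> complex) set" where
  "B_FS = {k. \<exists>\<mu>1 \<mu>2 \<mu>3 \<mu>4. fin_borel \<mu>1 \<and> fin_borel \<mu>2 \<and> fin_borel \<mu>3 \<and> fin_borel \<mu>4 \<and>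
      (\<forall>x. k x = (\<integral>t. cis (x \<bullet> t) \<partial>\<mu>1) - (\<integral>t. cis (x \<bullet> t) \<partial>\<mu>2)
                 + \<i> * ((\<integral>t. cis (x \<bullet> t) \<partial>\<mu>3) - (\<integral>t. cis (x \<bullet> t) \<partial>\<mu>4)))}"

definition Cc :: "('a::euclidean_space \<Rightarrow> complex) set" where
  "Cc = {h. continuous_on UNIV h \<and> bounded {x. h x \<noteq> 0}}"

definition Cb :: "('a::euclidean_space \<Rightarrow> complex) set" where
  "Cb = {\<phi>. continuous_on UNIV \<phi> \<and> bounded (range \<phi>)}"

text \<open>The norm ||phi||^{bar V} with bar V = closed ball of radius 1/4: sup over s and over
  trigonometric polynomials p = sum c(s') e^{i x.s'} with frequencies in bar V + s and
  sup norm at most 1 of |sum c(s') phi(s')|.\<close>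
definition Vnorm :: "('a::euclidean_space \<Rightarrow> complex) \<Rightarrow> ereal" where
  "Vnorm \<phi> = (SUP s. SUP Sc \<in> {(S, c). finite S \<and> S \<subseteq> cball s (1/4) \<and>
          (\<forall>x. cmod (\<Sum>s'\<in>S. c s' * cis (x \<bullet> s')) \<le> 1)}.
        ereal (cmod (\<Sum>s'\<in>fst Sc. snd Sc s' * \<phi> s')))"

text \<open>A(hat R^d): generalized Fourier transforms of elements of the closure of L^1 in the
  completion of (M(R^d), ||.||_{bar V}); elements of calL^1 are identified with their
  generalized Fourier transforms.\<close>
definition A_alg :: "('a::euclidean_space \<Rightarrow> complex) set" where
  "A_alg = {\<psi>. \<psi> \<in> Cb \<and> (\<exists>f. (\<forall>n. integrable lborel (f n)) \<and>
        ((\<lambda>n. Vnorm (\<lambda>t. \<psi> t - FT (f n) t)) \<longlonglongrightarrow> 0))}"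

definition MA :: "('a::euclidean_space \<Rightarrow> complex) set" where
  "MA = {\<phi>. \<phi> \<in> Cb \<and> (\<forall>\<psi>\<in>A_alg. (\<lambda>t. \<phi> t * \<psi> t) \<in> A_alg)}"

text \<open>f_n (L^1) is a sequence witnessing local integrability of the element with
  generalized Fourier transform psi.\<close>
definition loc_int_seq :: "('a::euclidean_space \<Rightarrow> complex) \<Rightarrow> (nat \<Rightarrow> 'a \<Rightarrow> complex) \<Rightarrow> bool" where
  "loc_int_seq \<psi> f \<longleftrightarrow> (\<forall>n. integrable lborel (f n)) \<and>
     ((\<lambda>n. Vnorm (\<lambda>t. \<psi> t - FT (f n) t)) \<longlonglongrightarrow> 0) \<and>
     (\<forall>h\<in>Cc. \<forall>\<epsilon>>0. \<exists>N. \<forall>m\<ge>N. \<forall>n\<ge>N.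
        (\<integral>x. cmod (h x * f m x - h x * f n x) \<partial>lborel) < \<epsilon>)"

definition loc_integrable :: "('a::euclidean_space \<Rightarrow> complex) \<Rightarrow> bool" where
  "loc_integrable \<psi> \<longleftrightarrow> \<psi> \<in> A_alg \<and> (\<exists>f. loc_int_seq \<psi> f)"

text \<open>g is (a representative of) the L^1 function h f, where f has generalized
  Fourier transform psi.\<close>
definition loc_mult :: "('a::euclidean_space \<Rightarrow> complex) \<Rightarrow> ('a \<Rightarrow> complex) \<Rightarrow> ('a \<Rightarrow> complex) \<Rightarrow> bool" where
  "loc_mult \<psi> h g \<longleftrightarrow> integrable lborel g \<and> (\<exists>f. loc_int_seq \<psi> f \<and>
     ((\<lambda>n. \<integral>x. cmod (h x * f n x - g x) \<partial>lborel) \<longlonglongrightarrow> 0))"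

definition conv :: "('a::euclidean_space \<Rightarrow> complex) \<Rightarrow> ('a \<Rightarrow> complex) \<Rightarrow> 'a \<Rightarrow> complex" where
  "conv f g x = (\<integral>y. f (x - y) * g y \<partial>lborel)"

definition ind_B4 :: "'a::euclidean_space \<Rightarrow> complex" where
  "ind_B4 x = (if norm x \<le> 1/4 then 1 else 0)"

definition e0 :: "'a::euclidean_space \<Rightarrow> complex" where
  "e0 x = (let g = conv (conv (conv ind_B4 ind_B4) ind_B4) ind_B4
           in g x / complex_of_real (\<integral>y. cmod (g y) \<partial>lborel))"

definition en :: "nat \<Rightarrow> 'a::euclidean_space \<Rightarrow> complex" where
  "en n x = of_nat n ^ DIM('a) * e0 (of_nat n *\<^sub>R x)"

text \<open>F_phi is locally bounded; F_phi * e_n is the element of calL^1 with generalized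
  Fourier transform phi * hat e_n.\<close>
definition F_locally_bounded :: "('a::euclidean_space \<Rightarrow> complex) \<Rightarrow> bool" where
  "F_locally_bounded \<phi> \<longleftrightarrow>
     (\<forall>n\<ge>1. loc_integrable (\<lambda>t. \<phi> t * FT (en n) t)) \<and>
     (\<forall>h\<in>Cc. \<exists>C. \<forall>n\<ge>1. \<forall>g. loc_mult (\<lambda>t. \<phi> t * FT (en n) t) h g \<longrightarrow>
         (\<integral>x. cmod (g x) \<partial>lborel) \<le> C)"

text \<open>Complex Radon measures on R^d, as continuous linear functionals on C_c(R^d)
  (Bourbaki / Riesz): linear, and bounded in sup norm on functions supported in any
  fixed compact set.\<close>
definition radon_functional :: "(('a::euclidean_space \<Rightarrow> complex) \<Rightarrow> complex) \<Rightarrow> bool" where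
  "radon_functional \<nu> \<longleftrightarrow>
     (\<forall>f\<in>Cc. \<forall>g\<in>Cc. \<nu> (\<lambda>x. f x + g x) = \<nu> f + \<nu> g) \<and>
     (\<forall>f\<in>Cc. \<forall>c. \<nu> (\<lambda>x. c * f x) = c * \<nu> f) \<and>
     (\<forall>K. compact K \<longrightarrow> (\<exists>C. \<forall>f\<in>Cc. {x. f x \<noteq> 0} \<subseteq> K \<longrightarrow>
         cmod (\<nu> f) \<le> C * (SUP x. cmod (f x))))"

definition transformable_with_density :: "(('a::euclidean_space \<Rightarrow> complex) \<Rightarrow> complex) \<Rightarrow> ('a \<Rightarrow> complex) \<Rightarrow> bool" where
  "transformable_with_density \<nu> \<phi> \<longleftrightarrow>
     (\<forall>h\<in>Cc. integrable lborel (\<lambda>t. complex_of_real ((cmod (IFT h t))\<^sup>2) * \<phi> t) \<and>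
        \<nu> (conv h (\<lambda>x. cnj (h (- x)))) = (\<integral>t. complex_of_real ((cmod (IFT h t))\<^sup>2) * \<phi> t \<partial>lborel))"

definition khat_conv :: "('a::euclidean_space \<Rightarrow> complex) \<Rightarrow> ('a \<Rightarrow> complex) \<Rightarrow> 'a \<Rightarrow> complex" where
  "khat_conv k \<phi> t = (\<integral>s. \<phi> (t - s) * FT k s \<partial>lborel)"

end

theory Submission
  imports Defs "HOL-Probability.Probability"
begin

text \<open>On the functions \<open>u \<in> C\<^sub>c\<close> with integrable transform consider the functional
  \<open>L u = \<integral> \<phi>(-r) FT u(r) dr\<close>. Each of (a), (b), (c) is equivalent to \<open>L\<close> being bounded in the
  supremum norm on the functions supported in any fixed ball. Such an \<open>L\<close> extends to \<open>C\<^sub>c\<close> by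
  mollification and is then, up to a constant, the Radon measure of (a); conversely (a) determines \<open>L\<close> by
  polarization. In (b), \<open>FT k * \<phi>\<close> is the transform of the measure \<open>k L\<close>, which is obtained
  as a weak limit of the densities \<open>k (L * e\<^sub>n)\<close>. For (c), \<open>F * e\<^sub>n\<close> is the continuous function
  \<open>L * e\<^sub>n\<close>; cutting it off at radius \<open>m\<close> gives the approximating integrable functions, because
  elements of \<open>\<A>\<close> are limits of transforms of integrable functions.\<close>

section \<open>Fubini, substitution and the Gaussian\<close>

text \<open>\<open>L\<close> is given by absolutely convergent integrals only on functions with
  integrable transform, whereas the three conditions involve products with arbitrary continuous, or
  even merely measurable, factors. Convolution with \<open>en n\<close> bridges this gap: it
  enlarges the radius of the support by at most 1 and does not increase a supremum bound, so a local
  bound on \<open>L\<close> can be used uniformly in \<open>n\<close>. Membership in the domain of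
  \<open>L\<close> often comes from positivity: a bounded integrable function with nonnegative
  transform has an integrable transform. This covers autocorrelations, and also the mollifier, whose
  transform is a fourth power up to a positive factor. In (c) the bound must hold for every sequence
  that represents \<open>F * e\<^sub>n\<close>. Pairings with test functions depend only on the
  generalized transform, not on the sequence, and duality recovers the L1 norm from them. An
  explicit sequence is needed only for existence; it is cut off by dilates of one function, because
  the L1 norm of their transforms does not change with the dilation.\<close>

lemma norm_signed_sum_le: "cmod (a - b + \<i> * (c - d)) \<le> cmod a + cmod b + cmod c + cmod d"
  using norm_triangle_ineq[of "a - b" "\<i> * (c - d)"] norm_triangle_ineq4[of a b] norm_triangle_ineq4[of c d]
  by (simp add: norm_mult)

lemma measurable_cis [measurable]: "cis \<in> borel_measurable borel"
  by (intro borel_measurable_continuous_onI continuous_intros)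

lemma integrable_tensor:
  fixes f :: "'b \<Rightarrow> complex" and g :: "'c \<Rightarrow> complex"
  assumes M: "sigma_finite_measure M" and N: "sigma_finite_measure N"
    and f: "integrable M f" and g: "integrable N g"
  shows "integrable (M \<Otimes>\<^sub>M N) (\<lambda>(x, y). f x * g y)"
proof -
  interpret pair_sigma_finite M N using M N by (simp add: pair_sigma_finite_def)
  have [measurable]: "f \<in> borel_measurable M" "g \<in> borel_measurable N" using f g by auto
  have "integrable M (\<lambda>x. \<integral>y. norm (f x * g y) \<partial>N)"
    using f g by (simp add: norm_mult)
  then show ?thesis
    using g by (intro Fubini_integrable) (auto simp: split_beta)
qed

lemma integrable_bounded_kernel:
  fixes f :: "'b \<Rightarrow> complex" and g :: "'c \<Rightarrow> complex" and K :: "'b \<Rightarrow> 'c \<Rightarrow> complex"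
  assumes M: "sigma_finite_measure M" and N: "sigma_finite_measure N"
    and f: "integrable M f" and g: "integrable N g"
    and K [measurable]: "(\<lambda>(x, y). K x y) \<in> borel_measurable (M \<Otimes>\<^sub>M N)"
    and C: "\<And>x y. cmod (K x y) \<le> C"
  shows "integrable (M \<Otimes>\<^sub>M N) (\<lambda>(x, y). f x * (K x y * g y))"
proof -
  have [measurable]: "f \<in> borel_measurable M" "g \<in> borel_measurable N" using f g by auto
  have "integrable (M \<Otimes>\<^sub>M N) (\<lambda>p. of_real C * (\<lambda>(x, y). f x * g y) p)"
    using integrable_tensor[OF M N f g] by (intro integrable_mult_right) auto
  moreover have "norm (case p of (x, y) \<Rightarrow> f x * (K x y * g y)) \<le> norm (of_real C * (case p of (x, y) \<Rightarrow> f x * g y))" for p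
  proof (cases p)
    case (Pair x y)
    have "cmod (K x y) \<le> \<bar>C\<bar>" using C[of x y] by linarith
    then have "cmod (K x y) * (cmod (f x) * cmod (g y)) \<le> \<bar>C\<bar> * (cmod (f x) * cmod (g y))"
      by (intro mult_right_mono) auto
    with Pair show ?thesis by (simp add: norm_mult mult_ac)
  qed
  ultimately show ?thesis
    by (intro Bochner_Integration.integrable_bound[OF _ _ AE_I2, of _ _ "\<lambda>(x, y). f x * (K x y * g y)"]) (auto simp: split_beta')
qed

text \<open>The form in which a Fourier integral is exchanged with another integral: the kernel is a
  character and \<open>C = 1\<close>. The two integrable factors dominate the integrand, so joint
  integrability never has to be checked at the place of use.\<close>

lemma Fubini_bounded_kernel:
  fixes f :: "'b \<Rightarrow> complex" and g :: "'c \<Rightarrow> complex" and K :: "'b \<Rightarrow> 'c \<Rightarrow> complex"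
  assumes M: "sigma_finite_measure M" and N: "sigma_finite_measure N"
    and f: "integrable M f" and g: "integrable N g"
    and K: "(\<lambda>(x, y). K x y) \<in> borel_measurable (M \<Otimes>\<^sub>M N)"
    and C: "\<And>x y. cmod (K x y) \<le> C"
  shows "(\<integral>x. f x * (\<integral>y. K x y * g y \<partial>N) \<partial>M) = (\<integral>y. g y * (\<integral>x. K x y * f x \<partial>M) \<partial>N)"
proof -
  interpret pair_sigma_finite M N using M N by (simp add: pair_sigma_finite_def)
  have "(\<integral>y. (\<integral>x. f x * (K x y * g y) \<partial>M) \<partial>N) = (\<integral>x. (\<integral>y. f x * (K x y * g y) \<partial>N) \<partial>M)"
    using integrable_bounded_kernel[OF assms] by (intro Fubini_integral) (simp add: split_beta)
  moreover have "(\<integral>x. f x * (K x y * g y) \<partial>M) = (\<integral>x. g y * (K x y * f x) \<partial>M)" for y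
    by (simp add: mult_ac)
  ultimately show ?thesis by simp
qed

text \<open>No measurability is assumed, so that both facts serve as unconditional rewrite rules.
  The affine map has a measurable inverse, hence either both integrands are measurable or neither
  is; in the latter case both integrals have the default value 0.\<close>

lemma
  fixes f :: "'a::euclidean_space \<Rightarrow> complex"
  assumes "c \<noteq> 0"
  shows lborel_integrable_affine: "integrable lborel (\<lambda>x. f (t + c *\<^sub>R x)) \<longleftrightarrow> integrable lborel f" (is ?A)
    and lborel_integral_affine:
      "(LBINT x. f (t + c *\<^sub>R x)) = (LBINT x. f x) / of_real (\<bar>c\<bar> ^ DIM('a))" (is ?B)
proof -
  let ?D = "distr lborel borel (\<lambda>x. t + c *\<^sub>R x) :: 'a measure"
  have pos: "\<bar>c\<bar> ^ DIM('a) > 0" using assms by simp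
  have meas: "f \<in> borel_measurable borel" if "integrable lborel (\<lambda>x. f (t + c *\<^sub>R x))"
  proof -
    have "(\<lambda>x. f (t + c *\<^sub>R x)) \<in> borel_measurable borel" using that by auto
    then have "(\<lambda>x. f (t + c *\<^sub>R x)) \<circ> (\<lambda>x. (x - t) /\<^sub>R c) \<in> borel_measurable borel"
      by (intro measurable_comp[of _ borel borel]) auto
    then show ?thesis using assms by (simp add: comp_def)
  qed
  have int: "integrable lborel (\<lambda>x. f (t + c *\<^sub>R x)) \<longleftrightarrow> integrable lborel f"
      "(LBINT x. f (t + c *\<^sub>R x)) = (LBINT x. f x) / of_real (\<bar>c\<bar> ^ DIM('a))"
    if [measurable]: "f \<in> borel_measurable borel"
  proof -
    have "integrable lborel f \<longleftrightarrow> integrable (density ?D (\<lambda>_. \<bar>c\<bar> ^ DIM('a))) f"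
      using lborel_affine[OF assms, of t] by simp
    also have "\<dots> \<longleftrightarrow> integrable ?D (\<lambda>x. \<bar>c\<bar> ^ DIM('a) *\<^sub>R f x)"
      using pos by (subst integrable_density) auto
    also have "\<dots> \<longleftrightarrow> integrable ?D f"
      using assms integrable_scaleR_right[of "inverse (\<bar>c\<bar> ^ DIM('a))" ?D "\<lambda>x. \<bar>c\<bar> ^ DIM('a) *\<^sub>R f x"]
      by auto
    also have "\<dots> \<longleftrightarrow> integrable lborel (\<lambda>x. f (t + c *\<^sub>R x))"
      by (subst integrable_distr_eq) auto
    finally show "integrable lborel (\<lambda>x. f (t + c *\<^sub>R x)) \<longleftrightarrow> integrable lborel f" by simp
    have "(LBINT x. f x) = (\<integral>x. f x \<partial>density ?D (\<lambda>_. \<bar>c\<bar> ^ DIM('a)))"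
      using lborel_affine[OF assms, of t] by simp
    also have "\<dots> = (\<integral>x. \<bar>c\<bar> ^ DIM('a) *\<^sub>R f x \<partial>?D)"
      using pos by (subst integral_density) auto
    also have "\<dots> = (LBINT x. \<bar>c\<bar> ^ DIM('a) *\<^sub>R f (t + c *\<^sub>R x))"
      by (subst integral_distr) auto
    also have "\<dots> = of_real (\<bar>c\<bar> ^ DIM('a)) * (LBINT x. f (t + c *\<^sub>R x))"
      by (simp add: scaleR_conv_of_real)
    finally show "(LBINT x. f (t + c *\<^sub>R x)) = (LBINT x. f x) / of_real (\<bar>c\<bar> ^ DIM('a))"
      using pos assms by (simp add: field_simps)
  qed
  show ?A
  proof (cases "f \<in> borel_measurable borel")
    case True then show ?thesis by (rule int)
  next
    case False
    then have "\<not> integrable lborel (\<lambda>x. f (t + c *\<^sub>R x))" "\<not> integrable lborel f"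
      using meas by auto
    then show ?thesis by blast
  qed
  show ?B
  proof (cases "f \<in> borel_measurable borel")
    case False
    then have "\<not> integrable lborel (\<lambda>x. f (t + c *\<^sub>R x))" "\<not> integrable lborel f"
      using meas by auto
    then show ?thesis by (simp add: not_integrable_integral_eq)
  qed (rule int)
qed

lemmas lborel_integrable_scale = lborel_integrable_affine[where t = 0, simplified]
lemmas lborel_integral_scale = lborel_integral_affine[where t = 0, simplified]
lemmas lborel_integrable_reflect = lborel_integrable_affine[where c = "-1", simplified]
lemmas lborel_integral_reflect = lborel_integral_affine[where c = "-1", simplified]
lemmas lborel_integrable_uminus = lborel_integrable_reflect[where t = 0, simplified]
lemmas lborel_integral_uminus = lborel_integral_reflect[where t = 0, simplified]
lemmas lborel_integrable_shift = lborel_integrable_affine[where c = 1, simplified]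
lemmas lborel_integral_shift = lborel_integral_affine[where c = 1, simplified]

section \<open>The Gaussian and its Fourier integral\<close>

definition gauss :: "'a::euclidean_space \<Rightarrow> real" where
  "gauss x = exp (- (x \<bullet> x) / 2)"

lemma gauss_nonneg [simp]: "gauss x \<ge> 0" and gauss_le_1: "gauss x \<le> 1"
  by (auto simp: gauss_def)

lemma gauss_0 [simp]: "gauss 0 = 1"
  by (simp add: gauss_def)

lemma continuous_on_gauss [continuous_intros]:
  "continuous_on S f \<Longrightarrow> continuous_on S (\<lambda>x. gauss (f x))"
  unfolding gauss_def by (intro continuous_intros) auto

lemma measurable_gauss [measurable]: "gauss \<in> borel_measurable borel"
  by (intro borel_measurable_continuous_onI continuous_intros)

text \<open>Up to the factor \<open>sqrt (2 * pi)\<close> the integral is the characteristic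
  function of the standard normal distribution.\<close>

lemma cis_gauss_real:
  fixes t :: real
  shows "integrable lborel (\<lambda>x::real. cis (x * t) * of_real (exp (- x\<^sup>2 / 2)))"
    and "(LBINT x. cis (x * t) * of_real (exp (- x\<^sup>2 / 2))) = of_real (sqrt (2 * pi) * exp (- t\<^sup>2 / 2))"
proof -
  have eq: "cis (x * t) * of_real (exp (- x\<^sup>2 / 2))
      = of_real (sqrt (2 * pi)) * (std_normal_density x *\<^sub>R iexp (t * x))" for x
    by (simp add: normal_density_def cis_conv_exp scaleR_conv_of_real mult_ac)
  have "integrable lborel (\<lambda>x. std_normal_density x *\<^sub>R iexp (t * x))"
    by (rule Bochner_Integration.integrable_bound[of _ std_normal_density]) auto
  then show "integrable lborel (\<lambda>x::real. cis (x * t) * of_real (exp (- x\<^sup>2 / 2)))"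
    unfolding eq by (rule integrable_mult_right)
  have "char std_normal_distribution t = (LBINT x. std_normal_density x *\<^sub>R iexp (t * x))"
    unfolding char_def by (subst integral_density) auto
  then have "(LBINT x. std_normal_density x *\<^sub>R iexp (t * x)) = of_real (exp (- t\<^sup>2 / 2))"
    by (simp add: char_std_normal_distribution)
  then show "(LBINT x. cis (x * t) * of_real (exp (- x\<^sup>2 / 2))) = of_real (sqrt (2 * pi) * exp (- t\<^sup>2 / 2))"
    unfolding eq integral_mult_right_zero by simp
qed

lemma cis_sum: "finite A \<Longrightarrow> cis (\<Sum>i\<in>A. f i) = (\<Prod>i\<in>A. cis (f i))"
  by (induction A rule: finite_induct) (auto simp: cis_mult[symmetric])

text \<open>Both factors of the integrand split into products over the coordinates, and
  \<open>lborel\<close> is the image of a product of one-dimensional Lebesgue measures, so the real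
  case applies in each coordinate.\<close>

lemma cis_gauss:
  fixes t :: "'a::euclidean_space"
  shows "integrable lborel (\<lambda>x. cis (x \<bullet> t) * of_real (gauss x))"
    and "(LBINT x. cis (x \<bullet> t) * of_real (gauss x)) = of_real (sqrt (2 * pi) ^ DIM('a) * gauss t)"
proof -
  interpret product_sigma_finite "\<lambda>_::'a. lborel :: real measure" ..
  let ?T = "\<lambda>f. \<Sum>b\<in>Basis. f b *\<^sub>R b :: 'a"
  let ?P = "\<Pi>\<^sub>M b\<in>(Basis :: 'a set). lborel :: real measure"
  let ?g = "\<lambda>b (x::real). cis (x * (t \<bullet> b)) * complex_of_real (exp (- x\<^sup>2 / 2))"
  have gx: "complex_of_real (gauss x) = (\<Prod>b\<in>Basis. of_real (exp (- (x \<bullet> b)\<^sup>2 / 2)))" for x :: 'a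
    unfolding gauss_def euclidean_inner[of x x]
    by (simp add: exp_sum[symmetric] sum_negf sum_divide_distrib power2_eq_square of_real_prod[symmetric]
        del: of_real_prod)
  have cx: "cis (x \<bullet> t) = (\<Prod>b\<in>Basis. cis ((x \<bullet> b) * (t \<bullet> b)))" for x
    by (subst euclidean_inner) (simp add: cis_sum)
  have eq: "cis (x \<bullet> t) * of_real (gauss x) = (\<Prod>b\<in>Basis. ?g b (x \<bullet> b))" for x
    unfolding gx cx by (simp add: prod.distrib)
  have eq': "(\<Prod>b\<in>Basis. ?g b (?T f \<bullet> b)) = (\<Prod>b\<in>Basis. ?g b (f b))" for f
    by (intro prod.cong refl) simp
  have T [measurable]: "?T \<in> measurable ?P borel"
    by measurable
  have m [measurable]: "(\<lambda>x::'a. \<Prod>b\<in>Basis. ?g b (x \<bullet> b)) \<in> borel_measurable borel"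
    by measurable
  have "integrable ?P (\<lambda>f. \<Prod>b\<in>Basis. ?g b (f b))"
    by (intro product_integrable_prod cis_gauss_real finite_Basis)
  then show "integrable lborel (\<lambda>x. cis (x \<bullet> t) * of_real (gauss x))"
    unfolding eq by (subst lborel_eq, subst integrable_distr_eq[OF T m]) (simp only: eq')
  have "(LBINT x. cis (x \<bullet> t) * of_real (gauss x)) = (\<integral>f. (\<Prod>b\<in>Basis. ?g b (f b)) \<partial>?P)"
    unfolding eq by (subst lborel_eq, subst integral_distr[OF T m]) (simp only: eq')
  also have "\<dots> = (\<Prod>b\<in>Basis. of_real (sqrt (2 * pi) * exp (- (t \<bullet> b)\<^sup>2 / 2)))"
    by (subst product_integral_prod[OF finite_Basis cis_gauss_real(1)]) (simp only: cis_gauss_real(2))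
  also have "\<dots> = of_real (sqrt (2 * pi) ^ DIM('a) * gauss t)"
    unfolding of_real_mult gx[of t] prod.distrib by simp
  finally show "(LBINT x. cis (x \<bullet> t) * of_real (gauss x)) = of_real (sqrt (2 * pi) ^ DIM('a) * gauss t)" .
qed

section \<open>Fourier transforms and inversion\<close>

lemma ft_const_nonzero [simp]: "ft_const TYPE('a::euclidean_space) \<noteq> 0"
  by (simp add: ft_const_def)

lemma ft_const_mult: "ft_const TYPE('a::euclidean_space) * of_real ((2 * pi) ^ DIM('a)) = 1"
  by (simp add: ft_const_def field_simps)

lemma IFT_eq_FT: "IFT h t = FT h (- t)"
  by (simp add: IFT_def FT_def)

lemma integrable_cis_mult:
  fixes f :: "'b \<Rightarrow> complex"
  assumes "integrable M f" "a \<in> borel_measurable M"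
  shows "integrable M (\<lambda>x. cis (a x) * f x)"
  using assms(1)
  by (rule Bochner_Integration.integrable_bound) (use assms in \<open>auto simp: norm_mult\<close>)

lemma integrable_bounded_mult:
  fixes f :: "'b \<Rightarrow> complex"
  assumes f: "integrable M f" and C: "\<And>x. cmod (a x) \<le> C" and [measurable]: "a \<in> borel_measurable M"
  shows "integrable M (\<lambda>x. a x * f x)"
proof (rule Bochner_Integration.integrable_bound)
  show "integrable M (\<lambda>x. of_real C * f x)" using f by simp
  show "(\<lambda>x. a x * f x) \<in> borel_measurable M" using f by auto
  show "AE x in M. cmod (a x * f x) \<le> cmod (of_real C * f x)"
    by (intro AE_I2) (auto simp: norm_mult intro!: mult_right_mono order_trans[OF C abs_ge_self])
qed

lemma continuous_Fourier_integral:
  fixes f :: "'a::euclidean_space \<Rightarrow> complex"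
  assumes "integrable M f" "sets M = sets borel"
  shows "continuous_on UNIV (\<lambda>t. \<integral>x. cis (x \<bullet> t) * f x \<partial>M)"
proof (rule continuous_on_sequentiallyI)
  fix u :: "nat \<Rightarrow> 'a" and a assume u: "u \<longlonglongrightarrow> a"
  note assms(2) [measurable_cong]
  have [measurable]: "f \<in> borel_measurable M" using assms by auto
  show "(\<lambda>n. \<integral>x. cis (x \<bullet> u n) * f x \<partial>M) \<longlonglongrightarrow> (\<integral>x. cis (x \<bullet> a) * f x \<partial>M)"
    by (rule integral_dominated_convergence[where w = "\<lambda>x. cmod (f x)"])
       (use assms in \<open>auto simp: norm_mult intro!: AE_I2 tendsto_intros u isCont_tendsto_compose[of _ cis]
          continuous_intros\<close>)
qed

lemma continuous_FT:
  assumes "integrable lborel f"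
  shows "continuous_on UNIV (FT f)"
proof -
  have "continuous_on UNIV ((\<lambda>t. ft_const TYPE('a) * (LBINT x. cis (x \<bullet> t) * f x)) \<circ> uminus)"
    using assms
    by (intro continuous_on_compose continuous_intros continuous_on_subset[OF continuous_Fourier_integral]) auto
  then show ?thesis by (simp add: FT_def[abs_def] comp_def)
qed

lemma measurable_FT [measurable]:
  assumes "integrable lborel f"
  shows "FT f \<in> borel_measurable borel"
  using continuous_FT[OF assms] by (rule borel_measurable_continuous_onI)

lemma norm_FT_le:
  fixes f :: "'a::euclidean_space \<Rightarrow> complex"
  shows "cmod (FT f t) \<le> cmod (ft_const TYPE('a)) * (LBINT x. cmod (f x))"
proof -
  have "cmod (LBINT x. cis (- (x \<bullet> t)) * f x) \<le> (LBINT x. cmod (cis (- (x \<bullet> t)) * f x))"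
    by simp
  then show ?thesis
    unfolding FT_def norm_mult by (intro mult_left_mono) (auto simp: norm_mult)
qed

lemma FT_modulate: "FT (\<lambda>x. cis (- (x \<bullet> t)) * f x) s = FT f (s + t)"
  by (simp add: FT_def inner_add_right cis_mult mult.assoc[symmetric])

text \<open>Gaussian probability density with standard deviation \<open>1 / s\<close> in each
  coordinate. It arises as the transform of the wide Gaussian \<open>gauss (x /\<^sub>R s)\<close>
  and concentrates at 0 as \<open>s\<close> grows.\<close>

definition gkern :: "real \<Rightarrow> 'a::euclidean_space \<Rightarrow> real" where
  "gkern s t = (s / sqrt (2 * pi)) ^ DIM('a) * gauss (s *\<^sub>R t)"

lemma gkern_nonneg: "s > 0 \<Longrightarrow> gkern s t \<ge> 0"
  by (auto simp: gkern_def)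

lemma measurable_gkern [measurable]: "gkern s \<in> borel_measurable borel"
  unfolding gkern_def[abs_def] by measurable

lemma gkern_le: "s > 0 \<Longrightarrow> gkern s (t :: 'a) \<le> (s / sqrt (2 * pi)) ^ DIM('a::euclidean_space)"
  by (auto simp: gkern_def gauss_le_1 mult_left_le)

lemma integrable_gauss: "integrable lborel (\<lambda>x :: 'a::euclidean_space. complex_of_real (gauss x))"
  and integral_gauss:
    "(\<integral>x. complex_of_real (gauss x) \<partial>(lborel :: 'a measure)) = of_real (sqrt (2 * pi) ^ DIM('a::euclidean_space))"
  using cis_gauss[of "0 :: 'a"] by simp_all

lemma
  assumes "s > 0"
  shows integrable_gkern: "integrable lborel (\<lambda>x. complex_of_real (gkern s (x :: 'a::euclidean_space)))"
    and integral_gkern: "(LBINT x. complex_of_real (gkern s (x :: 'a))) = 1"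
proof -
  have "integrable lborel (\<lambda>x :: 'a. complex_of_real (gauss (s *\<^sub>R x)))"
    using assms by (subst lborel_integrable_scale) (auto simp: integrable_gauss)
  then show "integrable lborel (\<lambda>x. complex_of_real (gkern s (x :: 'a::euclidean_space)))"
    unfolding gkern_def of_real_mult by (rule integrable_mult_right)
  have "(\<integral>x. complex_of_real (gauss (s *\<^sub>R x)) \<partial>(lborel :: 'a measure)) = of_real (sqrt (2 * pi) ^ DIM('a)) / of_real (s ^ DIM('a))"
    using assms by (subst lborel_integral_scale) (auto simp: integral_gauss[simplified])
  then show "(LBINT x. complex_of_real (gkern s (x :: 'a))) = 1"
    unfolding gkern_def of_real_mult integral_mult_right_zero using assms
    by (simp add: power_divide)
qed

lemma cis_gauss_scaled:
  fixes t :: "'a::euclidean_space"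
  assumes "s > 0"
  shows "integrable lborel (\<lambda>x. cis (x \<bullet> t) * of_real (gauss (x /\<^sub>R s)))"
    and "(LBINT x. cis (x \<bullet> t) * of_real (gauss (x /\<^sub>R s))) = of_real ((2 * pi) ^ DIM('a) * gkern s t)"
proof -
  have eq: "cis (x \<bullet> t) * of_real (gauss (x /\<^sub>R s)) = (\<lambda>y. cis (y \<bullet> (s *\<^sub>R t)) * complex_of_real (gauss y)) (inverse s *\<^sub>R x)" for x
  proof -
    have "(inverse s *\<^sub>R x) \<bullet> (s *\<^sub>R t) = x \<bullet> t" using assms by (simp add: field_simps)
    then show ?thesis by (simp only:)
  qed
  show "integrable lborel (\<lambda>x. cis (x \<bullet> t) * of_real (gauss (x /\<^sub>R s)))"
    unfolding eq using assms cis_gauss(1)[of "s *\<^sub>R t"] by (subst lborel_integrable_scale) auto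
  \<comment> \<open>One of the two factors is the Gaussian integral, the other cancels the
    normalization inside \<open>gkern\<close>.\<close>
  have "sqrt (2 * pi) ^ DIM('a) * sqrt (2 * pi) ^ DIM('a) = (2 * pi) ^ DIM('a)"
    unfolding power_mult_distrib[symmetric] by simp
  moreover have "c * c * gkern s t = c * gauss (s *\<^sub>R t) / \<bar>inverse s\<bar> ^ DIM('a)" if "c = sqrt (2 * pi) ^ DIM('a)" for c
    using assms by (simp add: gkern_def power_divide that field_simps)
  ultimately have "(2 * pi) ^ DIM('a) * gkern s t = sqrt (2 * pi) ^ DIM('a) * gauss (s *\<^sub>R t) / \<bar>inverse s\<bar> ^ DIM('a)"
    by metis
  then show "(LBINT x. cis (x \<bullet> t) * of_real (gauss (x /\<^sub>R s))) = of_real ((2 * pi) ^ DIM('a) * gkern s t)"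
    unfolding eq using assms
      lborel_integral_scale[of "inverse s" "\<lambda>y. cis (y \<bullet> (s *\<^sub>R t)) * complex_of_real (gauss y)"]
    unfolding cis_gauss(2) of_real_divide[symmetric] by simp
qed

text \<open>Damping the transform by a wide Gaussian amounts to averaging \<open>f\<close> over
  distances of order \<open>1 / s\<close>. Both the inversion theorem and the integrability
  criterion for nonnegative transforms are read off from this identity.\<close>

lemma FT_gauss_mean:
  fixes f :: "'a::euclidean_space \<Rightarrow> complex"
  assumes f: "integrable lborel f" and s: "s > 0"
  shows "(LBINT t. cis (x \<bullet> t) * (FT f t * of_real (gauss (t /\<^sub>R s))))
       = (LBINT z. f (x - z /\<^sub>R s) * of_real (gkern 1 z))"
proof -
  let ?G = "\<lambda>t. cis (t \<bullet> x) * complex_of_real (gauss (t /\<^sub>R s))"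
  have "(LBINT t. cis (x \<bullet> t) * (FT f t * of_real (gauss (t /\<^sub>R s))))
      = ft_const TYPE('a) * (LBINT t. ?G t * (LBINT y. cis (- (y \<bullet> t)) * f y))"
    by (subst integral_mult_right_zero[symmetric]) (simp add: FT_def mult_ac inner_commute)
  also have "(LBINT t. ?G t * (LBINT y. cis (- (y \<bullet> t)) * f y))
      = (LBINT y. f y * (LBINT t. cis (- (y \<bullet> t)) * ?G t))"
    by (rule Fubini_bounded_kernel[where C = 1])
      (use cis_gauss_scaled(1)[OF s, of x] f in \<open>auto intro: lborel.sigma_finite_measure_axioms\<close>)
  also have "\<dots> = (LBINT y. of_real ((2 * pi) ^ DIM('a)) * (f y * of_real (gkern s (x - y))))"
  proof (intro Bochner_Integration.integral_cong refl)
    fix y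
    have "(LBINT t. cis (- (y \<bullet> t)) * ?G t) = (LBINT t. cis (t \<bullet> (x - y)) * of_real (gauss (t /\<^sub>R s)))"
      by (simp add: mult.assoc[symmetric] cis_mult inner_diff_right inner_commute algebra_simps)
    then show "f y * (LBINT t. cis (- (y \<bullet> t)) * ?G t) = of_real ((2 * pi) ^ DIM('a)) * (f y * of_real (gkern s (x - y)))"
      using cis_gauss_scaled(2)[OF s, of "x - y"] by (simp add: mult_ac)
  qed
  also have "\<dots> = of_real ((2 * pi) ^ DIM('a)) * (LBINT y. f y * of_real (gkern s (x - y)))"
    by (rule integral_mult_right_zero)
  also have "ft_const TYPE('a) * \<dots> = (LBINT y. f y * of_real (gkern s (x - y)))"
    using ft_const_mult[where 'a = 'a] by (simp add: mult.assoc[symmetric])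
  \<comment> \<open>The substitution \<open>y = x - z / s\<close> turns \<open>gkern s\<close> into
    the fixed density \<open>gkern 1\<close>.\<close>
  also have "\<dots> = of_real (inverse s ^ DIM('a)) * (LBINT z. f (x - z /\<^sub>R s) * of_real (gkern s (z /\<^sub>R s)))"
    using lborel_integral_affine[where c = "- inverse s" and t = x and f = "\<lambda>y. f y * of_real (gkern s (x - y))"] s
    by simp
  also have "\<dots> = (LBINT z. f (x - z /\<^sub>R s) * of_real (gkern 1 z))"
    by (subst integral_mult_right_zero[symmetric]) (use s in \<open>simp add: gkern_def power_divide field_simps\<close>)
  finally show ?thesis .
qed

lemma gauss_scaled_tendsto:
  fixes t :: "'a::euclidean_space"
  shows "(\<lambda>n. gauss (t /\<^sub>R real (Suc n))) \<longlonglongrightarrow> 1"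
proof -
  have "(\<lambda>n. inverse (real (Suc n)) *\<^sub>R t) \<longlonglongrightarrow> 0 *\<^sub>R t"
    by (intro tendsto_scaleR LIMSEQ_inverse_real_of_nat tendsto_const)
  moreover have "isCont gauss (0 :: 'a)"
    using continuous_on_gauss[OF continuous_on_id, of "UNIV :: 'a set"] by (simp add: continuous_on_eq_continuous_at)
  ultimately have "(\<lambda>n. gauss (t /\<^sub>R real (Suc n))) \<longlonglongrightarrow> gauss (0 :: 'a)"
    by (intro isCont_tendsto_compose[of _ gauss]) auto
  then show ?thesis by simp
qed

text \<open>Let \<open>s\<close> run through the positive integers in \<open>FT_gauss_mean\<close>.
  The left side converges under the majorant \<open>cmod (FT f t)\<close>. The right side is
  dominated by \<open>B * gkern 1 z\<close>, and continuity of \<open>f\<close> at \<open>x\<close>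
  supplies its pointwise limit.\<close>

theorem Fourier_inversion:
  fixes f :: "'a::euclidean_space \<Rightarrow> complex"
  assumes f: "integrable lborel f" and cont: "continuous_on UNIV f" and bd: "\<And>x. cmod (f x) \<le> B"
    and ft: "integrable lborel (FT f)"
  shows "f x = (LBINT t. cis (x \<bullet> t) * FT f t)"
proof -
  have [measurable]: "f \<in> borel_measurable borel" "FT f \<in> borel_measurable borel"
    using f by (auto intro: measurable_FT)
  have lim: "(\<lambda>n. FT f t * of_real (gauss (t /\<^sub>R real (Suc n)))) \<longlonglongrightarrow> FT f t" for t
    using tendsto_mult_left[OF tendsto_of_real[OF gauss_scaled_tendsto], of "FT f t" t] by (simp del: of_nat_Suc)
  let ?L = "\<lambda>n. LBINT t. cis (x \<bullet> t) * (FT f t * of_real (gauss (t /\<^sub>R real (Suc n))))"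
  have "?L \<longlonglongrightarrow> (LBINT t. cis (x \<bullet> t) * FT f t)"
    by (rule integral_dominated_convergence[where w = "\<lambda>x. cmod (FT f x)"])
       (use ft in \<open>auto simp: norm_mult gauss_le_1 mult_left_le simp del: of_nat_Suc intro!: AE_I2 tendsto_intros lim\<close>)
  moreover have "(\<lambda>n. LBINT z. f (x - z /\<^sub>R real (Suc n)) * of_real (gkern 1 z))
      \<longlonglongrightarrow> (\<integral>z. f x * of_real (gkern 1 z) \<partial>(lborel :: 'a measure))"
  proof (rule integral_dominated_convergence[where w = "\<lambda>z::'a. B * gkern 1 z"])
    have "integrable lborel (\<lambda>z::'a. gkern 1 z)"
      using integrable_gkern[of 1, where 'a = 'a] by (simp add: complex_of_real_integrable_eq)
    then show "integrable lborel (\<lambda>z::'a. B * gkern 1 z)" by simp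
    show "AE z in lborel. (\<lambda>n. f (x - z /\<^sub>R real (Suc n)) * of_real (gkern 1 z)) \<longlonglongrightarrow> f x * of_real (gkern 1 z)"
    proof (intro AE_I2 tendsto_intros)
      fix z
      have "(\<lambda>n. x - inverse (real (Suc n)) *\<^sub>R z) \<longlonglongrightarrow> x - 0 *\<^sub>R z"
        by (intro tendsto_intros LIMSEQ_inverse_real_of_nat)
      moreover have "isCont f x" using cont by (simp add: continuous_on_eq_continuous_at)
      ultimately show "(\<lambda>n. f (x - z /\<^sub>R real (Suc n))) \<longlonglongrightarrow> f x"
        by (intro isCont_tendsto_compose[of _ f]) auto
    qed
    show "AE z in lborel. cmod (f (x - z /\<^sub>R real (Suc n)) * of_real (gkern 1 z)) \<le> B * gkern 1 z" for n
      using bd by (auto simp: norm_mult gkern_nonneg intro!: AE_I2 mult_right_mono)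
  qed auto
  then have "?L \<longlonglongrightarrow> f x * 1"
    unfolding FT_gauss_mean[OF f of_nat_0_less_iff[THEN iffD2, OF zero_less_Suc]] integral_mult_right_zero integral_gkern[OF zero_less_one] .
  ultimately show ?thesis using LIMSEQ_unique by fastforce
qed

section \<open>Integrability of transforms by Fatou's lemma\<close>

lemma integrable_of_tendsto_nn_integral_le:
  fixes f :: "'b \<Rightarrow> complex"
  assumes [measurable]: "\<And>n. F n \<in> borel_measurable M" "f \<in> borel_measurable M"
    and lim: "\<And>x. x \<in> space M \<Longrightarrow> (\<lambda>n. F n x) \<longlonglongrightarrow> f x"
    and C: "\<And>n. (\<integral>\<^sup>+x. ennreal (cmod (F n x)) \<partial>M) \<le> ennreal C"
  shows "integrable M f"
proof (rule integrableI_bounded)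
  have "(\<integral>\<^sup>+x. ennreal (cmod (f x)) \<partial>M) = (\<integral>\<^sup>+x. liminf (\<lambda>n. ennreal (cmod (F n x))) \<partial>M)"
    by (intro nn_integral_cong lim_imp_Liminf[symmetric] tendsto_ennrealI tendsto_norm lim) auto
  also have "\<dots> \<le> liminf (\<lambda>n. \<integral>\<^sup>+x. ennreal (cmod (F n x)) \<partial>M)"
    by (rule nn_integral_liminf) auto
  also have "\<dots> \<le> liminf (\<lambda>n. ennreal C)"
    by (intro Liminf_mono eventuallyI C)
  also have "\<dots> < \<infinity>" by (simp add: Liminf_const)
  finally show "(\<integral>\<^sup>+x. ennreal (cmod (f x)) \<partial>M) < \<infinity>" .
qed auto

text \<open>For a nonnegative transform the L1 norm of its damped version is the modulus of the
  damped inversion integral at 0. That integral is a Gaussian average of \<open>f\<close>, hence at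
  most \<open>B\<close> whatever the damping, and Fatou's lemma removes the damping.\<close>

lemma integrable_FT_nonneg:
  fixes f :: "'a::euclidean_space \<Rightarrow> complex"
  assumes f: "integrable lborel f" and bd: "\<And>x. cmod (f x) \<le> B"
    and nonneg: "\<And>t. FT f t = of_real (cmod (FT f t))"
  shows "integrable lborel (FT f)"
proof (rule integrable_of_tendsto_nn_integral_le)
  have [measurable]: "f \<in> borel_measurable borel" "FT f \<in> borel_measurable borel"
    using f by (auto intro: measurable_FT)
  let ?F = "\<lambda>n t. FT f t * of_real (gauss (t /\<^sub>R real (Suc n)))"
  show "?F n \<in> borel_measurable lborel" for n by measurable
  show "FT f \<in> borel_measurable lborel" by measurable
  show "(\<lambda>n. ?F n t) \<longlonglongrightarrow> FT f t" for t
    using tendsto_mult_left[OF tendsto_of_real[OF gauss_scaled_tendsto], of "FT f t" t]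
    by (simp del: of_nat_Suc)
  fix n
  have "integrable lborel (\<lambda>t::'a. complex_of_real (gauss (t /\<^sub>R real (Suc n))))"
    using cis_gauss_scaled(1)[of "real (Suc n)" "0::'a"] by (simp del: of_nat_Suc)
  then have int: "integrable lborel (?F n)"
    by (rule integrable_bounded_mult[OF _ norm_FT_le]) auto
  have eq: "?F n t = of_real (cmod (?F n t))" for t
    unfolding norm_mult of_real_mult nonneg[symmetric] by (simp del: of_nat_Suc)
  have "(\<integral>\<^sup>+t. ennreal (cmod (?F n t)) \<partial>lborel) = ennreal (LBINT t. cmod (?F n t))"
    using int by (intro nn_integral_eq_integral) auto
  also have "(LBINT t. cmod (?F n t)) = cmod (LBINT t. of_real (cmod (?F n t)))"
    by (simp del: of_nat_Suc)
  \<comment> \<open>Inserting the trivial character at the point 0 brings the integral into the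
    shape of \<open>FT_gauss_mean\<close>.\<close>
  also have "\<dots> = cmod (LBINT t. cis (0 \<bullet> t) * ?F n t)"
    unfolding eq[symmetric] by simp
  also have "\<dots> = cmod (LBINT z. f (0 - z /\<^sub>R real (Suc n)) * of_real (gkern 1 z))"
    by (subst FT_gauss_mean[OF f]) auto
  also have "\<dots> \<le> (\<integral>z. B * gkern 1 z \<partial>(lborel :: 'a measure))"
  proof (rule order_trans[OF integral_norm_bound], rule integral_mono')
    show "integrable lborel (\<lambda>z::'a. B * gkern 1 z)"
      using integrable_gkern[of 1, where 'a = 'a] by (simp add: complex_of_real_integrable_eq)
  qed (use order_trans[OF norm_ge_zero bd] bd in \<open>auto simp: norm_mult gkern_nonneg intro!: mult_right_mono\<close>)
  finally show "(\<integral>\<^sup>+t. ennreal (cmod (?F n t)) \<partial>lborel) \<le> ennreal (\<integral>z. B * gkern 1 z \<partial>(lborel :: 'a measure))"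
    by (simp add: ennreal_leI)
qed

section \<open>Convolution and the mollifiers\<close>

lemma conv_commute: "conv f g = conv g f"
proof
  fix x
  show "conv f g x = conv g f x"
    using lborel_integral_reflect[of "\<lambda>z. f z * g (x - z)" x] by (simp add: conv_def mult.commute)
qed

lemma integrable_conv_pair:
  fixes f g :: "'a::euclidean_space \<Rightarrow> complex"
  assumes f: "integrable lborel f" and g: "integrable lborel g"
  shows "integrable (lborel \<Otimes>\<^sub>M lborel) (\<lambda>(y, x). f (x - y) * g y)"
proof -
  have [measurable]: "f \<in> borel_measurable borel" "g \<in> borel_measurable borel" using f g by auto
  have shift: "integrable lborel (\<lambda>x. f (x - y))" for y
    using lborel_integrable_shift[of f "- y"] f by (simp add: algebra_simps)
  have "(LBINT x. cmod (f (x - y))) = (LBINT x. cmod (f x))" for y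
  proof -
    have "complex_of_real (LBINT x. cmod (f (x - y))) = of_real (LBINT x. cmod (f x))"
      using lborel_integral_shift[of "\<lambda>x. complex_of_real (cmod (f x))" "- y"] by (simp add: algebra_simps)
    then show ?thesis by (simp only: of_real_eq_iff)
  qed
  then have "integrable lborel (\<lambda>y. LBINT x. norm (f (x - y) * g y))"
    using g by (simp add: norm_mult)
  then show ?thesis
    using shift by (intro lborel_pair.Fubini_integrable) (auto simp: split_beta)
qed

lemma
  fixes f g :: "'a::euclidean_space \<Rightarrow> complex"
  assumes f: "integrable lborel f" and g: "integrable lborel g"
  shows integrable_conv: "integrable lborel (conv f g)"
    and integral_conv: "(LBINT x. conv f g x) = (LBINT x. f x) * (LBINT x. g x)"
proof -
  show "integrable lborel (conv f g)"
    using lborel_pair.integrable_snd[OF integrable_conv_pair[OF f g]] by (simp add: conv_def[abs_def])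
  have "(LBINT x. conv f g x) = (LBINT y. (LBINT x. f (x - y) * g y))"
    unfolding conv_def by (rule lborel_pair.Fubini_integral[OF integrable_conv_pair[OF f g]])
  also have "\<dots> = (LBINT y. (LBINT x. f x) * g y)"
  proof (intro Bochner_Integration.integral_cong refl)
    fix y
    have "(LBINT x. f (x - y)) = (LBINT x. f x)"
      using lborel_integral_shift[of f "- y"] by (simp add: algebra_simps)
    then show "(LBINT x. f (x - y) * g y) = (LBINT x. f x) * g y" by simp
  qed
  also have "\<dots> = (LBINT x. f x) * (LBINT x. g x)" by simp
  finally show "(LBINT x. conv f g x) = (LBINT x. f x) * (LBINT x. g x)" .
qed

text \<open>Characters are multiplicative, so modulating both factors modulates the convolution, and
  \<open>integral_conv\<close> applies. Each transform carries its own \<open>ft_const\<close>, one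
  of which must be divided out.\<close>

lemma FT_conv:
  fixes f g :: "'a::euclidean_space \<Rightarrow> complex"
  assumes f: "integrable lborel f" and g: "integrable lborel g"
  shows "FT (conv f g) t = FT f t * FT g t / ft_const TYPE('a)"
proof -
  let ?m = "\<lambda>f x. cis (- (x \<bullet> t)) * f x"
  have "cis (- (x \<bullet> t)) * conv f g x = conv (?m f) (?m g) x" for x
  proof -
    have "cis (- (x \<bullet> t)) * (f (x - y) * g y) = ?m f (x - y) * ?m g y" for y
    proof -
      have "cis (- (x \<bullet> t)) = cis (- ((x - y) \<bullet> t)) * cis (- (y \<bullet> t))"
        by (simp add: cis_mult inner_diff_left)
      then show ?thesis by (simp only: mult_ac)
    qed
    then show ?thesis unfolding conv_def by (simp only: integral_mult_right_zero[symmetric])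
  qed
  then have "(LBINT x. ?m (conv f g) x) = (LBINT x. ?m f x) * (LBINT x. ?m g x)"
    using integral_conv[of "?m f" "?m g"] integrable_cis_mult[OF f] integrable_cis_mult[OF g] by simp
  then show ?thesis by (simp add: FT_def)
qed

lemma norm_conv_le:
  assumes g: "integrable lborel g" and B: "\<And>x. cmod (f x) \<le> B"
  shows "cmod (conv f g x) \<le> B * (LBINT y. cmod (g y))"
proof -
  have "B \<ge> 0" using B[of 0] norm_ge_zero order_trans by blast
  have "cmod (conv f g x) \<le> (LBINT y. cmod (f (x - y) * g y))"
    unfolding conv_def by (rule integral_norm_bound)
  also have "\<dots> \<le> (LBINT y. B * cmod (g y))"
    using g B \<open>B \<ge> 0\<close> by (intro integral_mono') (auto simp: norm_mult intro: mult_right_mono)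
  finally show ?thesis by simp
qed

lemma continuous_conv:
  fixes f g :: "'a::euclidean_space \<Rightarrow> complex"
  assumes f: "integrable lborel f" and [measurable]: "g \<in> borel_measurable borel"
    and B: "\<And>x. cmod (g x) \<le> B"
    and cont: "\<And>x. AE y in lborel. isCont g (x - y)"
  shows "continuous_on UNIV (conv f g)"
proof -
  have [measurable]: "f \<in> borel_measurable borel" using f by auto
  have "continuous_on UNIV (conv g f)"
  proof (rule continuous_on_sequentiallyI)
    fix u :: "nat \<Rightarrow> 'a" and a assume u: "u \<longlonglongrightarrow> a"
    show "(\<lambda>n. conv g f (u n)) \<longlonglongrightarrow> conv g f a"
      unfolding conv_def
    proof (rule integral_dominated_convergence[where w = "\<lambda>x. B * cmod (f x)"])
      show "AE y in lborel. (\<lambda>n. g (u n - y) * f y) \<longlonglongrightarrow> g (a - y) * f y"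
        using cont[of a]
      proof eventually_elim
        case (elim y)
        have "(\<lambda>n. u n - y) \<longlonglongrightarrow> a - y" using u by (intro tendsto_intros)
        then show ?case by (intro tendsto_mult tendsto_const isCont_tendsto_compose[OF elim])
      qed
    qed (use f B in \<open>auto simp: norm_mult intro!: AE_I2 mult_right_mono\<close>)
  qed
  then show ?thesis by (simp add: conv_commute)
qed

lemma conv_support:
  fixes f g :: "'a::euclidean_space \<Rightarrow> complex"
  assumes f: "\<And>x. norm x > R \<Longrightarrow> f x = 0" and g: "\<And>x. norm x > S \<Longrightarrow> g x = 0" and x: "norm x > R + S"
  shows "conv f g x = 0"
proof -
  have "f (x - y) * g y = 0" for y
  proof (cases "norm y > S")
    case False
    have "norm x \<le> norm (x - y) + norm y" by norm
    then have "norm (x - y) > R" using x False by linarith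
    then show ?thesis using f by simp
  qed (simp add: g)
  then show ?thesis unfolding conv_def by (simp only: integral_zero)
qed

text \<open>Being a nonnegative real is expressed for complex values as
  \<open>z = of_real (cmod z)\<close>, the form that \<open>integrable_FT_nonneg\<close>
  expects.\<close>

lemma conv_nonneg:
  assumes f: "\<And>x. f x = complex_of_real (cmod (f x))" and g: "\<And>x. g x = complex_of_real (cmod (g x))"
  shows "conv f g x = of_real (cmod (conv f g x))"
proof -
  have "f (x - y) * g y = of_real (cmod (f (x - y)) * cmod (g y))" for y
    by (subst f, subst g) simp
  then have *: "conv f g x = of_real (LBINT y. cmod (f (x - y)) * cmod (g y))"
    unfolding conv_def by (simp del: of_real_mult)
  then have "cmod (conv f g x) = (LBINT y. cmod (f (x - y)) * cmod (g y))"
    unfolding * by simp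
  then show ?thesis using * by simp
qed

lemma conv_even:
  assumes "\<And>x. f (- x) = f x" "\<And>x. g (- x) = g x"
  shows "conv f g (- x) = conv f g x"
proof -
  have "conv f g (- x) = (LBINT y. f (- (x - y)) * g (- y))"
    unfolding conv_def using lborel_integral_uminus[of "\<lambda>y. f (- x - y) * g y"] by simp
  then show ?thesis unfolding assms conv_def .
qed

section \<open>The mollifier built from the indicator of a ball\<close>

lemma ind_B4_simps [simp]:
  "cmod (ind_B4 x) \<le> 1" "ind_B4 (- x) = ind_B4 x" "norm x > 1/4 \<Longrightarrow> ind_B4 x = 0"
  "complex_of_real (cmod (ind_B4 x)) = ind_B4 x" "cnj (ind_B4 x) = ind_B4 x"
  by (auto simp: ind_B4_def)

lemma ind_B4_eq: "ind_B4 = (\<lambda>x::'a::euclidean_space. complex_of_real (indicator (cball 0 (1/4)) x))"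
  by (auto simp: ind_B4_def indicator_def fun_eq_iff)

lemma measurable_ind_B4 [measurable]: "(ind_B4 :: 'a::euclidean_space \<Rightarrow> complex) \<in> borel_measurable borel"
proof -
  have [measurable]: "cball 0 (1/4) \<in> sets (borel :: 'a measure)" by simp
  show ?thesis unfolding ind_B4_eq by measurable
qed

lemma integrable_ind_B4: "integrable lborel ind_B4"
  unfolding ind_B4_eq
  by (intro integrable_of_real integrable_real_indicator emeasure_lborel_cball_finite) auto

lemma integral_ind_B4: "(\<integral>x. ind_B4 x \<partial>(lborel :: 'a::euclidean_space measure)) \<noteq> 0"
proof -
  have "(\<integral>x. ind_B4 x \<partial>(lborel :: 'a measure)) = of_real (measure lborel (cball 0 (1/4) :: 'a set))"
    unfolding ind_B4_eq by simp
  moreover have "measure lborel (cball 0 (1/4) :: 'a set) > 0"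
    using content_cball_pos[of "1/4" "0::'a"] by (simp add: measure_completion)
  ultimately show ?thesis by simp
qed

text \<open>The discontinuities of the indicator lie on a sphere, which is a null set.\<close>

lemma AE_isCont_ind_B4: "AE y in lborel. isCont ind_B4 (x - y :: 'a::euclidean_space)"
proof -
  have "negligible (sphere x (1/4))" by (rule negligible_sphere)
  then have "AE y in lebesgue. y \<notin> sphere x (1/4)"
    by (intro AE_not_in) (simp add: negligible_iff_null_sets)
  then have "AE y in lborel. y \<notin> sphere x (1/4)" by (simp add: AE_completion_iff)
  then show ?thesis
  proof eventually_elim
    case (elim y)
    have "x - y \<notin> frontier (cball 0 (1/4))" using elim by (simp add: dist_norm norm_minus_commute)
    then show ?case
      unfolding ind_B4_eq
      by (intro continuous_intros) (simp add: isCont_indicator)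
  qed
qed

definition bump :: "'a::euclidean_space \<Rightarrow> complex" where
  "bump = conv (conv (conv ind_B4 ind_B4) ind_B4) ind_B4"

lemma integrable_bump: "integrable lborel bump"
  unfolding bump_def by (intro integrable_conv integrable_ind_B4)

lemma bump_nonneg: "bump x = complex_of_real (cmod (bump x))"
  unfolding bump_def by (intro conv_nonneg) simp_all

lemma bump_even: "bump (- x) = bump x"
  unfolding bump_def by (intro conv_even) simp_all

text \<open>Radii of supports add under convolution, and there are four balls of radius
  \<open>1/4\<close>.\<close>

lemma bump_support: "norm x > 1 \<Longrightarrow> bump x = 0"
  unfolding bump_def by (rule conv_support[where R = "3/4" and S = "1/4"],
    rule conv_support[where R = "1/2" and S = "1/4"], rule conv_support[where R = "1/4" and S = "1/4"]) auto

lemma continuous_bump: "continuous_on UNIV bump"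
  unfolding bump_def
  by (intro continuous_conv[where B = 1] integrable_conv integrable_ind_B4 AE_isCont_ind_B4) auto

lemma bounded_bump: "\<exists>B. \<forall>x. cmod (bump x) \<le> B"
  unfolding bump_def
  using norm_conv_le[OF integrable_conv[OF integrable_conv[OF integrable_ind_B4 integrable_ind_B4] integrable_ind_B4], of ind_B4 1]
  by (subst conv_commute) auto

lemma integral_bump:
  "(\<integral>x. bump x \<partial>(lborel :: 'a::euclidean_space measure)) = complex_of_real (\<integral>x. cmod (bump x) \<partial>(lborel :: 'a measure))"
  "(\<integral>x. cmod (bump x) \<partial>(lborel :: 'a measure)) > 0"
proof -
  show 1: "(\<integral>x. bump x \<partial>(lborel :: 'a measure)) = complex_of_real (\<integral>x. cmod (bump x) \<partial>(lborel :: 'a measure))"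
    by (subst bump_nonneg) simp
  have "(\<integral>x. bump x \<partial>(lborel :: 'a measure)) \<noteq> 0"
    unfolding bump_def using integral_ind_B4[where 'a = 'a]
    by (simp add: integral_conv integrable_conv integrable_ind_B4)
  then have "(\<integral>x. cmod (bump x) \<partial>(lborel :: 'a measure)) \<noteq> 0" using 1 by auto
  then show "(\<integral>x. cmod (bump x) \<partial>(lborel :: 'a measure)) > 0"
    by (simp add: order_less_le)
qed

lemma cnj_FT: "cnj (FT f t) = FT (\<lambda>x. cnj (f x)) (- t)"
  using Bochner_Integration.integral_cnj[of lborel "\<lambda>x. cis (- (x \<bullet> t)) * f x"] by (simp add: FT_def ft_const_def cis_cnj)

lemma FT_uminus_arg: "FT f (- t) = FT (\<lambda>x. f (- x)) t"
  using lborel_integral_uminus[of "\<lambda>x. cis (x \<bullet> t) * f x"] by (simp add: FT_def)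

text \<open>The indicator is real and even, so its transform is real. The fourfold convolution
  produces the fourth power of a real number, which is nonnegative, and
  \<open>integrable_FT_nonneg\<close> applies.\<close>

lemma integrable_FT_bump: "integrable lborel (FT bump)"
proof -
  obtain B where B: "\<And>x :: 'a. cmod (bump x) \<le> B" using bounded_bump by blast
  let ?r = "\<lambda>t::'a. FT ind_B4 t"
  have "cnj (?r t) = ?r t" for t
    by (simp add: cnj_FT FT_uminus_arg)
  then have r: "?r t = of_real (Re (?r t))" for t by (simp add: complex_eq_iff)
  let ?c = "inverse ((2 * pi) ^ DIM('a))"
  have nonneg: "z = of_real (cmod z)" if "z = complex_of_real r" "r \<ge> 0" for z r
    using that by simp
  have "FT bump t = (?r t) ^ 4 / of_real ?c ^ 3" for t
    \<comment> \<open>The three convolutions contribute the three factors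
      \<open>1 / ft_const\<close>.\<close>
    unfolding bump_def ft_const_def[of "TYPE('a)", symmetric]
    by (simp add: FT_conv integrable_conv integrable_ind_B4 power4_eq_xxxx power3_eq_cube)
  also have "(?r t) ^ 4 / of_real ?c ^ 3 = complex_of_real (Re (?r t) ^ 4 / ?c ^ 3)" for t
    by (subst r) simp
  finally have "FT bump t = complex_of_real (Re (?r t) ^ 4 / ?c ^ 3)" for t .
  then have "FT bump t = of_real (cmod (FT bump t))" for t :: 'a
    by (rule nonneg) simp
  then show ?thesis
    by (rule integrable_FT_nonneg[OF integrable_bump B])
qed

lemma e0_eq:
  fixes x :: "'a::euclidean_space"
  shows "e0 x = bump x / complex_of_real (\<integral>y. cmod (bump y) \<partial>(lborel :: 'a measure))"
  by (simp add: e0_def bump_def Let_def)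

lemma en_eq: "en n x = of_real (real n ^ DIM('a)) * e0 (real n *\<^sub>R x)" for x :: "'a::euclidean_space"
  by (simp add: en_def)

lemma e0_facts:
  "integrable lborel (e0 :: 'a::euclidean_space \<Rightarrow> complex)"
  "(\<integral>x. e0 x \<partial>(lborel :: 'a measure)) = 1"
  "continuous_on UNIV (e0 :: 'a \<Rightarrow> complex)"
  "integrable lborel (FT (e0 :: 'a \<Rightarrow> complex))"
  "e0 (- x) = e0 (x :: 'a)"
  "e0 x = of_real (cmod (e0 (x :: 'a)))"
  "norm x > 1 \<Longrightarrow> e0 (x :: 'a) = 0"
proof -
  let ?Z = "\<integral>y. cmod (bump y) \<partial>(lborel :: 'a measure)"
  have e: "e0 = (\<lambda>x::'a. bump x / of_real ?Z)" by (simp add: fun_eq_iff e0_eq)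
  have Z: "?Z > 0" by (rule integral_bump)
  show "integrable lborel (e0 :: 'a \<Rightarrow> complex)" unfolding e by (intro integrable_divide integrable_bump)
  show "(\<integral>x. e0 x \<partial>(lborel :: 'a measure)) = 1" unfolding e using integral_bump[where 'a = 'a] by simp
  show "continuous_on UNIV (e0 :: 'a \<Rightarrow> complex)" unfolding e using Z by (intro continuous_intros continuous_bump) auto
  have "FT (e0 :: 'a \<Rightarrow> complex) = (\<lambda>t. FT bump t / of_real ?Z)" unfolding e by (simp add: FT_def fun_eq_iff)
  then show "integrable lborel (FT (e0 :: 'a \<Rightarrow> complex))" by (simp add: integrable_FT_bump)
  show "e0 (- x) = e0 x" by (simp add: e bump_even)
  show "e0 x = of_real (cmod (e0 x))" unfolding e using Z by (subst bump_nonneg) (simp add: norm_divide)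
  show "norm x > 1 \<Longrightarrow> e0 x = 0" by (simp add: e bump_support)
qed

lemma FT_en: "n \<ge> 1 \<Longrightarrow> FT (en n) t = FT e0 (t /\<^sub>R real n)" for t :: "'a::euclidean_space"
proof -
  assume n: "n \<ge> 1"
  have "(LBINT x. cis (- (x \<bullet> t)) * en n x)
    = of_real (real n ^ DIM('a)) * (LBINT x. (\<lambda>y. cis (- (y \<bullet> (t /\<^sub>R real n))) * e0 y) (real n *\<^sub>R x))"
    unfolding integral_mult_right_zero[symmetric] en_eq
    using n by (intro Bochner_Integration.integral_cong refl) (simp add: field_simps)
  also have "\<dots> = (LBINT y. cis (- (y \<bullet> (t /\<^sub>R real n))) * e0 y)"
    using n by (subst lborel_integral_scale) auto
  finally show ?thesis by (simp add: FT_def)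
qed

lemma en_facts:
  assumes n: "n \<ge> 1"
  shows integrable_en: "integrable lborel (en n :: 'a::euclidean_space \<Rightarrow> complex)"
  and integral_en: "(\<integral>x. en n x \<partial>(lborel :: 'a measure)) = 1"
  and continuous_en: "continuous_on UNIV (en n :: 'a \<Rightarrow> complex)"
  and integrable_FT_en: "integrable lborel (FT (en n :: 'a \<Rightarrow> complex))"
  and en_even: "en n (- x) = en n (x :: 'a)"
  and en_nonneg: "en n x = of_real (cmod (en n (x :: 'a)))"
  and en_support: "norm x > 1 / real n \<Longrightarrow> en n (x :: 'a) = 0"
  and integral_norm_en: "(\<integral>x. cmod (en n x) \<partial>(lborel :: 'a measure)) = 1"
proof -
  have e: "en n = (\<lambda>x::'a. of_real (real n ^ DIM('a)) * e0 (real n *\<^sub>R x))" by (simp add: fun_eq_iff en_eq)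
  show "integrable lborel (en n :: 'a \<Rightarrow> complex)" unfolding e using n
    by (intro integrable_mult_right, subst lborel_integrable_scale) (auto simp: e0_facts(1-4))
  show 1: "(\<integral>x. en n x \<partial>(lborel :: 'a measure)) = 1"
    unfolding e integral_mult_right_zero using n by (subst lborel_integral_scale) (auto simp: e0_facts(1-4))
  show "continuous_on UNIV (en n :: 'a \<Rightarrow> complex)" unfolding e
    by (intro continuous_intros continuous_on_compose2[OF e0_facts(3)]) auto
  have "FT (en n :: 'a \<Rightarrow> complex) = (\<lambda>t. FT e0 (inverse (real n) *\<^sub>R t))"
    by (simp add: fun_eq_iff FT_en[OF n])
  then show "integrable lborel (FT (en n :: 'a \<Rightarrow> complex))"
    using n by (simp, subst lborel_integrable_scale) (auto simp: e0_facts(1-4))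
  show "en n (- x) = en n (x :: 'a)" by (simp add: e e0_facts(5))
  show nn: "en n x = of_real (cmod (en n (x :: 'a)))" for x
    unfolding e by (subst e0_facts(6)) (simp add: norm_mult norm_power)
  show "norm x > 1 / real n \<Longrightarrow> en n (x :: 'a) = 0"
    using n by (simp add: e e0_facts(7) field_simps)
  have "complex_of_real (\<integral>x. cmod (en n x) \<partial>(lborel :: 'a measure)) = 1"
    unfolding integral_complex_of_real[symmetric] nn[symmetric] by (rule 1)
  then show "(\<integral>x. cmod (en n x) \<partial>(lborel :: 'a measure)) = 1" by (simp only: of_real_eq_1_iff)
qed

section \<open>Complex densities as combinations of four positive measures\<close>

definition pos_meas :: "('a::euclidean_space \<Rightarrow> complex) \<Rightarrow> 'a measure" where
  "pos_meas u = density lborel (\<lambda>x. ennreal (max 0 (Re (u x))))"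

lemma pos_meas:
  assumes u: "integrable lborel (u :: 'a::euclidean_space \<Rightarrow> complex)"
  shows fin_borel_pos_meas: "fin_borel (pos_meas u)"
    and measure_pos_meas_le: "measure (pos_meas u) UNIV \<le> (LBINT x. cmod (u x))"
    and integral_pos_meas: "a \<in> borel_measurable borel \<Longrightarrow>
      (\<integral>x. a x \<partial>pos_meas u) = (LBINT x. of_real (max 0 (Re (u x))) * (a x :: complex))"
proof -
  have [measurable]: "u \<in> borel_measurable borel" using u by auto
  have le: "emeasure (pos_meas u) UNIV \<le> ennreal (LBINT x. cmod (u x))"
  proof -
    have "emeasure (pos_meas u) UNIV = (\<integral>\<^sup>+x. ennreal (max 0 (Re (u x))) \<partial>lborel)"
      by (simp add: pos_meas_def emeasure_density)
    also have "\<dots> \<le> (\<integral>\<^sup>+x. ennreal (cmod (u x)) \<partial>lborel)"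
      by (intro nn_integral_mono ennreal_leI) (simp add: complex_Re_le_cmod)
    also have "\<dots> = ennreal (LBINT x. cmod (u x))"
      using u by (intro nn_integral_eq_integral) auto
    finally show ?thesis .
  qed
  then show "fin_borel (pos_meas u)"
    unfolding fin_borel_def by (auto simp: pos_meas_def intro!: finite_measureI simp: top_unique)
  show "measure (pos_meas u) UNIV \<le> (LBINT x. cmod (u x))"
    unfolding measure_def using le by (intro enn2real_leI) auto
  show "(\<integral>x. a x \<partial>pos_meas u) = (LBINT x. of_real (max 0 (Re (u x))) * a x)"
    if [measurable]: "a \<in> borel_measurable borel"
    unfolding pos_meas_def by (subst integral_density) (auto simp: scaleR_conv_of_real)
qed

text \<open>Multiplying \<open>u\<close> by 1, -1, \<open>-\<i>\<close> and \<open>\<i>\<close>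
  before taking the positive part of the real part yields the positive and negative parts of
  \<open>Re u\<close> and of \<open>Im u\<close>, because
  \<open>Re (- \<i> * u x) = Im (u x)\<close>.\<close>

lemma integral_pos_meas_decomp:
  assumes u: "integrable lborel (u :: 'a::euclidean_space \<Rightarrow> complex)"
    and [measurable]: "a \<in> borel_measurable borel" and C: "\<And>x. cmod (a x) \<le> C"
  shows "(LBINT x. a x * u x) = (\<integral>x. a x \<partial>pos_meas u) - (\<integral>x. a x \<partial>pos_meas (\<lambda>x. - u x))
    + \<i> * ((\<integral>x. a x \<partial>pos_meas (\<lambda>x. - \<i> * u x)) - (\<integral>x. a x \<partial>pos_meas (\<lambda>x. \<i> * u x)))"
proof -
  have [measurable]: "u \<in> borel_measurable borel" using u by auto
  have int: "integrable lborel (\<lambda>x. of_real (max 0 (Re (c * u x))) * a x)" for c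
  proof -
    have "integrable lborel (\<lambda>x. complex_of_real (Re (c * u x)))" using u by (intro integrable_of_real integrable_Re) auto
    then have "integrable lborel (\<lambda>x. complex_of_real (max 0 (Re (c * u x))))"
      unfolding complex_of_real_integrable_eq by (intro integrable_max) auto
    from integrable_bounded_mult[OF this C] show ?thesis by (simp add: mult.commute)
  qed
  have eq: "a x * u x = of_real (max 0 (Re (u x))) * a x - of_real (max 0 (Re (- u x))) * a x
      + \<i> * (of_real (max 0 (Re (- \<i> * u x))) * a x - of_real (max 0 (Re (\<i> * u x))) * a x)" for x
  proof -
    have "u x = of_real (max 0 (Re (u x))) - of_real (max 0 (Re (- u x)))
      + \<i> * (of_real (max 0 (Re (- \<i> * u x))) - of_real (max 0 (Re (\<i> * u x))))"
      by (simp add: complex_eq_iff max_def)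
    then have "u x * a x = (of_real (max 0 (Re (u x))) - of_real (max 0 (Re (- u x)))
      + \<i> * (of_real (max 0 (Re (- \<i> * u x))) - of_real (max 0 (Re (\<i> * u x))))) * a x" by (rule arg_cong)
    then show ?thesis by (simp add: algebra_simps)
  qed
  note i = int[of 1, simplified] int[of "-1", simplified] int[of "-\<i>"] int[of "\<i>"]
  show ?thesis
    unfolding eq using i u
    by (simp add: integral_pos_meas)
qed

lemma B_FS_I:
  assumes u: "integrable lborel (u :: 'a::euclidean_space \<Rightarrow> complex)"
    and k: "\<And>x. k x = (LBINT t. cis (x \<bullet> t) * u t)"
  shows "k \<in> B_FS"
  unfolding B_FS_def
proof (intro CollectI exI conjI allI)
  show "k x = (\<integral>t. cis (x \<bullet> t) \<partial>pos_meas u) - (\<integral>t. cis (x \<bullet> t) \<partial>pos_meas (\<lambda>x. - u x))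
    + \<i> * ((\<integral>t. cis (x \<bullet> t) \<partial>pos_meas (\<lambda>x. - \<i> * u x)) - (\<integral>t. cis (x \<bullet> t) \<partial>pos_meas (\<lambda>x. \<i> * u x)))" for x
    unfolding k by (rule integral_pos_meas_decomp[OF u, where C = 1]) auto
qed (use u in \<open>auto intro!: fin_borel_pos_meas\<close>)

section \<open>Compactly supported functions with integrable transform\<close>

lemma FT_add: "integrable lborel f \<Longrightarrow> integrable lborel g \<Longrightarrow> FT (\<lambda>x. f x + g x) t = FT f t + FT g t"
  by (simp add: FT_def integrable_cis_mult distrib_left)

lemma FT_cmult: "FT (\<lambda>x. c * f x) t = c * FT f t"
proof -
  have "cis (- (x \<bullet> t)) * (c * f x) = c * (cis (- (x \<bullet> t)) * f x)" for x by simp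
  then show ?thesis unfolding FT_def by (simp only: integral_mult_right_zero mult.left_commute)
qed

lemma FT_diff: "integrable lborel f \<Longrightarrow> integrable lborel g \<Longrightarrow> FT (\<lambda>x. f x - g x) t = FT f t - FT g t"
  by (simp add: FT_def integrable_cis_mult right_diff_distrib)

text \<open>The analogue of \<open>FT_gauss_mean\<close> for measures: damping the function
  synthesized from \<mu> replaces \<mu> by its convolution with \<open>gkern s\<close>, which is an
  honest function.\<close>

lemma gauss_mean_FT_meas:
  fixes \<mu> :: "'a::euclidean_space measure"
  assumes \<mu>: "fin_borel \<mu>" and s: "s > 0"
  shows "FT (\<lambda>x. of_real (gauss (x /\<^sub>R s)) * (\<integral>y. cis (x \<bullet> y) \<partial>\<mu>)) t = (\<integral>y. of_real (gkern s (y - t)) \<partial>\<mu>)"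
proof -
  interpret finite_measure \<mu> using \<mu> by (simp add: fin_borel_def)
  have [measurable_cong]: "sets \<mu> = sets borel" using \<mu> by (simp add: fin_borel_def)
  let ?G = "\<lambda>x. cis (x \<bullet> (- t)) * complex_of_real (gauss (x /\<^sub>R s))"
  have "(LBINT x. ?G x * (\<integral>y. cis (x \<bullet> y) * 1 \<partial>\<mu>)) = (\<integral>y. 1 * (LBINT x. cis (x \<bullet> y) * ?G x) \<partial>\<mu>)"
    by (rule Fubini_bounded_kernel[where C = 1])
      (use cis_gauss_scaled(1)[OF s, of "- t"] in \<open>auto intro: lborel.sigma_finite_measure_axioms sigma_finite_measure_axioms\<close>)
  also have "\<dots> = (\<integral>y. of_real ((2 * pi) ^ DIM('a)) * of_real (gkern s (y - t)) \<partial>\<mu>)"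
  proof (intro Bochner_Integration.integral_cong refl)
    fix y
    have "(LBINT x. cis (x \<bullet> y) * ?G x) = (LBINT x. cis (x \<bullet> (y - t)) * of_real (gauss (x /\<^sub>R s)))"
      by (simp add: mult.assoc[symmetric] cis_mult inner_diff_right)
    then show "1 * (LBINT x. cis (x \<bullet> y) * ?G x) = of_real ((2 * pi) ^ DIM('a)) * of_real (gkern s (y - t))"
      using cis_gauss_scaled(2)[OF s, of "y - t"] by simp
  qed
  finally have "(LBINT x. ?G x * (\<integral>y. cis (x \<bullet> y) \<partial>\<mu>))
      = of_real ((2 * pi) ^ DIM('a)) * (\<integral>y. of_real (gkern s (y - t)) \<partial>\<mu>)"
    by (simp only: mult_1_right integral_mult_right_zero)
  then have "FT (\<lambda>x. of_real (gauss (x /\<^sub>R s)) * (\<integral>y. cis (x \<bullet> y) \<partial>\<mu>)) t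
      = (ft_const TYPE('a) * of_real ((2 * pi) ^ DIM('a))) * (\<integral>y. of_real (gkern s (y - t)) \<partial>\<mu>)"
    by (simp add: FT_def mult.assoc)
  then show ?thesis unfolding ft_const_mult by simp
qed

lemma nn_integral_gkern:
  assumes "s > 0"
  shows "(\<integral>\<^sup>+t. ennreal (gkern s (y - t :: 'a::euclidean_space)) \<partial>lborel) = 1"
proof -
  have int: "integrable lborel (\<lambda>t. complex_of_real (gkern s (y - t)))"
    using integrable_gkern[OF assms, where 'a = 'a]
      lborel_integrable_reflect[of "\<lambda>t. complex_of_real (gkern s t)" y] by simp
  have "complex_of_real (LBINT t. gkern s (y - t)) = 1"
    using lborel_integral_reflect[of "\<lambda>t. complex_of_real (gkern s t)" y] integral_gkern[OF assms, where 'a = 'a]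
    by (simp flip: integral_complex_of_real del: integral_complex_of_real)
  then have "(LBINT t. gkern s (y - t)) = 1" by (simp only: of_real_eq_1_iff)
  then show ?thesis
    using int assms by (subst nn_integral_eq_integral) (auto simp: complex_of_real_integrable_eq gkern_nonneg)
qed

text \<open>By Tonelli, averaging against a probability density does not increase the total mass.
  What matters is that the bound is independent of \<open>s\<close>.\<close>

lemma nn_integral_gauss_mean:
  fixes \<mu> :: "'a::euclidean_space measure"
  assumes \<mu>: "fin_borel \<mu>" and s: "s > 0"
  shows "(\<integral>\<^sup>+t. ennreal (cmod (\<integral>y. complex_of_real (gkern s (y - t)) \<partial>\<mu>)) \<partial>lborel) \<le> emeasure \<mu> UNIV"
proof -
  interpret finite_measure \<mu> using \<mu> by (simp add: fin_borel_def)
  have sets [measurable_cong]: "sets \<mu> = sets borel" using \<mu> by (simp add: fin_borel_def)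
  interpret P: pair_sigma_finite "lborel :: 'a measure" \<mu>
    by (simp add: pair_sigma_finite_def lborel.sigma_finite_measure_axioms sigma_finite_measure_axioms)
  have "(\<integral>\<^sup>+t. ennreal (cmod (\<integral>y. complex_of_real (gkern s (y - t)) \<partial>\<mu>)) \<partial>lborel)
      \<le> (\<integral>\<^sup>+t. (\<integral>\<^sup>+y. ennreal (gkern s (y - t)) \<partial>\<mu>) \<partial>lborel)"
  proof (rule nn_integral_mono)
    fix t :: 'a
    have "integrable \<mu> (\<lambda>y. complex_of_real (gkern s (y - t)))"
      by (rule integrable_const_bound[where B = "(s / sqrt (2 * pi)) ^ DIM('a)"])
        (use s in \<open>auto simp: gkern_nonneg intro: gkern_le\<close>)
    from integral_norm_bound_ennreal[OF this]
    show "ennreal (cmod (\<integral>y. complex_of_real (gkern s (y - t)) \<partial>\<mu>)) \<le> (\<integral>\<^sup>+y. ennreal (gkern s (y - t)) \<partial>\<mu>)"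
      using s by (simp add: gkern_nonneg)
  qed
  also have "\<dots> = (\<integral>\<^sup>+y. (\<integral>\<^sup>+t. ennreal (gkern s (y - t)) \<partial>lborel) \<partial>\<mu>)"
    by (rule P.Fubini'[symmetric]) measurable
  also have "\<dots> = emeasure \<mu> UNIV"
    using sets_eq_imp_space_eq[OF sets] by (simp add: nn_integral_gkern[OF s])
  finally show ?thesis .
qed

text \<open>The damped versions of \<open>k\<close> have transforms whose L1 norms are bounded by
  the total masses of the four measures. They converge pointwise to \<open>FT k\<close> because
  \<open>k\<close> is integrable, so Fatou's lemma applies.\<close>

lemma integrable_FT_B_FS:
  fixes k :: "'a::euclidean_space \<Rightarrow> complex"
  assumes k: "k \<in> B_FS" and int: "integrable lborel k"
  shows "integrable lborel (FT k)"
proof -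
  obtain \<mu>1 \<mu>2 \<mu>3 \<mu>4 :: "'a measure" where fin: "fin_borel \<mu>1" "fin_borel \<mu>2" "fin_borel \<mu>3" "fin_borel \<mu>4"
    and k_eq: "\<And>x. k x = (\<integral>t. cis (x \<bullet> t) \<partial>\<mu>1) - (\<integral>t. cis (x \<bullet> t) \<partial>\<mu>2)
      + \<i> * ((\<integral>t. cis (x \<bullet> t) \<partial>\<mu>3) - (\<integral>t. cis (x \<bullet> t) \<partial>\<mu>4))"
    using k unfolding B_FS_def by blast
  let ?A = "\<lambda>n \<mu> t. (\<integral>y. complex_of_real (gkern (real (Suc n)) (y - t)) \<partial>\<mu>)"
  let ?g = "\<lambda>n x::'a. complex_of_real (gauss (x /\<^sub>R real (Suc n)))"
  let ?E = "\<lambda>n \<mu> t. ennreal (cmod (?A n \<mu> t))"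
  let ?J = "\<lambda>n \<mu> x. ?g n x * (\<integral>y. cis (x \<bullet> y) \<partial>\<mu>)"
  let ?F = "\<lambda>n. FT (\<lambda>x. ?g n x * k x)"
  have g1: "cmod (?g n x) \<le> 1" for n x by (simp add: gauss_le_1 del: of_nat_Suc)
  have intF: "integrable lborel (\<lambda>x. ?g n x * k x)" for n
    by (rule integrable_bounded_mult[OF int g1]) measurable
  have [measurable]: "k \<in> borel_measurable borel" using int by auto
  have F_eq: "?F n t = ?A n \<mu>1 t - ?A n \<mu>2 t + \<i> * (?A n \<mu>3 t - ?A n \<mu>4 t)" for n t
  proof -
    have i: "integrable lborel (\<lambda>x. ?J n \<mu> x)"
      if \<mu>: "fin_borel \<mu>" for \<mu>
    proof -
      interpret finite_measure \<mu> using \<mu> by (simp add: fin_borel_def)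
      have [measurable_cong]: "sets \<mu> = sets borel" using \<mu> by (simp add: fin_borel_def)
      have "cmod (\<integral>y. cis (x \<bullet> y) \<partial>\<mu>) \<le> measure \<mu> (space \<mu>)" for x
        by (rule order_trans[OF integral_norm_bound]) simp
      moreover have "integrable lborel (?g n)"
        using cis_gauss_scaled(1)[of "real (Suc n)" "0::'a"] by (simp del: of_nat_Suc)
      ultimately have "integrable lborel (\<lambda>x. (\<integral>y. cis (x \<bullet> y) \<partial>\<mu>) * ?g n x)"
        by (intro integrable_bounded_mult) auto
      then show ?thesis by (simp only: mult.commute)
    qed
    have "(\<lambda>x. ?g n x * k x) = (\<lambda>x. (?J n \<mu>1 x - ?J n \<mu>2 x)
      + \<i> * (?J n \<mu>3 x - ?J n \<mu>4 x))"
      unfolding k_eq by (simp add: algebra_simps)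
    then have "?F n t = FT (?J n \<mu>1) t - FT (?J n \<mu>2) t
      + \<i> * (FT (?J n \<mu>3) t - FT (?J n \<mu>4) t)"
      by (simp only: FT_add FT_diff FT_cmult i fin Bochner_Integration.integrable_diff integrable_mult_right)
    then show ?thesis
      using fin by (simp only: gauss_mean_FT_meas of_nat_0_less_iff zero_less_Suc)
  qed
  let ?C = "measure \<mu>1 UNIV + measure \<mu>2 UNIV + measure \<mu>3 UNIV + measure \<mu>4 UNIV"
  show ?thesis
  proof (rule integrable_of_tendsto_nn_integral_le[where F = ?F and C = ?C])
    show "?F n \<in> borel_measurable lborel" for n using measurable_FT[OF intF] by simp
    show "FT k \<in> borel_measurable lborel" using measurable_FT[OF int] by simp
    show "(\<lambda>n. ?F n t) \<longlonglongrightarrow> FT k t" for t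
      unfolding FT_def
    proof (intro tendsto_intros integral_dominated_convergence[where w = "\<lambda>x. cmod (k x)"] AE_I2)
      fix x
      have "(\<lambda>n. ?g n x * k x) \<longlonglongrightarrow> of_real 1 * k x"
        by (intro tendsto_intros gauss_scaled_tendsto)
      then show "(\<lambda>n. ?g n x * k x) \<longlonglongrightarrow> k x" by (simp del: of_nat_Suc)
    qed (use int g1 in \<open>auto simp: norm_mult gauss_le_1 mult_left_le_one_le simp del: of_nat_Suc\<close>)
    fix n
    have m: "?A n \<mu> \<in> borel_measurable lborel" if "fin_borel \<mu>" for \<mu>
    proof -
      interpret finite_measure \<mu> using that by (simp add: fin_borel_def)
      have [measurable_cong]: "sets \<mu> = sets borel" using that by (simp add: fin_borel_def)
      show ?thesis by measurable
    qed
    note [measurable] = m[OF fin(1)] m[OF fin(2)] m[OF fin(3)] m[OF fin(4)]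
    have "(\<integral>\<^sup>+t. ennreal (cmod (?F n t)) \<partial>lborel)
        \<le> (\<integral>\<^sup>+t. ?E n \<mu>1 t + ?E n \<mu>2 t + ?E n \<mu>3 t + ?E n \<mu>4 t \<partial>lborel)"
    proof (rule nn_integral_mono)
      fix t
      show "ennreal (cmod (?F n t)) \<le> ?E n \<mu>1 t + ?E n \<mu>2 t + ?E n \<mu>3 t + ?E n \<mu>4 t"
        unfolding F_eq using norm_signed_sum_le by (simp only: ennreal_plus[symmetric] norm_ge_zero add_nonneg_nonneg ennreal_leI)
    qed
    also have "\<dots> = (\<integral>\<^sup>+t. ?E n \<mu>1 t \<partial>lborel) + (\<integral>\<^sup>+t. ?E n \<mu>2 t \<partial>lborel)
        + (\<integral>\<^sup>+t. ?E n \<mu>3 t \<partial>lborel) + (\<integral>\<^sup>+t. ?E n \<mu>4 t \<partial>lborel)"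
      by (subst nn_integral_add; (measurable)?)+
    also have "\<dots> \<le> emeasure \<mu>1 UNIV + emeasure \<mu>2 UNIV + emeasure \<mu>3 UNIV + emeasure \<mu>4 UNIV"
      by (intro add_mono nn_integral_gauss_mean fin) auto
    also have "\<dots> = ennreal ?C"
      using fin by (simp add: fin_borel_def finite_measure.emeasure_eq_measure)
    finally show "(\<integral>\<^sup>+t. ennreal (cmod (?F n t)) \<partial>lborel) \<le> ennreal ?C" .
  qed
qed

section \<open>Test functions, mollification and cutoffs\<close>

definition supp_in :: "real \<Rightarrow> ('a::euclidean_space \<Rightarrow> complex) \<Rightarrow> bool" where
  "supp_in R f \<longleftrightarrow> (\<forall>x. norm x > R \<longrightarrow> f x = 0)"

lemma CcI: "continuous_on UNIV f \<Longrightarrow> supp_in R f \<Longrightarrow> f \<in> Cc"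
  by (auto simp: Cc_def supp_in_def intro!: boundedI[of _ R]) (meson not_le_imp_less)

lemma Cc_supp: "f \<in> Cc \<Longrightarrow> \<exists>R\<ge>0. supp_in R f"
proof -
  assume "f \<in> Cc"
  then obtain R where "\<And>x. f x \<noteq> 0 \<Longrightarrow> norm x \<le> R" by (auto simp: Cc_def bounded_iff)
  then show ?thesis by (intro exI[of _ "max R 0"]) (auto simp: supp_in_def, meson not_less)
qed

lemma Cc_continuous: "f \<in> Cc \<Longrightarrow> continuous_on UNIV f"
  by (simp add: Cc_def)

lemma Cc_measurable [measurable_dest]: "f \<in> Cc \<Longrightarrow> f \<in> borel_measurable borel"
  by (intro borel_measurable_continuous_onI Cc_continuous)

lemma Cc_bounded:
  assumes "f \<in> Cc" shows "\<exists>B\<ge>0. \<forall>x. cmod (f x) \<le> B"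
proof -
  obtain R where R: "supp_in R f" using Cc_supp[OF assms] by blast
  have "compact (f ` cball 0 R)"
    by (intro compact_continuous_image continuous_on_subset[OF Cc_continuous[OF assms]]) auto
  from compact_imp_bounded[OF this] obtain B where B: "\<And>x. norm x \<le> R \<Longrightarrow> cmod (f x) \<le> B"
    unfolding bounded_iff by (metis imageI mem_cball_0)
  have "cmod (f x) \<le> max B 0" for x
    using B[of x] R by (cases "norm x \<le> R") (auto simp: supp_in_def)
  then show ?thesis by (intro exI[of _ "max B 0"]) auto
qed

lemma integrable_bounded_support:
  fixes f :: "'a::euclidean_space \<Rightarrow> complex"
  assumes [measurable]: "f \<in> borel_measurable borel" and B: "\<And>x. cmod (f x) \<le> B" and R: "supp_in R f"
  shows "integrable lborel f"
proof (rule Bochner_Integration.integrable_bound)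
  show "integrable lborel (\<lambda>x. B * indicator (cball 0 R) x :: real)"
    by (intro integrable_mult_right integrable_real_indicator emeasure_lborel_cball_finite) auto
  show "AE x in lborel. cmod (f x) \<le> norm (B * indicator (cball 0 R) x :: real)"
  proof (intro AE_I2)
    fix x
    show "cmod (f x) \<le> norm (B * indicator (cball 0 R) x :: real)"
      using B[of x] R by (cases "norm x \<le> R") (auto simp: supp_in_def)
  qed
qed auto

lemma integrable_Cc: "f \<in> Cc \<Longrightarrow> integrable lborel f"
  using Cc_bounded Cc_supp integrable_bounded_support Cc_measurable by metis

lemma Cc_mult_continuous:
  assumes f: "f \<in> Cc" and g: "continuous_on UNIV g"
  shows "(\<lambda>x. f x * g x) \<in> Cc"
proof -
  obtain R where "supp_in R f" using Cc_supp[OF f] by blast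
  then show ?thesis
    by (intro CcI[of _ R] continuous_on_mult Cc_continuous[OF f] g) (auto simp: supp_in_def)
qed

lemma Cc_uniformly_continuous:
  assumes f: "f \<in> Cc" and e: "e > 0"
  shows "\<exists>d>0. \<forall>x y. norm (x - y) < d \<longrightarrow> cmod (f x - f y) < e"
proof -
  obtain R where R: "supp_in R f" using Cc_supp[OF f] by blast
  have "uniformly_continuous_on (cball 0 (R + 1)) f"
    by (intro compact_uniformly_continuous continuous_on_subset[OF Cc_continuous[OF f]]) auto
  then obtain d where d: "d > 0" "\<And>x y. norm x \<le> R + 1 \<Longrightarrow> norm y \<le> R + 1 \<Longrightarrow> norm (x - y) < d \<Longrightarrow> cmod (f x - f y) < e"
    using e unfolding uniformly_continuous_on_def by (auto simp: dist_norm norm_minus_commute)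
  show ?thesis
  proof (intro exI[of _ "min d 1"] conjI allI impI)
    fix x y :: 'a assume xy: "norm (x - y) < min d 1"
    show "cmod (f x - f y) < e"
    proof (cases "norm x \<le> R + 1 \<and> norm y \<le> R + 1")
      case False
      have "norm x \<le> norm (x - y) + norm y" "norm y \<le> norm (x - y) + norm x" by norm+
      then have "norm x > R" "norm y > R" using False xy by linarith+
      then show ?thesis using R e by (simp add: supp_in_def)
    qed (use d xy in auto)
  qed (use d in auto)
qed

text \<open>The domain of \<open>L\<close>. By \<open>nice_iff\<close> it is exactly the class of
  functions \<open>k\<close> in (b), but integrability of the transform is the property that is
  used.\<close>

definition nice :: "('a::euclidean_space \<Rightarrow> complex) \<Rightarrow> bool" where
  "nice u \<longleftrightarrow> u \<in> Cc \<and> integrable lborel (FT u)"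

lemma nice_inversion:
  assumes "nice u"
  shows "u x = (LBINT t. cis (x \<bullet> t) * FT u t)"
proof -
  obtain B where "\<And>x. cmod (u x) \<le> B" using assms Cc_bounded unfolding nice_def by metis
  then show ?thesis using assms
    by (intro Fourier_inversion) (auto simp: nice_def integrable_Cc Cc_continuous)
qed

lemma nice_iff: "nice k \<longleftrightarrow> k \<in> Cc \<inter> B_FS"
proof
  assume "nice k"
  then show "k \<in> Cc \<inter> B_FS" using B_FS_I[of "FT k" k] nice_inversion[of k] by (auto simp: nice_def)
qed (auto simp: nice_def integrable_FT_B_FS integrable_Cc)

text \<open>The transform is a bounded factor times the integrable \<open>FT (en n)\<close>. Only
  integrability is asked of \<open>v\<close>, so discontinuous test functions can be mollified
  too.\<close>

lemma nice_conv_en: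
  fixes v :: "'a::euclidean_space \<Rightarrow> complex"
  assumes v: "integrable lborel v" "supp_in R v" and n: "n \<ge> 1"
  shows "nice (conv v (en n))"
proof -
  obtain B where B: "\<And>x::'a. cmod (en n x) \<le> B"
    using Cc_bounded[OF CcI[of "en n" "1 / real n"]] continuous_en[OF n] en_support[OF n] by (auto simp: supp_in_def)
  have sup: "supp_in (R + 1 / real n) (conv v (en n))"
    using conv_support[of R v "1 / real n" "en n"] v(2) en_support[OF n] by (auto simp: supp_in_def)
  have c: "continuous_on UNIV (conv v (en n))"
    using continuous_en[OF n, where 'a = 'a]
    by (intro continuous_conv[OF v(1) _ B] AE_I2) (auto simp: continuous_on_eq_continuous_at borel_measurable_continuous_onI)
  have "FT (conv v (en n)) = (\<lambda>t. (FT v t / ft_const TYPE('a)) * FT (en n) t)"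
    by (simp add: fun_eq_iff FT_conv v integrable_en[OF n])
  moreover have "integrable lborel (\<lambda>t. (FT v t / ft_const TYPE('a)) * FT (en n) t)"
    by (rule integrable_bounded_mult[OF integrable_FT_en[OF n], where C = "LBINT x. cmod (v x)"])
      (use v(1) norm_FT_le[of v] in \<open>auto simp: norm_divide field_simps\<close>)
  ultimately show ?thesis using CcI[OF c sup] by (simp add: nice_def)
qed

text \<open>The radius grows by 1 instead of \<open>1 / n\<close>, so that one ball serves all
  mollifications at once.\<close>

lemma supp_in_conv_en:
  assumes v: "supp_in R v" and n: "n \<ge> 1"
  shows "supp_in (R + 1) (conv v (en n))"
proof -
  have "1 / real n \<le> 1" using n by simp
  then have "supp_in 1 (en n)" using en_support[OF n] le_less_trans unfolding supp_in_def by blast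
  then show ?thesis using conv_support[of R v 1 "en n"] v by (auto simp: supp_in_def)
qed

lemma norm_conv_en_le:
  fixes v :: "'a::euclidean_space \<Rightarrow> complex"
  assumes n: "n \<ge> 1" and B: "\<And>x. cmod (v x) \<le> B"
  shows "cmod (conv v (en n) x) \<le> B"
  using norm_conv_le[where f = v, OF integrable_en[OF n] B, of x] by (simp add: integral_norm_en[OF n])

lemma conv_en_uniform:
  fixes f :: "'a::euclidean_space \<Rightarrow> complex"
  assumes f: "f \<in> Cc" and e: "e > 0"
  shows "\<exists>N\<ge>1. \<forall>n\<ge>N. \<forall>x. cmod (conv f (en n) x - f x) \<le> e"
proof -
  obtain d where d: "d > 0" "\<And>x y. norm (x - y) < d \<Longrightarrow> cmod (f x - f y) < e"
    using Cc_uniformly_continuous[OF f e] by metis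
  obtain B where B: "\<And>x. cmod (f x) \<le> B" using Cc_bounded[OF f] by metis
  have [measurable]: "f \<in> borel_measurable borel" using Cc_measurable[OF f] .
  obtain N where N: "N \<ge> 1" "1 / real N < d"
    using ex_inverse_of_nat_less[OF d(1)] by (auto simp: inverse_eq_divide Suc_le_eq)
  show ?thesis
  proof (intro exI[of _ N] conjI allI impI N)
    fix n x assume "n \<ge> N"
    then have n: "n \<ge> 1" using N by simp
    have "1 / real n \<le> 1 / real N" using N \<open>n \<ge> N\<close> by (intro divide_left_mono) auto
    then have n': "1 / real n < d" using N by simp
    note i = integrable_en[OF n, where 'a = 'a]
    have "integrable lborel (\<lambda>y. f (x - y) * en n y)"
      by (rule integrable_bounded_mult[OF i B]) measurable
    then have "conv f (en n) x - f x = (LBINT y. (f (x - y) - f x) * en n y)"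
      using i integral_en[OF n, where 'a = 'a] by (simp add: conv_def left_diff_distrib)
    also have "cmod \<dots> \<le> (LBINT y. cmod ((f (x - y) - f x) * en n y))"
      by (rule integral_norm_bound)
    also have "\<dots> \<le> (\<integral>y. e * cmod (en n y) \<partial>(lborel :: 'a measure))"
    proof (rule integral_mono')
      show "integrable lborel (\<lambda>y::'a. e * cmod (en n y))" using i by simp
      fix y :: 'a
      show "cmod ((f (x - y) - f x) * en n y) \<le> e * cmod (en n y)"
      proof (cases "norm y > 1 / real n")
        case False
        then have "cmod (f (x - y) - f x) < e" using n' by (intro d) auto
        then show ?thesis by (simp add: norm_mult mult_right_mono)
      qed (simp add: en_support[OF n])
    qed (use e in auto)
    also have "\<dots> = e" using integral_norm_en[OF n, where 'a = 'a] by simp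
    finally show "cmod (conv f (en n) x - f x) \<le> e" .
  qed
qed

lemma khat_conv_eq_conv: "khat_conv k \<phi> = conv \<phi> (FT k)"
  by (simp add: khat_conv_def conv_def fun_eq_iff)

text \<open>Multiplication turns into convolution of transforms. Here \<psi> need not be given as
  the transform of an integrable function; this matters for the product of \<phi> with
  \<open>FT (en n)\<close>.\<close>

lemma FT_mult_eq_khat_conv:
  fixes k \<psi> :: "'a::euclidean_space \<Rightarrow> complex"
  assumes k: "integrable lborel k" and \<psi>: "integrable lborel \<psi>"
  shows "FT (\<lambda>x. k x * (LBINT r. cis (x \<bullet> r) * \<psi> r)) t = khat_conv k \<psi> t"
proof -
  have "(LBINT x. (cis (- (x \<bullet> t)) * k x) * (LBINT r. cis (x \<bullet> r) * \<psi> r))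
     = (LBINT r. \<psi> r * (LBINT x. cis (x \<bullet> r) * (cis (- (x \<bullet> t)) * k x)))"
    by (rule Fubini_bounded_kernel[where C = 1])
      (use k \<psi> in \<open>auto intro: lborel.sigma_finite_measure_axioms integrable_cis_mult\<close>)
  then have "FT (\<lambda>x. k x * (LBINT r. cis (x \<bullet> r) * \<psi> r)) t
    = ft_const TYPE('a) * (LBINT r. \<psi> r * (LBINT x. cis (- (x \<bullet> (t - r))) * k x))"
    by (simp add: FT_def mult.assoc[symmetric] cis_mult inner_diff_right)
  also have "\<dots> = (LBINT r. FT k (t - r) * \<psi> r)"
    by (subst integral_mult_right_zero[symmetric]) (simp add: FT_def mult_ac)
  also have "\<dots> = khat_conv k \<psi> t"
    unfolding khat_conv_eq_conv conv_commute[of \<psi>] by (simp add: conv_def)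
  finally show ?thesis .
qed

lemma FT_nice_mult:
  assumes u: "nice u" and f: "integrable lborel f"
  shows "FT (\<lambda>x. u x * f x) t = khat_conv u (FT f) t"
proof -
  have "FT (\<lambda>x. u x * f x) t = FT (\<lambda>x. f x * (LBINT r. cis (x \<bullet> r) * FT u r)) t"
    using nice_inversion[OF u] by (simp add: mult.commute)
  also have "\<dots> = khat_conv f (FT u) t"
    using u f by (intro FT_mult_eq_khat_conv) (auto simp: nice_def)
  finally show ?thesis by (simp add: khat_conv_eq_conv conv_commute)
qed

text \<open>Mollifying with \<open>en 1\<close>, whose support has radius 1, leaves the value 1 on
  the ball of radius \<open>R\<close> and spreads the support to radius
  \<open>R + 2\<close>.\<close>

definition cutoff :: "real \<Rightarrow> 'a::euclidean_space \<Rightarrow> complex" where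
  "cutoff R = conv (\<lambda>x. of_real (indicator (cball 0 (R + 1)) x)) (en 1)"

lemma
  fixes x :: "'a::euclidean_space"
  shows nice_cutoff: "nice (cutoff R :: 'a \<Rightarrow> complex)"
  and supp_in_cutoff: "supp_in (R + 2) (cutoff R :: 'a \<Rightarrow> complex)"
  and norm_cutoff_le: "cmod (cutoff R x) \<le> 1"
  and cutoff_eq_1: "norm x \<le> R \<Longrightarrow> cutoff R x = 1"
proof -
  let ?I = "\<lambda>x::'a. complex_of_real (indicator (cball 0 (R + 1)) x)"
  have s: "supp_in (R + 1) ?I" by (auto simp: supp_in_def)
  have i: "integrable lborel ?I"
    by (intro integrable_of_real integrable_real_indicator emeasure_lborel_cball_finite) auto
  show "nice (cutoff R :: 'a \<Rightarrow> complex)" unfolding cutoff_def by (rule nice_conv_en[OF i s]) simp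
  show "supp_in (R + 2) (cutoff R :: 'a \<Rightarrow> complex)" unfolding cutoff_def using supp_in_conv_en[OF s, of 1] by (simp add: add.commute)
  show "cmod (cutoff R x) \<le> 1" unfolding cutoff_def by (rule norm_conv_en_le) auto
  assume x: "norm x \<le> R"
  have "?I (x - y) * en 1 y = en 1 y" for y
  proof (cases "norm y \<le> 1")
    case True
    have "norm (x - y) \<le> norm x + norm y" by norm
    then show ?thesis using True x by simp
  next
    case False
    then have "en 1 y = 0" by (intro en_support) auto
    then show ?thesis by simp
  qed
  then show "cutoff R x = 1"
    unfolding cutoff_def conv_def by (simp only: integral_en[OF order_refl])
qed

text \<open>The functional \<open>L\<close>. Because \<open>FT u (- r) = IFT u r\<close>, the
  reflection makes it the integral of \<phi> against \<open>IFT u\<close>, the shape in which (a)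
  pairs \<phi> with autocorrelations.\<close>

definition pair_ft :: "('a::euclidean_space \<Rightarrow> complex) \<Rightarrow> ('a \<Rightarrow> complex) \<Rightarrow> complex" where
  "pair_ft \<phi> u = (LBINT r. \<phi> (- r) * FT u r)"

text \<open>A free bound \<open>M\<close> stands for the supremum norm, so no supremum has to be
  formed. The sign of \<open>C\<close> is left open; \<open>locally_bddD\<close> makes it
  nonnegative.\<close>

definition pair_ft_bound :: "('a::euclidean_space \<Rightarrow> complex) \<Rightarrow> real \<Rightarrow> real \<Rightarrow> bool" where
  "pair_ft_bound \<phi> R C \<longleftrightarrow> (\<forall>u M. nice u \<longrightarrow> supp_in R u \<longrightarrow> (\<forall>x. cmod (u x) \<le> M) \<longrightarrow>
    cmod (pair_ft \<phi> u) \<le> C * M)"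

lemma pair_ft_boundD:
  "pair_ft_bound \<phi> R C \<Longrightarrow> nice u \<Longrightarrow> supp_in R u \<Longrightarrow> (\<And>x. cmod (u x) \<le> M) \<Longrightarrow> cmod (pair_ft \<phi> u) \<le> C * M"
  by (simp add: pair_ft_bound_def)

definition locally_bdd :: "('a::euclidean_space \<Rightarrow> complex) \<Rightarrow> bool" where
  "locally_bdd \<phi> \<longleftrightarrow> (\<forall>R. \<exists>C. pair_ft_bound \<phi> R C)"

lemma Cb_measurable: "\<phi> \<in> Cb \<Longrightarrow> \<phi> \<in> borel_measurable borel"
  by (auto simp: Cb_def intro: borel_measurable_continuous_onI)

lemma Cb_bounded:
  assumes "\<phi> \<in> Cb" shows "\<exists>B\<ge>0. \<forall>t. cmod (\<phi> t) \<le> B"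
proof -
  obtain B where B: "\<And>t. cmod (\<phi> t) \<le> B" using assms unfolding Cb_def bounded_iff by auto
  then have "B \<ge> 0" using norm_ge_zero order_trans by blast
  then show ?thesis using B by blast
qed

lemma pair_ft_integrable:
  assumes "\<phi> \<in> Cb" "integrable lborel (FT u)"
  shows "integrable lborel (\<lambda>r. \<phi> (- r) * FT u r)"
proof -
  obtain B where "\<And>t. cmod (\<phi> t) \<le> B" using Cb_bounded[OF assms(1)] by metis
  moreover note [measurable] = Cb_measurable[OF assms(1)]
  ultimately show ?thesis using assms(2) by (intro integrable_bounded_mult[where C = B]) auto
qed

lemma Cc_add: "f \<in> Cc \<Longrightarrow> g \<in> Cc \<Longrightarrow> (\<lambda>x. f x + g x) \<in> Cc"
proof -
  assume f: "f \<in> Cc" and g: "g \<in> Cc"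
  obtain R S where "supp_in R f" "supp_in S g" using Cc_supp f g by metis
  then show ?thesis
    by (intro CcI[of _ "max R S"] continuous_on_add Cc_continuous[OF f] Cc_continuous[OF g]) (auto simp: supp_in_def)
qed

lemma Cc_cmult: "f \<in> Cc \<Longrightarrow> (\<lambda>x. c * f x) \<in> Cc"
  using Cc_mult_continuous[of f "\<lambda>_. c"] by (simp add: mult.commute)

lemma FT_nice_diff:
  assumes "nice u" "nice v"
  shows "FT (\<lambda>x. u x - v x) = (\<lambda>t. FT u t - FT v t)"
proof
  fix t
  have "integrable lborel u" "integrable lborel v" using assms by (simp_all add: nice_def integrable_Cc)
  then show "FT (\<lambda>x. u x - v x) t = FT u t - FT v t" by (rule FT_diff)
qed

lemma nice_diff: "nice u \<Longrightarrow> nice v \<Longrightarrow> nice (\<lambda>x. u x - v x)"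
proof -
  assume uv: "nice u" "nice v"
  then have "(\<lambda>x. u x + - 1 * v x) \<in> Cc" by (intro Cc_add Cc_cmult) (auto simp: nice_def)
  moreover have "integrable lborel (\<lambda>t. FT u t - FT v t)" using uv by (intro Bochner_Integration.integrable_diff) (auto simp: nice_def)
  ultimately show ?thesis using uv by (simp add: nice_def[of "\<lambda>x. u x - v x"] FT_nice_diff)
qed

lemma pair_ft_diff:
  assumes "\<phi> \<in> Cb" "nice u" "nice v"
  shows "pair_ft \<phi> (\<lambda>x. u x - v x) = pair_ft \<phi> u - pair_ft \<phi> v"
proof -
  have "integrable lborel (\<lambda>r. \<phi> (- r) * FT u r)" "integrable lborel (\<lambda>r. \<phi> (- r) * FT v r)"
    using assms pair_ft_integrable by (auto simp: nice_def)
  then show ?thesis using assms by (simp add: pair_ft_def FT_nice_diff right_diff_distrib)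
qed

section \<open>Radon functionals\<close>

lemma norm_FT_en_le: "n \<ge> 1 \<Longrightarrow> cmod (FT (en n) t) \<le> cmod (ft_const TYPE('a))" for t :: "'a::euclidean_space"
  using norm_FT_le[of "en n" t] by (simp add: integral_norm_en)

lemma FT_en_even: "n \<ge> 1 \<Longrightarrow> FT (en n) (- t) = FT (en n) t"
  by (simp add: FT_uminus_arg en_even)

lemma cnj_FT_en:
  assumes n: "n \<ge> 1" shows "cnj (FT (en n) t) = FT (en n) t"
proof -
  have "cnj (en n x) = en n x" for x :: 'a
    by (subst (1 2) en_nonneg[OF n]) simp
  then show ?thesis by (simp add: cnj_FT FT_en_even[OF n])
qed

text \<open>\<open>FT (en n)\<close> is a dilate of \<open>FT e0\<close>, so its values tend to the
  value at 0, which is \<open>ft_const\<close> because the mollifier has integral 1.\<close>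

lemma FT_en_tendsto: "(\<lambda>n. FT (en (Suc n)) t) \<longlonglongrightarrow> ft_const TYPE('a)" for t :: "'a::euclidean_space"
proof -
  have "(\<lambda>n. inverse (real (Suc n)) *\<^sub>R t) \<longlonglongrightarrow> 0 *\<^sub>R t"
    by (intro tendsto_scaleR LIMSEQ_inverse_real_of_nat tendsto_const)
  moreover have "isCont (FT e0) (0 :: 'a)"
    using continuous_FT[OF e0_facts(1)[where 'a = 'a]] by (simp add: continuous_on_eq_continuous_at)
  ultimately have "(\<lambda>n. FT e0 (inverse (real (Suc n)) *\<^sub>R t)) \<longlonglongrightarrow> FT e0 (0 :: 'a)"
    by (intro isCont_tendsto_compose[of _ "FT e0"]) auto
  moreover have "FT e0 (0 :: 'a) = ft_const TYPE('a)" using e0_facts(2)[where 'a = 'a] by (simp add: FT_def)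
  ultimately show ?thesis by (simp add: FT_en)
qed

text \<open>The passage to the limit shared by all three conditions: the mollification disappears
  and leaves behind the factor \<open>ft_const\<close>.\<close>

lemma pair_ft_en_tendsto:
  fixes u :: "'a::euclidean_space \<Rightarrow> complex"
  assumes \<phi>: "\<phi> \<in> Cb" and u: "integrable lborel (FT u)"
  shows "(\<lambda>n. LBINT r. \<phi> (- r) * FT u r * FT (en (Suc n)) r) \<longlonglongrightarrow> ft_const TYPE('a) * pair_ft \<phi> u"
proof -
  note i = pair_ft_integrable[OF \<phi> u]
  have [measurable]: "FT (en (Suc n) :: 'a \<Rightarrow> complex) \<in> borel_measurable borel" for n
    by (intro measurable_FT integrable_en) simp
  have "(\<lambda>n. LBINT r. (\<phi> (- r) * FT u r) * FT (en (Suc n)) r) \<longlonglongrightarrow> (LBINT r. (\<phi> (- r) * FT u r) * ft_const TYPE('a))"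
  proof (rule integral_dominated_convergence[where w = "\<lambda>r. cmod (\<phi> (- r) * FT u r) * cmod (ft_const TYPE('a))"])
    show "AE r in lborel. (\<lambda>n. (\<phi> (- r) * FT u r) * FT (en (Suc n)) r) \<longlonglongrightarrow> (\<phi> (- r) * FT u r) * ft_const TYPE('a)"
      by (intro AE_I2 tendsto_intros FT_en_tendsto)
    show "AE r in lborel. cmod (\<phi> (- r) * FT u r * FT (en (Suc n)) r) \<le> cmod (\<phi> (- r) * FT u r) * cmod (ft_const TYPE('a))" for n
      unfolding norm_mult[of _ "FT (en (Suc n)) _"]
      by (intro AE_I2 mult_left_mono norm_FT_en_le) auto
  qed (use i in auto)
  then show ?thesis by (simp add: pair_ft_def mult.commute)
qed

lemma Cc_conv:
  assumes f: "f \<in> Cc" and g: "g \<in> Cc"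
  shows "conv f g \<in> Cc"
proof -
  obtain R S where "supp_in R f" "supp_in S g" using Cc_supp f g by metis
  then have "supp_in (R + S) (conv f g)" using conv_support[of R f S g] by (auto simp: supp_in_def)
  moreover obtain B where "\<And>x. cmod (g x) \<le> B" using Cc_bounded[OF g] by metis
  then have "continuous_on UNIV (conv f g)"
    using Cc_continuous[OF g]
    by (intro continuous_conv[OF integrable_Cc[OF f] Cc_measurable[OF g]] AE_I2)
      (auto simp: continuous_on_eq_continuous_at)
  ultimately show ?thesis by (rule CcI[rotated])
qed

lemma Cc_reflect: "h \<in> Cc \<Longrightarrow> (\<lambda>x. cnj (h (- x))) \<in> Cc"
proof -
  assume h: "h \<in> Cc"
  obtain R where "supp_in R h" using Cc_supp[OF h] by metis
  then show ?thesis
    by (intro CcI[of _ R] continuous_on_cnj continuous_on_compose2[OF Cc_continuous[OF h], of _ uminus] continuous_on_minus continuous_on_id)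
      (auto simp: supp_in_def)
qed

lemma FT_autocorrelation:
  fixes h :: "'a::euclidean_space \<Rightarrow> complex"
  assumes h: "h \<in> Cc"
  shows "FT (conv h (\<lambda>x. cnj (h (- x)))) t = of_real ((cmod (FT h t))\<^sup>2) / ft_const TYPE('a)"
proof -
  have "FT (\<lambda>x. cnj (h (- x))) t = cnj (FT h t)"
    by (simp add: cnj_FT FT_uminus_arg)
  then show ?thesis
    using FT_conv[OF integrable_Cc[OF h] integrable_Cc[OF Cc_reflect[OF h]], of t]
    by (simp only: complex_norm_square)
qed

text \<open>The transform is a square modulus divided by the positive number
  \<open>ft_const\<close>, so it is integrable by positivity. Hence every function that (a) tests
  lies in the domain of \<open>L\<close>.\<close>

lemma nice_autocorrelation:
  fixes h :: "'a::euclidean_space \<Rightarrow> complex"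
  assumes h: "h \<in> Cc"
  shows "nice (conv h (\<lambda>x. cnj (h (- x))))" (is "nice ?k")
proof -
  have k: "?k \<in> Cc" by (intro Cc_conv h Cc_reflect)
  obtain B where "\<And>x. cmod (?k x) \<le> B" using Cc_bounded[OF k] by metis
  moreover have "FT ?k t = of_real (cmod (FT ?k t))" for t
    unfolding FT_autocorrelation[OF h] by (simp add: ft_const_def norm_divide norm_power norm_mult norm_inverse)
  ultimately have "integrable lborel (FT ?k)" by (intro integrable_FT_nonneg integrable_Cc k)
  then show ?thesis using k by (simp add: nice_def)
qed

lemma pair_ft_autocorrelation:
  fixes h :: "'a::euclidean_space \<Rightarrow> complex"
  assumes \<phi>: "\<phi> \<in> Cb" and h: "h \<in> Cc"
  shows "integrable lborel (\<lambda>t. complex_of_real ((cmod (IFT h t))\<^sup>2) * \<phi> t)"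
    and "ft_const TYPE('a) * pair_ft \<phi> (conv h (\<lambda>x. cnj (h (- x)))) = (LBINT t. complex_of_real ((cmod (IFT h t))\<^sup>2) * \<phi> t)"
proof -
  let ?k = "conv h (\<lambda>x. cnj (h (- x)))"
  let ?g = "\<lambda>t. complex_of_real ((cmod (IFT h t))\<^sup>2) * \<phi> t"
  have eq: "ft_const TYPE('a) * (\<phi> (- r) * FT ?k r) = ?g (- r)" for r
    by (simp add: FT_autocorrelation[OF h] IFT_eq_FT)
  have "integrable lborel (\<lambda>r. ft_const TYPE('a) * (\<phi> (- r) * FT ?k r))"
    using pair_ft_integrable[OF \<phi>, of ?k] nice_autocorrelation[OF h] by (intro integrable_mult_right) (auto simp: nice_def)
  then show "integrable lborel ?g"
    unfolding eq lborel_integrable_uminus[of ?g] .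
  show "ft_const TYPE('a) * pair_ft \<phi> ?k = (LBINT t. ?g t)"
    unfolding pair_ft_def integral_mult_right_zero[symmetric] eq lborel_integral_uminus[of ?g] ..
qed

lemma locally_bddD:
  fixes \<phi> :: "'a::euclidean_space \<Rightarrow> complex"
  assumes "locally_bdd \<phi>"
  obtains C where "C \<ge> 0" "pair_ft_bound \<phi> R C"
proof -
  obtain C where C: "pair_ft_bound \<phi> R C" using assms unfolding locally_bdd_def by blast
  have "pair_ft_bound \<phi> R (max C 0)"
    unfolding pair_ft_bound_def
  proof (intro allI impI)
    fix u :: "'a \<Rightarrow> complex" and M
    assume u: "nice u" "supp_in R u" "\<forall>x. cmod (u x) \<le> M"
    then have "M \<ge> 0" using norm_ge_zero order_trans by blast
    then have "C * M \<le> max C 0 * M" by (intro mult_right_mono) auto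
    with pair_ft_boundD[OF C, of u M] u show "cmod (pair_ft \<phi> u) \<le> max C 0 * M" by auto
  qed
  then show ?thesis using that[of "max C 0"] by simp
qed

text \<open>Extension of \<open>L\<close> to all of \<open>Cc\<close> by mollification. The limit
  exists when \<open>L\<close> is locally bounded, by \<open>ext_pair_tendsto\<close>; otherwise
  \<open>lim\<close> returns an unspecified value.\<close>

definition ext_pair :: "('a::euclidean_space \<Rightarrow> complex) \<Rightarrow> ('a \<Rightarrow> complex) \<Rightarrow> complex" where
  "ext_pair \<phi> f = lim (\<lambda>n. pair_ft \<phi> (conv f (en (Suc n))))"

lemma nice_conv_en_Cc: "f \<in> Cc \<Longrightarrow> nice (conv f (en (Suc n)))"
proof -
  assume f: "f \<in> Cc"
  obtain R where "supp_in R f" using Cc_supp[OF f] by metis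
  then show ?thesis by (rule nice_conv_en[OF integrable_Cc[OF f]]) simp
qed

text \<open>The mollifications of \<open>f\<close> are uniformly close to \<open>f\<close>, hence to
  each other, and are supported in one ball. The local bound turns uniform closeness into closeness
  of the values of \<open>L\<close>.\<close>

lemma pair_ft_conv_en_close:
  fixes \<phi> f u :: "'a::euclidean_space \<Rightarrow> complex"
  assumes \<phi>: "\<phi> \<in> Cb" "locally_bdd \<phi>" and f: "f \<in> Cc" and e: "e > 0"
  shows "\<exists>N. \<forall>n\<ge>N. \<forall>m\<ge>N. cmod (pair_ft \<phi> (conv f (en (Suc n))) - pair_ft \<phi> (conv f (en (Suc m)))) < e"
    and "nice f \<Longrightarrow> \<exists>N. \<forall>n\<ge>N. cmod (pair_ft \<phi> (conv f (en (Suc n))) - pair_ft \<phi> f) < e"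
proof -
  obtain R where R: "supp_in R f" using Cc_supp[OF f] by metis
  obtain C where C: "C \<ge> 0" "pair_ft_bound \<phi> (R + 1) C"
    using locally_bddD[OF \<phi>(2)] .
  \<comment> \<open>The factor 2 allows for comparing two mollifications through \<open>f\<close>;
    the summand 1 keeps the denominator positive when \<open>C = 0\<close>.\<close>
  define d where "d = e / (2 * C + 1)"
  have d: "d > 0" "C * (2 * d) < e"
    using e C(1) by (auto simp: d_def field_simps)
  obtain N where N: "\<And>n x. n \<ge> N \<Longrightarrow> cmod (conv f (en n) x - f x) \<le> d" using conv_en_uniform[OF f d(1)] by metis
  have s: "supp_in (R + 1) (conv f (en (Suc n)))" for n by (rule supp_in_conv_en[OF R]) simp
  have "cmod (pair_ft \<phi> (conv f (en (Suc n))) - pair_ft \<phi> (conv f (en (Suc m)))) < e" if "n \<ge> N" "m \<ge> N" for n m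
  proof -
    have "cmod (conv f (en (Suc n)) x - conv f (en (Suc m)) x) \<le> 2 * d" for x
      using N[of "Suc n" x] N[of "Suc m" x] that
        norm_triangle_ineq4[of "conv f (en (Suc n)) x - f x" "conv f (en (Suc m)) x - f x"] by simp
    then have "cmod (pair_ft \<phi> (\<lambda>x. conv f (en (Suc n)) x - conv f (en (Suc m)) x)) \<le> C * (2 * d)"
      using s[of n] s[of m] by (intro pair_ft_boundD[OF C(2)] nice_diff nice_conv_en_Cc f) (auto simp: supp_in_def)
    then show ?thesis using d(2) by (simp add: pair_ft_diff \<phi> nice_conv_en_Cc f)
  qed
  then show "\<exists>N. \<forall>n\<ge>N. \<forall>m\<ge>N. cmod (pair_ft \<phi> (conv f (en (Suc n))) - pair_ft \<phi> (conv f (en (Suc m)))) < e"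
    by blast
  assume nf: "nice f"
  have "cmod (pair_ft \<phi> (conv f (en (Suc n))) - pair_ft \<phi> f) < e" if "n \<ge> N" for n
  proof -
    have "cmod (conv f (en (Suc n)) x - f x) \<le> 2 * d" for x
      using N[of "Suc n" x] that d by simp
    then have "cmod (pair_ft \<phi> (\<lambda>x. conv f (en (Suc n)) x - f x)) \<le> C * (2 * d)"
      using s[of n] R by (intro pair_ft_boundD[OF C(2)] nice_diff nice_conv_en_Cc f nf) (auto simp: supp_in_def)
    then show ?thesis using d(2) by (simp add: pair_ft_diff \<phi> nice_conv_en_Cc f nf)
  qed
  then show "\<exists>N. \<forall>n\<ge>N. cmod (pair_ft \<phi> (conv f (en (Suc n))) - pair_ft \<phi> f) < e"
    by blast
qed

lemma ext_pair_tendsto: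
  assumes \<phi>: "\<phi> \<in> Cb" "locally_bdd \<phi>" and f: "f \<in> Cc"
  shows "(\<lambda>n. pair_ft \<phi> (conv f (en (Suc n)))) \<longlonglongrightarrow> ext_pair \<phi> f"
proof -
  have "Cauchy (\<lambda>n. pair_ft \<phi> (conv f (en (Suc n))))"
    using pair_ft_conv_en_close(1)[OF \<phi> f] by (auto simp: Cauchy_def dist_norm)
  then have "convergent (\<lambda>n. pair_ft \<phi> (conv f (en (Suc n))))" by (rule Cauchy_convergent)
  then show ?thesis unfolding ext_pair_def by (simp add: convergent_LIMSEQ_iff)
qed

lemma ext_pair_nice:
  assumes \<phi>: "\<phi> \<in> Cb" "locally_bdd \<phi>" and f: "nice f"
  shows "ext_pair \<phi> f = pair_ft \<phi> f"
proof (rule LIMSEQ_unique)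
  have fc: "f \<in> Cc" using f by (simp add: nice_def)
  show "(\<lambda>n. pair_ft \<phi> (conv f (en (Suc n)))) \<longlonglongrightarrow> ext_pair \<phi> f" by (rule ext_pair_tendsto[OF \<phi> fc])
  show "(\<lambda>n. pair_ft \<phi> (conv f (en (Suc n)))) \<longlonglongrightarrow> pair_ft \<phi> f"
    using pair_ft_conv_en_close(2)[OF \<phi> fc _ f] by (auto simp: LIMSEQ_def dist_norm)
qed

lemma conv_add_left:
  fixes f g e :: "'a::euclidean_space \<Rightarrow> complex"
  assumes f: "f \<in> Cc" and g: "g \<in> Cc" and e: "integrable lborel e"
  shows "conv (\<lambda>x. f x + g x) e = (\<lambda>x. conv f e x + conv g e x)"
proof
  fix x
  have i: "integrable lborel (\<lambda>y. f (x - y) * e y)" if f: "f \<in> Cc" for f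
  proof -
    obtain B where "\<And>x. cmod (f x) \<le> B" using Cc_bounded[OF f] by metis
    moreover have [measurable]: "f \<in> borel_measurable borel" by (rule Cc_measurable[OF f])
    ultimately show ?thesis by (intro integrable_bounded_mult[OF e]) auto
  qed
  show "conv (\<lambda>x. f x + g x) e x = conv f e x + conv g e x"
    using i[OF f] i[OF g] by (simp add: conv_def distrib_right)
qed

lemma conv_cmult_left: "conv (\<lambda>x. c * f x) e = (\<lambda>x. c * conv f e x)"
proof
  fix x
  have "conv (\<lambda>x. c * f x) e x = (LBINT y. c * (f (x - y) * e y))" by (simp add: conv_def mult.assoc)
  then show "conv (\<lambda>x. c * f x) e x = c * conv f e x" by (simp add: conv_def)
qed

lemma pair_ft_add:
  assumes "\<phi> \<in> Cb" "nice u" "nice v"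
  shows "pair_ft \<phi> (\<lambda>x. u x + v x) = pair_ft \<phi> u + pair_ft \<phi> v"
proof -
  have "integrable lborel u" "integrable lborel v" using assms by (simp_all add: nice_def integrable_Cc)
  moreover have "integrable lborel (\<lambda>r. \<phi> (- r) * FT u r)" "integrable lborel (\<lambda>r. \<phi> (- r) * FT v r)"
    using assms pair_ft_integrable by (auto simp: nice_def)
  ultimately show ?thesis by (simp add: pair_ft_def FT_add distrib_left)
qed

lemma pair_ft_cmult: "pair_ft \<phi> (\<lambda>x. c * u x) = c * pair_ft \<phi> u"
  by (simp add: pair_ft_def FT_cmult mult.left_commute[of _ c])

lemma radon_of_locally_bdd:
  fixes \<phi> :: "'a::euclidean_space \<Rightarrow> complex"
  assumes \<phi>: "\<phi> \<in> Cb" "locally_bdd \<phi>"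
  shows "\<exists>\<nu>. radon_functional \<nu> \<and> transformable_with_density \<nu> \<phi>"
proof -
  let ?c = "ft_const TYPE('a)"
  \<comment> \<open>The factor undoes the division by \<open>ft_const\<close> in
    \<open>FT_autocorrelation\<close>, so that the density is \<phi> itself.\<close>
  let ?\<nu> = "\<lambda>f. ?c * ext_pair \<phi> f"
  note lim = ext_pair_tendsto[OF \<phi>]
  note i = integrable_en[of "Suc _", where 'a = 'a, simplified]
  have add: "ext_pair \<phi> (\<lambda>x. f x + g x) = ext_pair \<phi> f + ext_pair \<phi> g" if f: "f \<in> Cc" and g: "g \<in> Cc" for f g
  proof (rule LIMSEQ_unique[OF lim[OF Cc_add[OF f g]]])
    show "(\<lambda>n. pair_ft \<phi> (conv (\<lambda>x. f x + g x) (en (Suc n)))) \<longlonglongrightarrow> ext_pair \<phi> f + ext_pair \<phi> g"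
      unfolding conv_add_left[OF f g i] pair_ft_add[OF \<phi>(1) nice_conv_en_Cc[OF f] nice_conv_en_Cc[OF g]]
      by (intro tendsto_add lim f g)
  qed
  have scale: "ext_pair \<phi> (\<lambda>x. c * f x) = c * ext_pair \<phi> f" if f: "f \<in> Cc" for c f
  proof (rule LIMSEQ_unique[OF lim[OF Cc_cmult[OF f]]])
    show "(\<lambda>n. pair_ft \<phi> (conv (\<lambda>x. c * f x) (en (Suc n)))) \<longlonglongrightarrow> c * ext_pair \<phi> f"
      unfolding conv_cmult_left pair_ft_cmult by (intro tendsto_mult_left lim f)
  qed
  have bound: "\<exists>C. \<forall>f\<in>Cc. {x. f x \<noteq> 0} \<subseteq> K \<longrightarrow> cmod (?\<nu> f) \<le> C * (SUP x. cmod (f x))" if K: "compact K" for K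
  proof -
    obtain R where R: "\<And>x. x \<in> K \<Longrightarrow> norm x \<le> R" using compact_imp_bounded[OF K] by (auto simp: bounded_iff)
    obtain C where C: "C \<ge> 0" "pair_ft_bound \<phi> (R + 1) C"
      using locally_bddD[OF \<phi>(2)] .
    have "cmod (?\<nu> f) \<le> cmod ?c * C * (SUP x. cmod (f x))" if f: "f \<in> Cc" and sub: "{x. f x \<noteq> 0} \<subseteq> K" for f
    proof -
      have s: "supp_in R f" using sub R by (force simp: supp_in_def)
      obtain B where B: "\<And>x. cmod (f x) \<le> B" using Cc_bounded[OF f] by metis
      have le: "cmod (f x) \<le> (SUP x. cmod (f x))" for x
        by (rule cSUP_upper) (auto intro: bdd_aboveI2 B)
      have "cmod (pair_ft \<phi> (conv f (en (Suc n)))) \<le> C * (SUP x. cmod (f x))" for n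
        by (intro pair_ft_boundD[OF C(2)] nice_conv_en_Cc f supp_in_conv_en s norm_conv_en_le le) auto
      then have "cmod (ext_pair \<phi> f) \<le> C * (SUP x. cmod (f x))"
        using tendsto_upperbound[OF tendsto_norm[OF lim[OF f]], of "C * (SUP x. cmod (f x))"] by simp
      then show ?thesis by (simp add: norm_mult mult.assoc mult_left_mono)
    qed
    then show ?thesis by blast
  qed
  have "radon_functional ?\<nu>"
    unfolding radon_functional_def
  proof (intro conjI ballI allI impI)
    show "?\<nu> (\<lambda>x. f x + g x) = ?\<nu> f + ?\<nu> g" if "f \<in> Cc" "g \<in> Cc" for f g
      using add[OF that] by (simp add: distrib_left)
    show "?\<nu> (\<lambda>x. c * f x) = c * ?\<nu> f" if "f \<in> Cc" for f c
      using scale[OF that] by simp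
  qed (rule bound)
  moreover have "transformable_with_density ?\<nu> \<phi>"
    unfolding transformable_with_density_def
    using pair_ft_autocorrelation[OF \<phi>(1)] ext_pair_nice[OF \<phi> nice_autocorrelation] by auto
  ultimately show ?thesis by blast
qed

text \<open>Two pairs \<open>(a, b)\<close> and \<open>(c, d)\<close> occur because a convolution
  evaluates its factors at two different points. The terms \<open>b * cnj c\<close> of the first two
  and of the last two products cancel.\<close>

lemma polarization:
  fixes a b c d :: complex
  shows "4 * (a * cnj d) = (a + b) * cnj (c + d) - (a - b) * cnj (c - d)
    + \<i> * ((a + \<i> * b) * cnj (c + \<i> * d)) - \<i> * ((a - \<i> * b) * cnj (c - \<i> * d))"
  by (simp add: algebra_simps)

lemma radon_polarized:
  fixes \<phi> f g :: "'a::euclidean_space \<Rightarrow> complex"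
  assumes \<nu>: "radon_functional \<nu>" and t: "transformable_with_density \<nu> \<phi>" and f: "f \<in> Cc" and g: "g \<in> Cc"
  shows "\<nu> (conv f (\<lambda>x. cnj (g (- x)))) = (LBINT t. IFT f t * cnj (IFT g t) * \<phi> t)"
proof -
  have add: "\<nu> (\<lambda>x. f x + g x) = \<nu> f + \<nu> g" if "f \<in> Cc" "g \<in> Cc" for f g
    using \<nu> that by (simp add: radon_functional_def)
  have scale: "\<nu> (\<lambda>x. c * f x) = c * \<nu> f" if "f \<in> Cc" for f c
    using \<nu> that by (simp add: radon_functional_def)
  \<comment> \<open>Used with \<open>c\<close> ranging over 1, -1, \<open>\<i>\<close> and
    \<open>-\<i>\<close>: hypothesis (a) speaks only about the autocorrelations
    \<open>P c\<close>.\<close>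
  define h where "h c = (\<lambda>x. f x + c * g x)" for c
  define P where "P c = conv (h c) (\<lambda>x. cnj (h c (- x)))" for c
  define Q where "Q c = (\<lambda>t. complex_of_real ((cmod (IFT (h c) t))\<^sup>2) * \<phi> t)" for c
  have h: "h c \<in> Cc" for c unfolding h_def by (intro Cc_add Cc_cmult f g)
  have P: "P c \<in> Cc" for c unfolding P_def by (intro Cc_conv Cc_reflect h)
  have Q: "integrable lborel (Q c)" and PQ: "\<nu> (P c) = (LBINT t. Q c t)" for c
    using t h[of c] by (auto simp: transformable_with_density_def P_def Q_def)
  have "conv f (\<lambda>x. cnj (g (- x))) x = 1/4 * (P 1 x + (-1) * P (-1) x + (\<i> * P \<i> x + (-\<i>) * P (-\<i>) x))" for x
  proof -
    have i: "integrable lborel (\<lambda>y. h c (x - y) * cnj (h c (- y)))" for c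
    proof -
      obtain B where "\<And>x. cmod (h c x) \<le> B" using Cc_bounded[OF h] by metis
      moreover have [measurable]: "h c \<in> borel_measurable borel" by (rule Cc_measurable[OF h])
      ultimately show ?thesis by (intro integrable_bounded_mult[OF integrable_Cc[OF Cc_reflect[OF h]]]) auto
    qed
    have eq: "f (x - y) * cnj (g (- y)) = 1/4 * (h 1 (x - y) * cnj (h 1 (- y)) - h (-1) (x - y) * cnj (h (-1) (- y))
      + (\<i> * (h \<i> (x - y) * cnj (h \<i> (- y))) - \<i> * (h (-\<i>) (x - y) * cnj (h (-\<i>) (- y)))))" for y
      \<comment> \<open>The instantiation follows the order of occurrence \<open>a\<close>,
        \<open>d\<close>, \<open>b\<close>, \<open>c\<close>: the pair \<open>(a, b)\<close> holds
        the values at \<open>x - y\<close>, the pair \<open>(c, d)\<close> those at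
        \<open>- y\<close>.\<close>
      using polarization[of "f (x - y)" "g (- y)" "g (x - y)" "f (- y)"] unfolding h_def by (simp add: algebra_simps)
    show ?thesis
      unfolding P_def conv_def eq using i by simp
  qed
  then have "conv f (\<lambda>x. cnj (g (- x))) = (\<lambda>x. 1/4 * (P 1 x + (-1) * P (-1) x + (\<i> * P \<i> x + (-\<i>) * P (-\<i>) x)))"
    by (rule ext)
  then have "\<nu> (conv f (\<lambda>x. cnj (g (- x)))) = \<nu> (\<lambda>x. 1/4 * (P 1 x + (-1) * P (-1) x + (\<i> * P \<i> x + (-\<i>) * P (-\<i>) x)))"
    by (simp only:)
  also have "\<dots> = 1/4 * (\<nu> (P 1) + (-1) * \<nu> (P (-1)) + (\<i> * \<nu> (P \<i>) + (-\<i>) * \<nu> (P (-\<i>))))"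
    by (simp only: add scale P Cc_add Cc_cmult)
  also have "\<dots> = (LBINT t. 1/4 * (Q 1 t + (-1) * Q (-1) t + (\<i> * Q \<i> t + (-\<i>) * Q (-\<i>) t)))"
    unfolding PQ using Q by simp
  also have "\<dots> = (LBINT t. IFT f t * cnj (IFT g t) * \<phi> t)"
  proof (intro Bochner_Integration.integral_cong refl)
    fix t
    have hF: "IFT (h c) t = IFT f t + c * IFT g t" for c
      unfolding IFT_eq_FT h_def using f g by (subst FT_add) (auto simp: FT_cmult integrable_Cc)
    have Q': "Q c t = (IFT f t + c * IFT g t) * cnj (IFT f t + c * IFT g t) * \<phi> t" for c
      unfolding Q_def hF complex_norm_square by simp
    show "1/4 * (Q 1 t + (-1) * Q (-1) t + (\<i> * Q \<i> t + (-\<i>) * Q (-\<i>) t)) = IFT f t * cnj (IFT g t) * \<phi> t"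
      unfolding Q' by (simp add: algebra_simps)
  qed
  finally show ?thesis .
qed

text \<open>By polarization (a) determines \<nu> on \<open>conv u (en n)\<close>. These functions
  stay in one ball and below \<open>M\<close>, so the Radon bound applies to them, and their values
  converge to \<open>ft_const\<close> times \<open>L u\<close>.\<close>

lemma locally_bdd_of_radon:
  fixes \<phi> :: "'a::euclidean_space \<Rightarrow> complex"
  assumes \<phi>: "\<phi> \<in> Cb" and \<nu>: "radon_functional \<nu>" and t: "transformable_with_density \<nu> \<phi>"
  shows "locally_bdd \<phi>"
  unfolding locally_bdd_def
proof
  fix R
  let ?c = "ft_const TYPE('a)"
  have "compact (cball (0::'a) (R + 1))" by simp
  then obtain C where C: "\<And>f. f \<in> Cc \<Longrightarrow> {x. f x \<noteq> 0} \<subseteq> cball 0 (R + 1) \<Longrightarrow> cmod (\<nu> f) \<le> C * (SUP x. cmod (f x))"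
    using \<nu> unfolding radon_functional_def by metis
  \<comment> \<open>The Radon bound may come with a negative \<open>C\<close>, hence the maximum;
    the division removes the factor \<open>ft_const\<close> of the limit.\<close>
  have "cmod (pair_ft \<phi> u) \<le> max C 0 / cmod ?c * M" if u: "nice u" "supp_in R u" "\<And>x. cmod (u x) \<le> M" for u M
  proof -
    have uc: "u \<in> Cc" and ui: "integrable lborel (FT u)" using u by (auto simp: nice_def)
    have M: "M \<ge> 0" using u(3)[of 0] norm_ge_zero order_trans by blast
    have en: "en (Suc n) \<in> (Cc :: ('a \<Rightarrow> complex) set)" for n
      by (rule CcI[of _ "1 / real (Suc n)"])
        (auto simp: supp_in_def continuous_en simp del: of_nat_Suc intro!: en_support)
    have "\<nu> (conv u (en (Suc n))) = (LBINT r. \<phi> (- r) * FT u r * FT (en (Suc n)) r)" for n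
    proof -
      have "cnj (en (Suc n) (- x)) = en (Suc n) x" for x :: 'a
        by (subst (1 2) en_nonneg) (auto simp: en_even)
      then have "\<nu> (conv u (en (Suc n))) = (LBINT t. IFT u t * cnj (IFT (en (Suc n)) t) * \<phi> t)"
        using radon_polarized[OF \<nu> t uc en, of n] by simp
      also have "\<dots> = (LBINT t. (\<lambda>r. \<phi> (- r) * FT u r * FT (en (Suc n)) r) (- t))"
        by (simp add: IFT_eq_FT FT_en_even cnj_FT_en mult_ac)
      also have "\<dots> = (LBINT r. \<phi> (- r) * FT u r * FT (en (Suc n)) r)"
        by (rule lborel_integral_uminus[of "\<lambda>r. \<phi> (- r) * FT u r * FT (en (Suc n)) r"])
      finally show ?thesis .
    qed
    then have lim: "(\<lambda>n. \<nu> (conv u (en (Suc n)))) \<longlonglongrightarrow> ?c * pair_ft \<phi> u"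
      using pair_ft_en_tendsto[OF \<phi> ui] by simp
    have "cmod (\<nu> (conv u (en (Suc n)))) \<le> max C 0 * M" for n
    proof -
      have k: "conv u (en (Suc n)) \<in> Cc" by (intro Cc_conv uc en)
      have "supp_in (R + 1) (conv u (en (Suc n)))" by (rule supp_in_conv_en[OF u(2)]) simp
      then have "{x. conv u (en (Suc n)) x \<noteq> 0} \<subseteq> cball 0 (R + 1)" by (auto simp: supp_in_def not_less[symmetric])
      from C[OF k this] have "cmod (\<nu> (conv u (en (Suc n)))) \<le> C * (SUP x. cmod (conv u (en (Suc n)) x))" .
      also have "\<dots> \<le> max C 0 * (SUP x. cmod (conv u (en (Suc n)) x))"
      proof (rule mult_right_mono)
        have "cmod (conv u (en (Suc n)) 0) \<le> (SUP x. cmod (conv u (en (Suc n)) x))"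
          by (rule cSUP_upper) (auto intro!: bdd_aboveI2[where M = M] norm_conv_en_le u)
        then show "(SUP x. cmod (conv u (en (Suc n)) x)) \<ge> 0" using norm_ge_zero order_trans by blast
      qed auto
      also have "\<dots> \<le> max C 0 * M"
        by (intro mult_left_mono cSUP_least norm_conv_en_le u) auto
      finally show ?thesis .
    qed
    then have "cmod (?c * pair_ft \<phi> u) \<le> max C 0 * M"
      using tendsto_upperbound[OF tendsto_norm[OF lim], of "max C 0 * M"] by simp
    then show ?thesis by (simp add: norm_mult field_simps)
  qed
  then show "\<exists>C. pair_ft_bound \<phi> R C"
    unfolding pair_ft_bound_def by blast
qed

section \<open>Weak compactness of measures supported in a ball\<close>

text \<open>A variant of Schoenberg's space-filling curve: \<open>bit_wave (3^k * u)\<close> reads off the \<open>k\<close>-th digit of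
  \<open>u\<close> when all ternary digits of \<open>u\<close> are 0 or 2.\<close>

definition bit_wave :: "real \<Rightarrow> real" where
  "bit_wave u = min 1 (max 0 (1/2 - cos (pi * u)))"

lemma bit_wave_bounds: "0 \<le> bit_wave u" "bit_wave u \<le> 1"
  by (auto simp: bit_wave_def)

lemma continuous_bit_wave [continuous_intros]:
  fixes f :: "real \<Rightarrow> real"
  shows "continuous_on S f \<Longrightarrow> continuous_on S (\<lambda>x. bit_wave (f x))"
  unfolding bit_wave_def by (intro continuous_intros)

text \<open>\<open>cos (pi * u)\<close> has period 2. On \<open>[0, 1/3]\<close> it is at least
  \<open>1/2\<close>, so the wave is clipped to 0; on \<open>[2/3, 1]\<close> it is at most
  \<open>-1/2\<close>, so the wave is clipped to 1. The remainder \<open>q\<close> stands for the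
  later digits.\<close>

lemma bit_wave_eq:
  assumes "a = 0 \<or> a = 1" "0 \<le> q" "q \<le> 1/3"
  shows "bit_wave (2 * of_int m + (2 * a / 3 + q)) = a"
proof -
  let ?r = "2 * a / 3 + q"
  have "cos (pi * (2 * of_int m + ?r)) = cos (2 * pi * of_int m + pi * ?r)"
    by (simp add: algebra_simps)
  also have "\<dots> = cos (pi * ?r)" by (simp add: cos_add del: distrib_left_numeral)
  finally have per: "bit_wave (2 * of_int m + ?r) = bit_wave ?r"
    unfolding bit_wave_def by simp
  from assms(1) have "bit_wave ?r = a"
  proof
    assume a: "a = 0"
    have "cos (pi / 3) \<le> cos (pi * q)"
      using assms by (intro cos_monotone_0_pi_le) (auto simp: field_simps)
    then show ?thesis using a by (simp add: bit_wave_def cos_60)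
  next
    assume a: "a = 1"
    have "cos (pi * (2 / 3 + q)) \<le> cos (2 * pi / 3)"
      using assms by (intro cos_monotone_0_pi_le) (auto simp: field_simps)
    then show ?thesis using a by (simp add: bit_wave_def cos_120)
  qed
  with per show ?thesis by simp
qed

text \<open>For \<open>a\<close> with values 0 and 1 this is the point of the Cantor set with
  ternary digits \<open>2 * a j\<close>.\<close>

definition ternary :: "(nat \<Rightarrow> real) \<Rightarrow> real" where
  "ternary a = (\<Sum>j. 2 * a j / 3 ^ Suc j)"

lemma ternary_bounds:
  assumes a: "\<And>j. 0 \<le> a j" "\<And>j. a j \<le> 1"
  shows "summable (\<lambda>j. 2 * a j / 3 ^ Suc j)" "0 \<le> ternary a" "ternary a \<le> 1"
proof -
  have g: "(\<lambda>j. 2/3 * (1/3) ^ j :: real) sums 1"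
    using sums_mult[OF geometric_sums[of "1/3 :: real"], of "2/3"] by simp
  have le: "2 * a j / 3 ^ Suc j \<le> 2/3 * (1/3) ^ j" for j
    using a[of j] by (simp add: power_divide divide_right_mono)
  show s: "summable (\<lambda>j. 2 * a j / 3 ^ Suc j)"
    by (rule summable_comparison_test[OF _ sums_summable[OF g]]) (use a le in auto)
  show "0 \<le> ternary a" unfolding ternary_def by (intro suminf_nonneg s) (use a in auto)
  have "ternary a \<le> (\<Sum>j. 2/3 * (1/3) ^ j)"
    unfolding ternary_def by (rule suminf_le[OF le s sums_summable[OF g]])
  also have "\<dots> = 1" by (rule sums_unique[OF g, symmetric])
  finally show "ternary a \<le> 1" .
qed

text \<open>Multiplication by \<open>3 ^ k\<close> moves digit \<open>k\<close> to the front. The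
  integer split off is even, since all digits are 0 or 2, and is lost by periodicity; the remaining
  tail contributes at most \<open>1/3\<close>.\<close>

lemma bit_wave_ternary:
  assumes a: "\<And>j. a j = 0 \<or> a j = 1"
  shows "bit_wave (3 ^ k * ternary a) = a k"
proof -
  have b: "0 \<le> a j" "a j \<le> 1" for j using a[of j] by auto
  have shift: "ternary (\<lambda>j. a (j + k)) = 2 * a k / 3 + ternary (\<lambda>j. a (j + Suc k)) / 3" for k
  proof -
    have "ternary (\<lambda>j. a (j + k)) = 2 * a k / 3 + (\<Sum>j. 2 * a (Suc j + k) / 3 ^ Suc (Suc j))"
      unfolding ternary_def using suminf_split_head[OF ternary_bounds(1)[of "\<lambda>j. a (j + k)"]] b by simp
    also have "(\<Sum>j. 2 * a (Suc j + k) / 3 ^ Suc (Suc j)) = (\<Sum>j. (1/3) * (2 * a (j + Suc k) / 3 ^ Suc j))"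
      by simp
    also have "\<dots> = (1/3) * ternary (\<lambda>j. a (j + Suc k))"
      unfolding ternary_def using ternary_bounds(1)[of "\<lambda>j. a (j + Suc k)"] b by (intro suminf_mult) auto
    finally show ?thesis by simp
  qed
  have "\<exists>m::int. 3 ^ k * ternary a = 2 * of_int m + ternary (\<lambda>j. a (j + k))"
  proof (induction k)
    case 0
    then show ?case by (intro exI[of _ 0]) simp
  next
    case (Suc k)
    then obtain m :: int where m: "3 ^ k * ternary a = 2 * of_int m + ternary (\<lambda>j. a (j + k))" by blast
    obtain i :: int where i: "a k = of_int i" using a[of k] by (metis of_int_0 of_int_1)
    have "3 ^ Suc k * ternary a = 3 * (2 * of_int m + ternary (\<lambda>j. a (j + k)))" using m by simp
    also have "\<dots> = 2 * of_int (3 * m + i) + ternary (\<lambda>j. a (j + Suc k))"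
      unfolding shift[of k] using i by simp
    finally show ?case by blast
  qed
  then obtain m :: int where "3 ^ k * ternary a = 2 * of_int m + (2 * a k / 3 + ternary (\<lambda>j. a (j + Suc k)) / 3)"
    unfolding shift[of k] by blast
  then show ?thesis
    using bit_wave_eq[OF a[of k], of "ternary (\<lambda>j. a (j + Suc k)) / 3" m] ternary_bounds(2,3)[of "\<lambda>j. a (j + Suc k)"] b
    by simp
qed

text \<open>The binary digit of weight \<open>1 / 2 ^ Suc n\<close>. The formula with floors makes
  it measurable in \<open>y\<close>, and its values are 0 or 1 for every real \<open>y\<close>, not
  only in the unit interval.\<close>

definition bin_digit :: "nat \<Rightarrow> real \<Rightarrow> real" where
  "bin_digit n y = of_int (\<lfloor>2 ^ Suc n * y\<rfloor> - 2 * \<lfloor>2 ^ n * y\<rfloor>)"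

lemma bin_digit_01: "bin_digit n y = 0 \<or> bin_digit n y = 1"
proof -
  have "\<lfloor>2 * z\<rfloor> - 2 * \<lfloor>z\<rfloor> = 0 \<or> \<lfloor>2 * z\<rfloor> - 2 * \<lfloor>z\<rfloor> = 1" for z :: real
    by linarith
  from this[of "2 ^ n * y"] show ?thesis unfolding bin_digit_def by (auto simp: mult.assoc)
qed

lemma measurable_bin_digit [measurable]: "bin_digit n \<in> borel_measurable borel"
  unfolding bin_digit_def[abs_def] by measurable

text \<open>The partial sums telescope to \<open>\<lfloor>2 ^ N * y\<rfloor> / 2 ^ N\<close>;
  restricting \<open>y\<close> to \<open>[0, 1)\<close> makes the starting term
  \<open>\<lfloor>y\<rfloor>\<close> vanish.\<close>

lemma bin_digit_sums:
  assumes "0 \<le> y" "y < 1"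
  shows "(\<lambda>n. bin_digit n y / 2 ^ Suc n) sums y"
proof -
  have part: "(\<Sum>n<N. bin_digit n y / 2 ^ Suc n) = of_int \<lfloor>2 ^ N * y\<rfloor> / 2 ^ N" for N
  proof (induction N)
    case 0
    have "\<lfloor>y\<rfloor> = 0" using assms by linarith
    then show ?case by simp
  next
    case (Suc N)
    then show ?case by (simp add: bin_digit_def field_simps)
  qed
  have "(\<lambda>N. of_int \<lfloor>2 ^ N * y\<rfloor> / 2 ^ N) \<longlonglongrightarrow> y"
  proof (rule tendsto_sandwich[of "\<lambda>N. y - (1/2) ^ N" _ _ "\<lambda>_. y"])
    have "(\<lambda>N. y - (1/2) ^ N) \<longlonglongrightarrow> y - 0" by (intro tendsto_intros LIMSEQ_power_zero) auto
    then show "(\<lambda>N. y - (1/2) ^ N) \<longlonglongrightarrow> y" by simp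
    have "y - (1/2) ^ N \<le> of_int \<lfloor>2 ^ N * y\<rfloor> / 2 ^ N" for N
    proof -
      have "2 ^ N * y - 1 \<le> of_int \<lfloor>2 ^ N * y\<rfloor>" by linarith
      then have "(2 ^ N * y - 1) / 2 ^ N \<le> of_int \<lfloor>2 ^ N * y\<rfloor> / 2 ^ N" by (intro divide_right_mono) auto
      then show ?thesis by (simp add: diff_divide_distrib power_divide)
    qed
    then show "\<forall>\<^sub>F N in sequentially. y - (1/2) ^ N \<le> of_int \<lfloor>2 ^ N * y\<rfloor> / 2 ^ N" by simp
    have "of_int \<lfloor>2 ^ N * y\<rfloor> / 2 ^ N \<le> y" for N
      using of_int_floor_le[of "2 ^ N * y"] by (simp add: divide_le_eq mult.commute)
    then show "\<forall>\<^sub>F N in sequentially. of_int \<lfloor>2 ^ N * y\<rfloor> / 2 ^ N \<le> y" by simp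
  qed auto
  then show ?thesis unfolding sums_def part .
qed

text \<open>The section \<open>s\<close> interleaves the binary digits of all coordinates into one
  ternary expansion, and \<Gamma> recovers them with \<open>bit_wave\<close>. Reading is continuous,
  as a uniform limit; extracting digits is merely measurable.\<close>

lemma space_filling_curve:
  fixes R :: real
  shows "\<exists>(\<Gamma> :: real \<Rightarrow> 'a::euclidean_space) s. continuous_on UNIV \<Gamma> \<and> s \<in> borel_measurable borel
    \<and> (\<forall>x. 0 \<le> s x \<and> s x \<le> 1) \<and> (\<forall>x. norm x \<le> R \<longrightarrow> \<Gamma> (s x) = x)"
proof -
  obtain idx :: "'a \<Rightarrow> nat" where idx: "bij_betw idx Basis {..<DIM('a)}"
    using finite_same_card_bij[of "Basis :: 'a set" "{..<DIM('a)}"] by auto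
  define bs where "bs = inv_into Basis idx"
  have bs: "bs (idx b) = b" if "b \<in> Basis" for b
    using idx that unfolding bs_def by (meson bij_betw_inv_into_left)
  have idx_less: "idx b < DIM('a)" if "b \<in> Basis" for b
    using idx that by (auto simp: bij_betw_def)
  \<comment> \<open>Strictly larger than \<open>R\<close>, so that the rescaled coordinates
    \<open>c b x\<close> fall into \<open>[0, 1)\<close>, as \<open>bin_digit_sums\<close>
    demands.\<close>
  define L where "L = max R 0 + 1"
  define c where "c b x = (x \<bullet> b + L) / (2 * L)" for b x :: 'a
  \<comment> \<open>With \<open>d\<close> the dimension, position \<open>j\<close> stores digit
    \<open>j div d\<close> of the coordinate numbered \<open>j mod d\<close>.\<close>
  define dig where "dig x j = bin_digit (j div DIM('a)) (c (bs (j mod DIM('a))) x)" for x j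
  define s where "s x = ternary (dig x)" for x
  define y where "y b u = (\<Sum>n. bit_wave (3 ^ (n * DIM('a) + idx b) * u) / 2 ^ Suc n)" for b u
  define \<Gamma> where "\<Gamma> u = (\<Sum>b\<in>Basis. (2 * L * y b u - L) *\<^sub>R b)" for u
  have y_cont: "continuous_on UNIV (y b)" for b
  proof (rule uniform_limit_theorem)
    show "uniform_limit UNIV (\<lambda>N u. \<Sum>n<N. bit_wave (3 ^ (n * DIM('a) + idx b) * u) / 2 ^ Suc n) (y b) sequentially"
      unfolding y_def
    proof (rule Weierstrass_m_test)
      show "norm (bit_wave (3 ^ (n * DIM('a) + idx b) * u) / 2 ^ Suc n) \<le> (1/2) ^ Suc n" for n u
        using bit_wave_bounds[of "3 ^ (n * DIM('a) + idx b) * u"] by (simp add: power_divide divide_right_mono)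
      show "summable (\<lambda>n. (1/2::real) ^ Suc n)" by (intro summable_mult summable_geometric iffD2[OF summable_Suc_iff]) auto
    qed
    show "\<forall>\<^sub>F N in sequentially. continuous_on UNIV (\<lambda>u. \<Sum>n<N. bit_wave (3 ^ (n * DIM('a) + idx b) * u) / 2 ^ Suc n)"
      by (intro always_eventually allI continuous_intros) auto
  qed auto
  have "continuous_on UNIV \<Gamma>"
    unfolding \<Gamma>_def by (intro continuous_intros y_cont)
  moreover have "s \<in> borel_measurable borel"
    unfolding s_def[abs_def] ternary_def dig_def c_def by measurable
  moreover have dig01: "dig x j = 0 \<or> dig x j = 1" for x j
    unfolding dig_def by (rule bin_digit_01)
  then have "0 \<le> s x \<and> s x \<le> 1" for x
    unfolding s_def using ternary_bounds(2,3)[of "dig x"] by (metis order_refl zero_le_one)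
  moreover have "\<Gamma> (s x) = x" if x: "norm x \<le> R" for x
  proof -
    have "2 * L * y b (s x) - L = x \<bullet> b" if b: "b \<in> Basis" for b
    proof -
      have D: "DIM('a) > 0" by simp
      have "\<bar>x \<bullet> b\<bar> \<le> norm x" using b by (rule Basis_le_norm)
      then have L: "L > 0" "- L \<le> x \<bullet> b" "x \<bullet> b < L" using x by (auto simp: L_def)
      have "dig x (n * DIM('a) + idx b) = bin_digit n (c b x)" for n
        unfolding dig_def using bs[OF b] idx_less[OF b] by simp
      then have "y b (s x) = (\<Sum>n. bin_digit n (c b x) / 2 ^ Suc n)"
        unfolding y_def s_def bit_wave_ternary[OF dig01] by simp
      also have "\<dots> = c b x"
        using L by (intro sums_unique[symmetric] bin_digit_sums) (auto simp: c_def field_simps)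
      finally show ?thesis using L by (simp add: c_def)
    qed
    then show ?thesis unfolding \<Gamma>_def by (simp add: euclidean_representation cong: sum.cong)
  qed
  ultimately show ?thesis by blast
qed

text \<open>The measurable section \<open>s\<close> of the curve transports the measures to the unit interval, where
  Helly's selection theorem applies; the curve itself transports the limit back.\<close>

lemma weak_compactness:
  fixes \<mu> :: "nat \<Rightarrow> 'a::euclidean_space measure"
  assumes fin: "\<And>n. fin_borel (\<mu> n)" and mass: "\<And>n. measure (\<mu> n) UNIV \<le> C"
    and supp: "\<And>n. AE x in \<mu> n. norm x \<le> R"
  shows "\<exists>r \<nu>. strict_mono (r :: nat \<Rightarrow> nat) \<and> fin_borel \<nu> \<and>
    (\<forall>f :: 'a \<Rightarrow> complex. \<forall>B. continuous_on UNIV f \<longrightarrow> (\<forall>x. cmod (f x) \<le> B) \<longrightarrow>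
      (\<lambda>n. \<integral>x. f x \<partial>\<mu> (r n)) \<longlonglongrightarrow> (\<integral>x. f x \<partial>\<nu>))"
proof -
  obtain \<Gamma> :: "real \<Rightarrow> 'a" and s where \<Gamma>: "continuous_on UNIV \<Gamma>" and s [measurable]: "s \<in> borel_measurable borel"
    and s01: "\<And>x. 0 \<le> s x" "\<And>x. s x \<le> 1" and inv: "\<And>x. norm x \<le> R \<Longrightarrow> \<Gamma> (s x) = x"
    using space_filling_curve[of R] by blast
  have [measurable]: "\<Gamma> \<in> borel_measurable borel" by (intro borel_measurable_continuous_onI \<Gamma>)
  have sets [measurable_cong]: "sets (\<mu> n) = sets borel" for n using fin by (simp add: fin_borel_def)
  have space [simp]: "space (\<mu> n) = UNIV" for n using sets_eq_imp_space_eq[OF sets] by simp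
  have finm: "finite_measure (\<mu> n)" for n using fin by (simp add: fin_borel_def)
  define m where "m n = measure (\<mu> n) UNIV" for n
  have em: "emeasure (\<mu> n) UNIV = ennreal (m n)" for n
    unfolding m_def using finm by (simp add: finite_measure.emeasure_eq_measure)
  have m0: "m n \<ge> 0" for n by (simp add: m_def)
  have "bounded (range m)" using mass m0 by (intro boundedI[of _ C]) (auto simp: m_def)
  \<comment> \<open>The total masses are bounded but vary with \<open>n\<close>. A first subsequence
    makes them converge; normalization then leaves a question about probability measures.\<close>
  then obtain l r1 where r1: "strict_mono r1" "(m \<circ> r1) \<longlonglongrightarrow> l"
    using bounded_imp_convergent_subsequence by blast
  have l: "l \<ge> 0" using LIMSEQ_le_const[OF r1(2)] m0 by auto
  \<comment> \<open>When the mass vanishes the point mass at 0 is a placeholder; it will be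
    multiplied by \<open>m n = 0\<close>.\<close>
  define P where "P n = (if m n = 0 then return borel 0 else distr (density (\<mu> n) (\<lambda>_. ennreal (1 / m n))) borel s)" for n
  have P: "real_distribution (P n)" for n
  proof (cases "m n = 0")
    case True
    then show ?thesis
      by (auto simp: P_def real_distribution_def real_distribution_axioms_def intro: prob_space_return)
  next
    case False
    then have "m n > 0" using m0[of n] by simp
    then have "ennreal (1 / m n) * emeasure (\<mu> n) UNIV = 1"
      unfolding em by (simp flip: ennreal_mult)
    then have "prob_space (density (\<mu> n) (\<lambda>_. ennreal (1 / m n)))"
      by (intro prob_spaceI) (simp add: emeasure_density)
    then have "prob_space (distr (density (\<mu> n) (\<lambda>_. ennreal (1 / m n))) borel s)"
      by (rule prob_space.prob_space_distr) measurable
    then show ?thesis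
      using False by (auto simp: P_def real_distribution_def real_distribution_axioms_def)
  qed
  \<comment> \<open>All these laws are carried by \<open>[0, 1]\<close>, so a single interval works.
    Its left end lies below 0 because the interval is open there.\<close>
  have tight: "tight P"
    unfolding tight_def
  proof (intro conjI allI impI P)
    fix \<epsilon> :: real assume e: "\<epsilon> > 0"
    have "measure (P n) {-1<..1} = 1" for n
    proof -
      interpret real_distribution "P n" by (rule P)
      have "AE u in P n. u \<in> {-1<..1}"
      proof (cases "m n = 0")
        case False
        have "AE x in density (\<mu> n) (\<lambda>_. ennreal (1 / m n)). s x \<in> {-1<..1}"
        proof (rule AE_I2)
          fix x show "s x \<in> {-1<..1}" using s01[of x] by simp
        qed
        then show ?thesis unfolding P_def if_not_P[OF False] by (subst AE_distr_iff) auto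
      next
        case True
        then show ?thesis unfolding P_def if_P[OF True] by (subst AE_return) auto
      qed
      then show ?thesis by (intro prob_eq_1[THEN iffD2]) auto
    qed
    then show "\<exists>a b. a < b \<and> (\<forall>n. 1 - \<epsilon> < measure (P n) {a<..b})"
      using e by (intro exI[of _ "-1"] exI[of _ 1]) auto
  qed
  obtain r2 M where r2: "strict_mono r2" and M: "real_distribution M" and w: "weak_conv_m (P \<circ> r1 \<circ> r2) M"
    using tight_imp_convergent_subsubsequence[OF tight r1(1)] by blast
  interpret M: real_distribution M by (rule M)
  \<comment> \<open>The limit law, rescaled to the limit mass and carried back along the
    curve.\<close>
  define \<nu> where "\<nu> = distr (density M (\<lambda>_. ennreal l)) borel \<Gamma>"
  have "fin_borel \<nu>"
  proof -
    have "finite_measure (density M (\<lambda>_. ennreal l))"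
      by (intro finite_measureI) (simp add: emeasure_density ennreal_mult_eq_top_iff M.emeasure_eq_measure)
    then show ?thesis unfolding \<nu>_def fin_borel_def by (auto intro: finite_measure.finite_measure_distr)
  qed
  moreover have "(\<lambda>n. \<integral>x. f x \<partial>\<mu> ((r1 \<circ> r2) n)) \<longlonglongrightarrow> (\<integral>x. f x \<partial>\<nu>)"
    if f: "continuous_on UNIV f" and B: "\<And>x. cmod (f x) \<le> B" for f :: "'a \<Rightarrow> complex" and B
  proof -
    have [measurable]: "f \<in> borel_measurable borel" by (intro borel_measurable_continuous_onI f)
    have eq: "(\<integral>x. f x \<partial>\<mu> n) = of_real (m n) * (\<integral>u. f (\<Gamma> u) \<partial>P n)" for n
    proof (cases "m n = 0")
      case True
      then have "emeasure (\<mu> n) UNIV = 0" by (simp add: em)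
      then have "AE x in \<mu> n. f x = 0" by (intro AE_I[of _ _ UNIV]) auto
      then have "(\<integral>x. f x \<partial>\<mu> n) = 0" by (rule integral_eq_zero_AE)
      then show ?thesis using True by simp
    next
      case False
      then have mp: "m n > 0" using m0[of n] by simp
      have "(\<integral>u. f (\<Gamma> u) \<partial>P n) = (\<integral>x. (1 / m n) *\<^sub>R f (\<Gamma> (s x)) \<partial>\<mu> n)"
        using mp by (simp add: P_def integral_distr integral_density)
      also have "\<dots> = (1 / m n) *\<^sub>R (\<integral>x. f (\<Gamma> (s x)) \<partial>\<mu> n)" by simp
      \<comment> \<open>The measures are carried by the ball on which \<Gamma> inverts
        \<open>s\<close>.\<close>
      also have "(\<integral>x. f (\<Gamma> (s x)) \<partial>\<mu> n) = (\<integral>x. f x \<partial>\<mu> n)"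
        using supp[of n] by (intro integral_cong_AE) (auto elim!: eventually_mono simp: inv)
      finally show ?thesis using mp by (simp add: scaleR_conv_of_real)
    qed
    have c: "continuous_on UNIV (\<lambda>u. f (\<Gamma> u))"
      by (rule continuous_on_compose2[OF f \<Gamma>]) auto
    have "(\<lambda>n. \<integral>u. f (\<Gamma> u) \<partial>(P \<circ> r1 \<circ> r2) n) \<longlonglongrightarrow> (\<integral>u. f (\<Gamma> u) \<partial>M)"
      by (rule weak_conv_imp_integral_bdd_continuous_conv[OF _ M w _ B])
        (use P c in \<open>auto simp: continuous_on_eq_continuous_at\<close>)
    moreover have "(\<lambda>n. complex_of_real ((m \<circ> r1) (r2 n))) \<longlonglongrightarrow> of_real l"
      using LIMSEQ_subseq_LIMSEQ[OF r1(2) r2] by (intro tendsto_of_real) (simp add: o_def)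
    ultimately have "(\<lambda>n. complex_of_real ((m \<circ> r1) (r2 n)) * (\<integral>u. f (\<Gamma> u) \<partial>(P \<circ> r1 \<circ> r2) n)) \<longlonglongrightarrow> of_real l * (\<integral>u. f (\<Gamma> u) \<partial>M)"
      by (intro tendsto_mult)
    moreover have "(\<integral>x. f x \<partial>\<nu>) = of_real l * (\<integral>u. f (\<Gamma> u) \<partial>M)"
      unfolding \<nu>_def using l by (simp add: integral_distr integral_density scaleR_conv_of_real)
    ultimately show ?thesis by (simp add: eq o_def)
  qed
  ultimately show ?thesis
    using strict_mono_o[OF r1(1) r2] by (intro exI[of _ "r1 \<circ> r2"] exI[of _ \<nu>]) blast
qed

section \<open>Fourier--Stieltjes functions\<close>

text \<open>On the right \<phi> enters only through \<open>khat_conv k \<phi>\<close>, the function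
  that (b) represents as the transform of a measure.\<close>

lemma pair_ft_mult_eq_khat_conv:
  fixes \<phi> k u :: "'a::euclidean_space \<Rightarrow> complex"
  assumes \<phi>: "\<phi> \<in> Cb" and u: "nice u" and k: "nice k"
  shows "pair_ft \<phi> (\<lambda>x. u x * k x) = (LBINT s. FT u s * khat_conv k \<phi> (- s))"
proof -
  obtain B where B: "\<And>t. cmod (\<phi> t) \<le> B" using Cb_bounded[OF \<phi>] by metis
  have [measurable]: "\<phi> \<in> borel_measurable borel" by (rule Cb_measurable[OF \<phi>])
  have uk: "integrable lborel (FT u)" "integrable lborel (FT k)" "integrable lborel k"
    using u k by (auto simp: nice_def integrable_Cc)
  have "pair_ft \<phi> (\<lambda>x. u x * k x) = (LBINT r. \<phi> (- r) * (LBINT s. FT k (r - s) * FT u s))"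
    unfolding pair_ft_def FT_nice_mult[OF u uk(3)] khat_conv_eq_conv conv_commute[of "FT k" "FT u"]
    by (subst conv_commute) (simp add: conv_def)
  also have "\<dots> = (LBINT r. (LBINT s. \<phi> (- r) * (FT k (r - s) * FT u s)))" by simp
  also have "\<dots> = (LBINT s. (LBINT r. \<phi> (- r) * (FT k (r - s) * FT u s)))"
  proof (rule lborel_pair.Fubini_integral)
    have "integrable (lborel \<Otimes>\<^sub>M lborel) (\<lambda>p. \<phi> (- snd p) * (\<lambda>(s, r). FT k (r - s) * FT u s) p)"
      by (rule integrable_bounded_mult[OF integrable_conv_pair[OF uk(2,1)] B]) measurable
    then show "integrable (lborel \<Otimes>\<^sub>M lborel) (\<lambda>(s, r). \<phi> (- r) * (FT k (r - s) * FT u s))"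
      by (simp add: split_beta')
  qed
  also have "\<dots> = (LBINT s. FT u s * khat_conv k \<phi> (- s))"
  proof (intro Bochner_Integration.integral_cong refl)
    fix s
    have "(LBINT r. \<phi> (- r) * (FT k (r - s) * FT u s)) = FT u s * (LBINT r. (\<lambda>r. \<phi> (- r) * FT k (r - s)) r)"
      by (subst integral_mult_right_zero[symmetric]) (simp add: mult_ac)
    also have "(LBINT r. (\<lambda>r. \<phi> (- r) * FT k (r - s)) r) = (LBINT q. \<phi> (- s - q) * FT k q)"
      using lborel_integral_shift[of "\<lambda>r. \<phi> (- r) * FT k (r - s)" s] by simp
    finally show "(LBINT r. \<phi> (- r) * (FT k (r - s) * FT u s)) = FT u s * khat_conv k \<phi> (- s)"
      by (simp add: khat_conv_def)
  qed
  finally show ?thesis .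
qed

text \<open>Parseval's formula for a test function and a finite measure: after Fubini the inner
  integral is the inversion formula for \<open>u\<close>.\<close>

lemma integral_FT_mult_FT_meas:
  fixes u :: "'a::euclidean_space \<Rightarrow> complex"
  assumes u: "nice u" and \<mu>: "fin_borel \<mu>"
  shows "integrable lborel (\<lambda>s. FT u s * FT_meas \<mu> (- s))"
    and "(LBINT s. FT u s * FT_meas \<mu> (- s)) = ft_const TYPE('a) * (\<integral>x. u x \<partial>\<mu>)"
proof -
  interpret finite_measure \<mu> using \<mu> by (simp add: fin_borel_def)
  have [measurable_cong]: "sets \<mu> = sets borel" using \<mu> by (simp add: fin_borel_def)
  have i: "integrable lborel (FT u)" using u by (simp add: nice_def)
  have meas [measurable]: "(\<lambda>s. \<integral>x. cis (x \<bullet> s) \<partial>\<mu>) \<in> borel_measurable borel"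
    by measurable
  have b: "cmod (\<integral>x. cis (x \<bullet> s) \<partial>\<mu>) \<le> measure \<mu> (space \<mu>)" for s
    by (rule order_trans[OF integral_norm_bound]) simp
  have "integrable lborel (\<lambda>s. (\<integral>x. cis (x \<bullet> s) \<partial>\<mu>) * FT u s)"
    by (rule integrable_bounded_mult[OF i b]) measurable
  then have "integrable lborel (\<lambda>s. ft_const TYPE('a) * ((\<integral>x. cis (x \<bullet> s) \<partial>\<mu>) * FT u s))"
    by (rule integrable_mult_right)
  then show "integrable lborel (\<lambda>s. FT u s * FT_meas \<mu> (- s))"
    by (simp add: FT_meas_def mult_ac)
  have "(LBINT s. FT u s * FT_meas \<mu> (- s)) = ft_const TYPE('a) * (LBINT s. FT u s * (\<integral>x. cis (x \<bullet> s) * 1 \<partial>\<mu>))"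
    by (subst integral_mult_right_zero[symmetric]) (simp add: FT_meas_def mult_ac)
  also have "(LBINT s. FT u s * (\<integral>x. cis (x \<bullet> s) * 1 \<partial>\<mu>)) = (\<integral>x. 1 * (LBINT s. cis (x \<bullet> s) * FT u s) \<partial>\<mu>)"
    by (rule Fubini_bounded_kernel[where C = 1])
      (use i in \<open>auto intro: lborel.sigma_finite_measure_axioms sigma_finite_measure_axioms\<close>)
  finally show "(LBINT s. FT u s * FT_meas \<mu> (- s)) = ft_const TYPE('a) * (\<integral>x. u x \<partial>\<mu>)"
    by (simp only: nice_inversion[OF u, symmetric] mult_1_left)
qed

text \<open>For each ball one \<open>k\<close> suffices: the cutoff equals 1 there, so
  \<open>u x * k x = u x\<close>, and (b) expresses \<open>L u\<close> by integrals of
  \<open>u\<close> against four finite measures. Their total masses yield the constant.\<close>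

lemma locally_bdd_of_B_hat:
  fixes \<phi> :: "'a::euclidean_space \<Rightarrow> complex"
  assumes \<phi>: "\<phi> \<in> Cb" and B_hat: "\<And>k. k \<in> Cc \<inter> B_FS \<Longrightarrow> khat_conv k \<phi> \<in> B_hat"
  shows "locally_bdd \<phi>"
  unfolding locally_bdd_def
proof
  fix R
  define k :: "'a \<Rightarrow> complex" where "k = cutoff R"
  have k: "nice k" unfolding k_def by (rule nice_cutoff)
  then have "khat_conv k \<phi> \<in> B_hat" by (intro B_hat) (simp add: nice_iff)
  then obtain \<mu>1 \<mu>2 \<mu>3 \<mu>4 :: "'a measure" where fin: "fin_borel \<mu>1" "fin_borel \<mu>2" "fin_borel \<mu>3" "fin_borel \<mu>4"
    and eq: "\<And>t. khat_conv k \<phi> t = FT_meas \<mu>1 t - FT_meas \<mu>2 t + \<i> * (FT_meas \<mu>3 t - FT_meas \<mu>4 t)"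
    unfolding B_hat_def by blast
  let ?I = "\<lambda>u \<mu>. \<integral>x. u x \<partial>\<mu>"
  let ?m = "\<lambda>\<mu> :: 'a measure. measure \<mu> (space \<mu>)"
  let ?C = "cmod (ft_const TYPE('a)) * (?m \<mu>1 + ?m \<mu>2 + ?m \<mu>3 + ?m \<mu>4)"
  have "cmod (pair_ft \<phi> u) \<le> ?C * M" if u: "nice u" "supp_in R u" "\<And>x. cmod (u x) \<le> M" for u M
  proof -
    have bd: "cmod (\<integral>x. u x \<partial>\<mu>) \<le> ?m \<mu> * M" if "fin_borel \<mu>" for \<mu>
    proof -
      interpret finite_measure \<mu> using that by (simp add: fin_borel_def)
      have M: "M \<ge> 0" using u(3)[of 0] norm_ge_zero order_trans by blast
      have "cmod (\<integral>x. u x \<partial>\<mu>) \<le> (\<integral>x. cmod (u x) \<partial>\<mu>)" by (rule integral_norm_bound)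
      also have "\<dots> \<le> (\<integral>x. M \<partial>\<mu>)" by (rule integral_mono') (use u(3) M in auto)
      finally show ?thesis by simp
    qed
    have "u x * k x = u x" for x
      using u(2) cutoff_eq_1[of x R] by (cases "norm x \<le> R") (auto simp: supp_in_def k_def)
    then have "(\<lambda>x. u x * k x) = u" by (rule ext)
    then have "pair_ft \<phi> u = (LBINT s. FT u s * khat_conv k \<phi> (- s))"
      using pair_ft_mult_eq_khat_conv[OF \<phi> u(1) k] by simp
    also have "\<dots> = (LBINT s. (FT u s * FT_meas \<mu>1 (- s) - FT u s * FT_meas \<mu>2 (- s))
        + \<i> * (FT u s * FT_meas \<mu>3 (- s) - FT u s * FT_meas \<mu>4 (- s)))"
      unfolding eq by (simp add: algebra_simps)
    also have "\<dots> = ft_const TYPE('a) * (?I u \<mu>1 - ?I u \<mu>2 + \<i> * (?I u \<mu>3 - ?I u \<mu>4))"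
      using fin by (simp add: integral_FT_mult_FT_meas[OF u(1)] algebra_simps)
    finally have "pair_ft \<phi> u = ft_const TYPE('a) * (?I u \<mu>1 - ?I u \<mu>2 + \<i> * (?I u \<mu>3 - ?I u \<mu>4))" .
    moreover from norm_signed_sum_le[of "?I u \<mu>1" "?I u \<mu>2" "?I u \<mu>3" "?I u \<mu>4"]
    have "cmod (?I u \<mu>1 - ?I u \<mu>2 + \<i> * (?I u \<mu>3 - ?I u \<mu>4))
        \<le> (?m \<mu>1 + ?m \<mu>2 + ?m \<mu>3 + ?m \<mu>4) * M"
      using bd[OF fin(1)] bd[OF fin(2)] bd[OF fin(3)] bd[OF fin(4)] by (simp add: distrib_right)
    ultimately show ?thesis by (simp add: norm_mult mult.assoc mult_left_mono)
  qed
  then show "\<exists>C. pair_ft_bound \<phi> R C"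
    unfolding pair_ft_bound_def by blast
qed

section \<open>Mollified densities, their local L1 bounds and weak limits\<close>

lemma measurable_cnj [measurable]: "cnj \<in> borel_measurable borel"
  by (intro borel_measurable_continuous_onI continuous_intros)

text \<open>The continuous density of the mollified functional \<open>L * e\<^sub>n\<close>:
  integrating \<open>v\<close> against it gives \<open>L\<close> of \<open>conv v (en n)\<close>,
  see \<open>integral_mult_smoothed\<close>.\<close>

definition smoothed :: "('a::euclidean_space \<Rightarrow> complex) \<Rightarrow> nat \<Rightarrow> 'a \<Rightarrow> complex" where
  "smoothed \<phi> n x = (LBINT r. cis (x \<bullet> r) * (\<phi> r * FT (en n) r))"

lemma integrable_mult_FT_en:
  fixes \<phi> :: "'a::euclidean_space \<Rightarrow> complex"
  assumes \<phi>: "\<phi> \<in> Cb" and n: "n \<ge> 1"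
  shows "integrable lborel (\<lambda>r. \<phi> r * FT (en n) r)"
proof -
  obtain B where B: "\<And>t. cmod (\<phi> t) \<le> B" using Cb_bounded[OF \<phi>] by metis
  have "\<phi> \<in> borel_measurable lborel" using Cb_measurable[OF \<phi>] by simp
  then show ?thesis by (rule integrable_bounded_mult[OF integrable_FT_en[OF n] B])
qed

lemma continuous_smoothed:
  assumes "\<phi> \<in> Cb" "n \<ge> 1"
  shows "continuous_on UNIV (smoothed \<phi> n)"
  using continuous_Fourier_integral[OF integrable_mult_FT_en[OF assms]]
  by (simp add: smoothed_def[abs_def] inner_commute)

lemma integral_smoothed:
  fixes \<phi> v :: "'a::euclidean_space \<Rightarrow> complex"
  assumes \<phi>: "\<phi> \<in> Cb" and n: "n \<ge> 1" and v: "integrable lborel v"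
  shows "ft_const TYPE('a) * (LBINT x. v x * smoothed \<phi> n x) = (LBINT r. \<phi> (- r) * FT v r * FT (en n) r)"
proof -
  have "(LBINT x. v x * smoothed \<phi> n x) = (LBINT r. (\<phi> r * FT (en n) r) * (LBINT x. cis (x \<bullet> r) * v x))"
    unfolding smoothed_def
    by (rule Fubini_bounded_kernel[where C = 1])
      (use v integrable_mult_FT_en[OF \<phi> n] in \<open>auto intro: lborel.sigma_finite_measure_axioms\<close>)
  also have "ft_const TYPE('a) * \<dots> = (LBINT r. (\<lambda>r. \<phi> (- r) * FT v r * FT (en n) r) (- r))"
    by (subst integral_mult_right_zero[symmetric]) (simp add: FT_def[of v] FT_en_even[OF n] mult_ac)
  also have "\<dots> = (LBINT r. \<phi> (- r) * FT v r * FT (en n) r)"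
    by (rule lborel_integral_uminus[of "\<lambda>r. \<phi> (- r) * FT v r * FT (en n) r"])
  finally show ?thesis .
qed

lemma pair_ft_conv_en:
  fixes \<phi> v :: "'a::euclidean_space \<Rightarrow> complex"
  assumes n: "n \<ge> 1" and v: "integrable lborel v"
  shows "ft_const TYPE('a) * pair_ft \<phi> (conv v (en n)) = (LBINT r. \<phi> (- r) * FT v r * FT (en n) r)"
  unfolding pair_ft_def FT_conv[OF v integrable_en[OF n]]
  by (subst integral_mult_right_zero[symmetric]) (simp add: mult_ac)

lemma integral_mult_smoothed:
  fixes \<phi> v :: "'a::euclidean_space \<Rightarrow> complex"
  assumes \<phi>: "\<phi> \<in> Cb" and n: "n \<ge> 1" and v: "integrable lborel v"
  shows "(LBINT x. v x * smoothed \<phi> n x) = pair_ft \<phi> (conv v (en n))"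
proof -
  have "ft_const TYPE('a) * (LBINT x. v x * smoothed \<phi> n x) = ft_const TYPE('a) * pair_ft \<phi> (conv v (en n))"
    unfolding integral_smoothed[OF assms] pair_ft_conv_en[OF n v] ..
  then show ?thesis by simp
qed

text \<open>Testing with the conjugate sign computes the L1 norm. The resulting \<open>v\<close> is
  only bounded and measurable, but \<open>L\<close> is applied to \<open>conv v (en n)\<close>,
  which lies in its domain and obeys the same supremum bound.\<close>

lemma integral_norm_smoothed_le:
  fixes \<phi> :: "'a::euclidean_space \<Rightarrow> complex"
  assumes \<phi>: "\<phi> \<in> Cb" "locally_bdd \<phi>"
  shows "\<exists>C. \<forall>n\<ge>1. \<forall>k B. k \<in> borel_measurable borel \<longrightarrow> supp_in R k \<longrightarrow> (\<forall>x. cmod (k x) \<le> B) \<longrightarrow>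
    (LBINT x. cmod (k x * smoothed \<phi> n x)) \<le> C * B"
proof -
  obtain C where C: "C \<ge> 0" "pair_ft_bound \<phi> (R + 1) C"
    using locally_bddD[OF \<phi>(2)] .
  have "(LBINT x. cmod (k x * smoothed \<phi> n x)) \<le> C * B"
    if n: "n \<ge> 1" and [measurable]: "k \<in> borel_measurable borel" and R: "supp_in R k" and B: "\<And>x. cmod (k x) \<le> B" for n k B
  proof -
    have [measurable]: "smoothed \<phi> n \<in> borel_measurable borel"
      by (intro borel_measurable_continuous_onI continuous_smoothed \<phi> n)
    define w where "w x = k x * smoothed \<phi> n x" for x
    have [measurable]: "w \<in> borel_measurable borel" unfolding w_def[abs_def] by measurable
    \<comment> \<open>Where \<open>w x = 0\<close> the quotient is 0 by the convention for division
      by zero.\<close>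
    define v where "v x = k x * (cnj (w x) / of_real (cmod (w x)))" for x
    have [measurable]: "v \<in> borel_measurable borel" unfolding v_def[abs_def] by measurable
    have vB: "cmod (v x) \<le> B" for x
      using B[of x] order_trans[OF norm_ge_zero B[of x]] by (simp add: v_def norm_mult norm_divide)
    have vR: "supp_in R v" using R by (simp add: supp_in_def v_def)
    have vi: "integrable lborel v" by (rule integrable_bounded_support[OF _ vB vR]) measurable
    have "v x * smoothed \<phi> n x = of_real (cmod (w x))" for x
    proof -
      have "v x * smoothed \<phi> n x = w x * cnj (w x) / of_real (cmod (w x))" by (simp add: v_def w_def)
      also have "\<dots> = of_real (cmod (w x))" by (simp add: complex_norm_square[symmetric] power2_eq_square)
      finally show ?thesis .
    qed
    then have "complex_of_real (LBINT x. cmod (w x)) = pair_ft \<phi> (conv v (en n))"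
      using integral_mult_smoothed[OF \<phi>(1) n vi] by simp
    then have "cmod (complex_of_real (LBINT x. cmod (w x))) = cmod (pair_ft \<phi> (conv v (en n)))" by simp
    then have "(LBINT x. cmod (w x)) = cmod (pair_ft \<phi> (conv v (en n)))" by simp
    also have "\<dots> \<le> C * B"
      by (intro pair_ft_boundD[OF C(2)] nice_conv_en[OF vi vR n] supp_in_conv_en[OF vR n] norm_conv_en_le[OF n vB])
    finally show ?thesis by (simp add: w_def)
  qed
  then show ?thesis by blast
qed

lemma AE_pos_meas_supp:
  assumes u: "supp_in R u" and [measurable]: "u \<in> borel_measurable borel"
  shows "AE x in pos_meas u. norm x \<le> R"
  unfolding pos_meas_def using u
  by (subst AE_density) (auto simp: supp_in_def intro!: AE_I2 leI)

text \<open>The densities \<open>u n\<close> have bounded L1 norms and supports in one ball, so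
  along a subsequence their four positive parts converge weakly. The limit is identified by testing
  with characters: \<open>L\<close> of \<open>cis (- (x \<bullet> t)) * k x\<close> equals
  \<open>khat_conv k \<phi> t\<close>.\<close>

lemma B_hat_of_locally_bdd:
  fixes \<phi> :: "'a::euclidean_space \<Rightarrow> complex"
  assumes \<phi>: "\<phi> \<in> Cb" "locally_bdd \<phi>" and k: "k \<in> Cc \<inter> B_FS"
  shows "khat_conv k \<phi> \<in> B_hat"
proof -
  let ?c = "ft_const TYPE('a)"
  have kn: "nice k" and kc: "k \<in> Cc" using k by (simp_all add: nice_iff)
  obtain R where R: "supp_in R k" using Cc_supp[OF kc] by metis
  obtain B where B: "\<And>x. cmod (k x) \<le> B" using Cc_bounded[OF kc] by metis
  have [measurable]: "k \<in> borel_measurable borel" by (rule Cc_measurable[OF kc])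
  obtain C where C: "\<And>n. (LBINT x. cmod (k x * smoothed \<phi> (Suc n) x)) \<le> C * B"
    using integral_norm_smoothed_le[OF \<phi>, of R] R B by (metis Suc_eq_plus1 le_add2 \<open>k \<in> borel_measurable borel\<close>)
  \<comment> \<open>The factor compensates for \<open>ft_const\<close> in
    \<open>FT_meas\<close>.\<close>
  define u where "u n x = (1 / ?c) * (k x * smoothed \<phi> (Suc n) x)" for n x
  have ui: "integrable lborel (u n)" for n
  proof -
    have "(\<lambda>x. k x * smoothed \<phi> (Suc n) x) \<in> Cc"
      by (rule Cc_mult_continuous[OF kc continuous_smoothed[OF \<phi>(1)]]) simp
    then show ?thesis unfolding u_def[abs_def] by (intro integrable_mult_right integrable_Cc)
  qed
  have uR: "supp_in R (u n)" for n using R by (simp add: supp_in_def u_def)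
  have uC: "(LBINT x. cmod (u n x)) \<le> cmod (1 / ?c) * (C * B)" for n
    unfolding u_def norm_mult[of "1 / ?c"] using C[of n] by (simp add: mult_left_mono divide_right_mono)
  \<comment> \<open>The multipliers stand in the order of
    \<open>integral_pos_meas_decomp\<close>.\<close>
  define V where "V j n = pos_meas (\<lambda>x. ([1, -1, -\<i>, \<i>] ! j) * u n x)" for j n
  have "\<exists>r \<nu>. strict_mono (r :: nat \<Rightarrow> nat) \<and> fin_borel \<nu> \<and>
      (\<forall>f :: 'a \<Rightarrow> complex. \<forall>B. continuous_on UNIV f \<longrightarrow> (\<forall>x. cmod (f x) \<le> B) \<longrightarrow>
      (\<lambda>n. \<integral>x. f x \<partial>V j (q (r n))) \<longlonglongrightarrow> (\<integral>x. f x \<partial>\<nu>))" if j: "j < 4" for j q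
  proof (rule weak_compactness)
    fix n
    let ?u = "\<lambda>x. ([1, -1, -\<i>, \<i>] ! j) * u (q n) x"
    have "cmod ([1, -1, -\<i>, \<i>] ! j) = 1" using j by (auto simp: numeral_eq_Suc less_Suc_eq)
    then have *: "cmod (?u x) = cmod (u (q n) x)" for x by (simp add: norm_mult)
    have i: "integrable lborel ?u" by (intro integrable_mult_right ui)
    show "fin_borel (V j (q n))" unfolding V_def by (rule fin_borel_pos_meas[OF i])
    show "measure (V j (q n)) UNIV \<le> cmod (1 / ?c) * (C * B)"
      unfolding V_def using measure_pos_meas_le[OF i] uC[of "q n"] unfolding * by linarith
    show "AE x in V j (q n). norm x \<le> R"
      unfolding V_def using uR[of "q n"] i by (intro AE_pos_meas_supp) (auto simp: supp_in_def)
  qed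
  note weak = this
  have lt: "(0::nat) < 4" "(1::nat) < 4" "(2::nat) < 4" "(3::nat) < 4" by simp_all
  \<comment> \<open>Four successive extractions; the arbitrary \<open>q\<close> in the preceding
    fact lets each one start from the subsequence found before.\<close>
  obtain r0 \<nu>0 where r0: "strict_mono (r0 :: nat \<Rightarrow> nat)" "fin_borel \<nu>0" and
    l0': "\<forall>f B. continuous_on UNIV f \<longrightarrow> (\<forall>x. cmod (f x) \<le> B) \<longrightarrow> (\<lambda>n. \<integral>x. f x \<partial>V 0 (r0 n)) \<longlonglongrightarrow> (\<integral>x. f x \<partial>\<nu>0)"
    using weak[OF lt(1), of "\<lambda>n. n"] by blast
  note l0 = l0'[rule_format]
  obtain r1 \<nu>1 where r1: "strict_mono (r1 :: nat \<Rightarrow> nat)" "fin_borel \<nu>1" and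
    l1': "\<forall>f B. continuous_on UNIV f \<longrightarrow> (\<forall>x. cmod (f x) \<le> B) \<longrightarrow> (\<lambda>n. \<integral>x. f x \<partial>V 1 (r0 (r1 n))) \<longlonglongrightarrow> (\<integral>x. f x \<partial>\<nu>1)"
    using weak[OF lt(2), of r0] by blast
  note l1 = l1'[rule_format]
  obtain r2 \<nu>2 where r2: "strict_mono (r2 :: nat \<Rightarrow> nat)" "fin_borel \<nu>2" and
    l2': "\<forall>f B. continuous_on UNIV f \<longrightarrow> (\<forall>x. cmod (f x) \<le> B) \<longrightarrow> (\<lambda>n. \<integral>x. f x \<partial>V 2 (r0 (r1 (r2 n)))) \<longlonglongrightarrow> (\<integral>x. f x \<partial>\<nu>2)"
    using weak[OF lt(3), of "\<lambda>n. r0 (r1 n)"] by blast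
  note l2 = l2'[rule_format]
  obtain r3 \<nu>3 where r3: "strict_mono (r3 :: nat \<Rightarrow> nat)" "fin_borel \<nu>3" and
    l3': "\<forall>f B. continuous_on UNIV f \<longrightarrow> (\<forall>x. cmod (f x) \<le> B) \<longrightarrow> (\<lambda>n. \<integral>x. f x \<partial>V 3 (r0 (r1 (r2 (r3 n))))) \<longlonglongrightarrow> (\<integral>x. f x \<partial>\<nu>3)"
    using weak[OF lt(4), of "\<lambda>n. r0 (r1 (r2 n))"] by blast
  note l3 = l3'[rule_format]
  define r where "r n = r0 (r1 (r2 (r3 n)))" for n
  have r: "strict_mono r"
    using r0(1) r1(1) r2(1) r3(1) by (simp add: r_def strict_mono_def)
  have "khat_conv k \<phi> t = FT_meas \<nu>0 t - FT_meas \<nu>1 t + \<i> * (FT_meas \<nu>2 t - FT_meas \<nu>3 t)" for t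
  proof -
    let ?f = "\<lambda>x::'a. cis (- (x \<bullet> t))"
    let ?I = "\<lambda>\<mu>. \<integral>x. ?f x \<partial>\<mu>"
    have f: "continuous_on UNIV ?f" by (intro continuous_intros)
    have fB: "cmod (?f x) \<le> 1" for x by simp
    have L: "(\<lambda>n. ?I (V 0 (r n))) \<longlonglongrightarrow> ?I \<nu>0" "(\<lambda>n. ?I (V 1 (r n))) \<longlonglongrightarrow> ?I \<nu>1"
      "(\<lambda>n. ?I (V 2 (r n))) \<longlonglongrightarrow> ?I \<nu>2" "(\<lambda>n. ?I (V 3 (r n))) \<longlonglongrightarrow> ?I \<nu>3"
      unfolding r_def
      using LIMSEQ_subseq_LIMSEQ[OF l0[OF f fB], of "\<lambda>n. r1 (r2 (r3 n))"]
        LIMSEQ_subseq_LIMSEQ[OF l1[OF f fB], of "\<lambda>n. r2 (r3 n)"]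
        LIMSEQ_subseq_LIMSEQ[OF l2[OF f fB], of r3] l3[OF f fB] r1(1) r2(1) r3(1)
      by (auto simp: o_def strict_mono_def)
    have eq: "(LBINT x. ?f x * u n x) = ?I (V 0 n) - ?I (V 1 n) + \<i> * (?I (V 2 n) - ?I (V 3 n))" for n
      using integral_pos_meas_decomp[OF ui[of n] _ fB] by (simp add: V_def numeral_2_eq_2 numeral_3_eq_3)
    have lim1: "(\<lambda>n. LBINT x. ?f x * u (r n) x) \<longlonglongrightarrow> ?I \<nu>0 - ?I \<nu>1 + \<i> * (?I \<nu>2 - ?I \<nu>3)"
      unfolding eq by (intro tendsto_intros L)
    \<comment> \<open>Modulating \<open>k\<close> translates its transform, so frequency
      \<open>t\<close> is absorbed into the test function.\<close>
    define v where "v x = ?f x * k x" for x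
    have FTv: "FT v s = FT k (s + t)" for s unfolding v_def by (rule FT_modulate)
    have vi: "integrable lborel v" unfolding v_def using integrable_Cc[OF kc] by (intro integrable_cis_mult) auto
    have FTvi: "integrable lborel (FT v)"
      unfolding FTv[abs_def] using kn lborel_integrable_shift[of "FT k" t] by (simp add: nice_def add.commute)
    have "?c * (LBINT x. ?f x * u n x) = (LBINT x. v x * smoothed \<phi> (Suc n) x)" for n
      unfolding u_def v_def by (subst integral_mult_right_zero[symmetric]) (simp add: mult_ac)
    \<comment> \<open>The inner factor is the one in \<open>FT_meas\<close>; the outer one matches
      the limit in \<open>pair_ft_en_tendsto\<close>.\<close>
    then have "?c * (?c * (LBINT x. ?f x * u n x)) = (LBINT s. \<phi> (- s) * FT v s * FT (en (Suc n)) s)" for n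
      using integral_smoothed[OF \<phi>(1) _ vi, of "Suc n"] by simp
    then have "(\<lambda>n. ?c * (?c * (LBINT x. ?f x * u n x))) \<longlonglongrightarrow> ?c * pair_ft \<phi> v"
      using pair_ft_en_tendsto[OF \<phi>(1) FTvi] by simp
    then have "(\<lambda>n. ?c * (?c * (LBINT x. ?f x * u (r n) x))) \<longlonglongrightarrow> ?c * pair_ft \<phi> v"
      using LIMSEQ_subseq_LIMSEQ[OF _ r] by (force simp: o_def)
    moreover have "(\<lambda>n. ?c * (?c * (LBINT x. ?f x * u (r n) x))) \<longlonglongrightarrow>
        ?c * (?c * (?I \<nu>0 - ?I \<nu>1 + \<i> * (?I \<nu>2 - ?I \<nu>3)))"
      by (intro tendsto_mult_left lim1)
    ultimately have "?c * pair_ft \<phi> v = ?c * (?c * (?I \<nu>0 - ?I \<nu>1 + \<i> * (?I \<nu>2 - ?I \<nu>3)))"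
      by (rule LIMSEQ_unique)
    then have "pair_ft \<phi> v = ?c * (?I \<nu>0 - ?I \<nu>1 + \<i> * (?I \<nu>2 - ?I \<nu>3))"
      by (simp only: mult_cancel_left ft_const_nonzero simp_thms)
    moreover have "pair_ft \<phi> v = khat_conv k \<phi> t"
      unfolding pair_ft_def FTv khat_conv_def
      using lborel_integral_shift[of "\<lambda>s. \<phi> (- s) * FT k (s + t)" "- t"] by (simp add: algebra_simps)
    ultimately show ?thesis by (simp add: FT_meas_def algebra_simps)
  qed
  then show ?thesis using r0(2) r1(2) r2(2) r3(2) unfolding B_hat_def by blast
qed

section \<open>The norm on the dual side and local boundedness\<close>

text \<open>A subsequence converges almost everywhere. Fatou's lemma, applied to
  \<open>s n - s (r i)\<close> as \<open>i\<close> grows, turns the Cauchy condition into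
  convergence of the whole sequence in norm.\<close>

lemma L1_complete:
  fixes s :: "nat \<Rightarrow> 'b \<Rightarrow> complex"
  assumes s: "\<And>n. integrable M (s n)"
    and cauchy: "\<And>e. e > 0 \<Longrightarrow> \<exists>N. \<forall>i\<ge>N. \<forall>j\<ge>N. (\<integral>x. cmod (s i x - s j x) \<partial>M) < e"
  shows "\<exists>g. integrable M g \<and> (\<lambda>n. \<integral>x. cmod (s n x - g x) \<partial>M) \<longlonglongrightarrow> 0"
proof -
  obtain r where r: "strict_mono r" and ae: "AE x in M. Cauchy (\<lambda>i. s (r i) x)"
    by (rule cauchy_L1_AE_cauchy_subseq[OF s cauchy])
  have [measurable]: "s n \<in> borel_measurable M" for n using s by auto
  define g where "g x = lim (\<lambda>i. s (r i) x)" for x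
  have [measurable]: "g \<in> borel_measurable M" unfolding g_def[abs_def] by measurable
  have lim: "AE x in M. (\<lambda>i. s (r i) x) \<longlonglongrightarrow> g x"
    using ae by eventually_elim (auto simp: g_def convergent_LIMSEQ_iff[symmetric] Cauchy_convergent_iff)
  have key: "(\<integral>\<^sup>+x. ennreal (cmod (s n x - g x)) \<partial>M) \<le> ennreal e"
    if N: "\<And>i j. i \<ge> N \<Longrightarrow> j \<ge> N \<Longrightarrow> (\<integral>x. cmod (s i x - s j x) \<partial>M) < e" and n: "n \<ge> N" for n N e
  proof -
    have "(\<integral>\<^sup>+x. ennreal (cmod (s n x - g x)) \<partial>M) = (\<integral>\<^sup>+x. liminf (\<lambda>i. ennreal (cmod (s n x - s (r i) x))) \<partial>M)"
      using lim
    proof (intro nn_integral_cong_AE, eventually_elim)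
      case (elim x)
      then have "(\<lambda>i. ennreal (cmod (s n x - s (r i) x))) \<longlonglongrightarrow> ennreal (cmod (s n x - g x))"
        by (intro tendsto_ennrealI tendsto_intros)
      then show ?case by (rule lim_imp_Liminf[OF trivial_limit_sequentially, symmetric])
    qed
    also have "\<dots> \<le> liminf (\<lambda>i. \<integral>\<^sup>+x. ennreal (cmod (s n x - s (r i) x)) \<partial>M)"
      by (rule nn_integral_liminf) auto
    also have "\<dots> \<le> liminf (\<lambda>i. ennreal e)"
    proof (rule Liminf_mono, rule eventually_sequentiallyI)
      fix i assume "i \<ge> N"
      then have "r i \<ge> N" using seq_suble[OF r, of i] by linarith
      have "(\<integral>\<^sup>+x. ennreal (cmod (s n x - s (r i) x)) \<partial>M) = ennreal (\<integral>x. cmod (s n x - s (r i) x) \<partial>M)"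
        by (intro nn_integral_eq_integral integrable_norm Bochner_Integration.integrable_diff s) auto
      also have "\<dots> \<le> ennreal e" using N[OF n \<open>r i \<ge> N\<close>] by (intro ennreal_leI) simp
      finally show "(\<integral>\<^sup>+x. ennreal (cmod (s n x - s (r i) x)) \<partial>M) \<le> ennreal e" .
    qed
    also have "\<dots> = ennreal e" by (simp add: Liminf_const)
    finally show ?thesis .
  qed
  have int: "integrable M g"
  proof -
    obtain N where N: "\<And>i j. i \<ge> N \<Longrightarrow> j \<ge> N \<Longrightarrow> (\<integral>x. cmod (s i x - s j x) \<partial>M) < 1"
      using cauchy[of 1] by auto
    have "(\<integral>\<^sup>+x. ennreal (cmod (s N x - g x)) \<partial>M) \<le> ennreal 1" by (rule key[OF N]) auto
    then have "integrable M (\<lambda>x. s N x - g x)"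
      by (intro integrableI_bounded) (auto simp: le_less_trans)
    from Bochner_Integration.integrable_diff[OF s[of N] this] show ?thesis by simp
  qed
  moreover have "(\<lambda>n. \<integral>x. cmod (s n x - g x) \<partial>M) \<longlonglongrightarrow> 0"
  proof (rule LIMSEQ_I)
    fix e :: real assume e: "e > 0"
    obtain N where N: "\<And>i j. i \<ge> N \<Longrightarrow> j \<ge> N \<Longrightarrow> (\<integral>x. cmod (s i x - s j x) \<partial>M) < e/2"
      using cauchy[of "e/2"] e by auto
    show "\<exists>N. \<forall>n\<ge>N. norm ((\<integral>x. cmod (s n x - g x) \<partial>M) - 0) < e"
    proof (intro exI allI impI)
      fix n assume n: "n \<ge> N"
      have "ennreal (\<integral>x. cmod (s n x - g x) \<partial>M) = (\<integral>\<^sup>+x. ennreal (cmod (s n x - g x)) \<partial>M)"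
        by (intro nn_integral_eq_integral[symmetric] integrable_norm Bochner_Integration.integrable_diff s int) auto
      also have "\<dots> \<le> ennreal (e/2)" by (rule key[OF N n])
      finally have "(\<integral>x. cmod (s n x - g x) \<partial>M) \<le> e/2" using e by simp
      then show "norm ((\<integral>x. cmod (s n x - g x) \<partial>M) - 0) < e" using e by simp
    qed
  qed
  ultimately show ?thesis by blast
qed

section \<open>Basic inequalities for \<open>Vnorm\<close>\<close>

lemma Vnorm_upper:
  assumes "finite S" "S \<subseteq> cball s (1/4)" "\<And>x. cmod (\<Sum>q\<in>S. c q * cis (x \<bullet> q)) \<le> 1"
  shows "ereal (cmod (\<Sum>q\<in>S. c q * \<theta> q)) \<le> Vnorm \<theta>"
  unfolding Vnorm_def
  by (rule SUP_upper2[OF UNIV_I[of s]], rule SUP_upper2[of "(S, c)"]) (use assms in auto)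

lemma Vnorm_least:
  assumes "\<And>s S c. finite S \<Longrightarrow> S \<subseteq> cball s (1/4) \<Longrightarrow> (\<And>x. cmod (\<Sum>q\<in>S. c q * cis (x \<bullet> q)) \<le> 1)
    \<Longrightarrow> ereal (cmod (\<Sum>q\<in>S. c q * \<theta> q)) \<le> B"
  shows "Vnorm \<theta> \<le> B"
  unfolding Vnorm_def by (intro SUP_least) (auto intro!: assms)

lemma Vnorm_nonneg: "0 \<le> Vnorm \<theta>"
  using Vnorm_upper[of "{}" 0 "\<lambda>_. 0" \<theta>] by (simp add: zero_ereal_def)

text \<open>A single character is an admissible polynomial. Hence convergence in
  \<open>Vnorm\<close> implies uniform convergence.\<close>

lemma Vnorm_point: "ereal (cmod (\<theta> t)) \<le> Vnorm \<theta>"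
  using Vnorm_upper[of "{t}" t "\<lambda>_. 1" \<theta>] by simp

lemma Vnorm_uminus: "Vnorm (\<lambda>t. - \<theta> t) = Vnorm \<theta>"
  unfolding Vnorm_def by (simp add: sum_negf)

lemma Vnorm_diff_commute: "Vnorm (\<lambda>t. a t - b t) = Vnorm (\<lambda>t. b t - a t)"
  using Vnorm_uminus[of "\<lambda>t. a t - b t"] by simp

lemma Vnorm_add_le: "Vnorm (\<lambda>t. a t + b t) \<le> Vnorm a + Vnorm b"
proof (rule Vnorm_least)
  fix s :: 'a and S c assume S: "finite S" "S \<subseteq> cball s (1/4)" "\<And>x. cmod (\<Sum>q\<in>S. c q * cis (x \<bullet> q)) \<le> 1"
  have "cmod (\<Sum>q\<in>S. c q * (a q + b q)) \<le> cmod (\<Sum>q\<in>S. c q * a q) + cmod (\<Sum>q\<in>S. c q * b q)"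
    using norm_triangle_ineq by (simp add: distrib_left sum.distrib)
  then have "ereal (cmod (\<Sum>q\<in>S. c q * (a q + b q))) \<le> ereal (cmod (\<Sum>q\<in>S. c q * a q)) + ereal (cmod (\<Sum>q\<in>S. c q * b q))"
    by simp
  also have "\<dots> \<le> Vnorm a + Vnorm b" by (intro add_mono Vnorm_upper[OF S])
  finally show "ereal (cmod (\<Sum>q\<in>S. c q * (a q + b q))) \<le> Vnorm a + Vnorm b" .
qed

text \<open>The sum is the integral of \<open>f\<close> against the polynomial evaluated at
  \<open>- x\<close>, which is bounded by 1 as well.\<close>

lemma Vnorm_FT_le:
  fixes f :: "'a::euclidean_space \<Rightarrow> complex"
  assumes f: "integrable lborel f"
  shows "Vnorm (FT f) \<le> ereal (cmod (ft_const TYPE('a)) * (LBINT x. cmod (f x)))"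
proof (rule Vnorm_least)
  fix s :: 'a and S c assume S: "finite S" "S \<subseteq> cball s (1/4)" "\<And>x. cmod (\<Sum>q\<in>S. c q * cis (x \<bullet> q)) \<le> 1"
  have i: "integrable lborel (\<lambda>x. c q * (cis (- (x \<bullet> q)) * f x))" for q
    by (intro integrable_mult_right integrable_cis_mult f) measurable
  have "(\<Sum>q\<in>S. c q * FT f q) = ft_const TYPE('a) * (\<Sum>q\<in>S. LBINT x. c q * (cis (- (x \<bullet> q)) * f x))"
    by (simp add: FT_def sum_distrib_left mult_ac)
  also have "(\<Sum>q\<in>S. LBINT x. c q * (cis (- (x \<bullet> q)) * f x)) = (LBINT x. (\<Sum>q\<in>S. c q * cis (- x \<bullet> q)) * f x)"
    using i by (subst Bochner_Integration.integral_sum[symmetric]) (auto simp: sum_distrib_right mult.assoc)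
  also have "cmod (ft_const TYPE('a) * \<dots>) \<le> cmod (ft_const TYPE('a)) * (LBINT x. cmod (f x))"
    unfolding norm_mult[of "ft_const TYPE('a)"]
  proof (rule mult_left_mono, rule order_trans[OF integral_norm_bound], rule integral_mono')
    fix x
    show "cmod ((\<Sum>q\<in>S. c q * cis (- x \<bullet> q)) * f x) \<le> cmod (f x)"
      using S(3)[of "- x"] by (simp only: norm_mult mult_left_le_one_le norm_ge_zero)
  qed (use f in auto)
  finally show "ereal (cmod (\<Sum>q\<in>S. c q * FT f q)) \<le> ereal (cmod (ft_const TYPE('a)) * (LBINT x. cmod (f x)))"
    by simp
qed

text \<open>The supremum over all centres makes the norm translation invariant, since shifting the
  frequencies multiplies the polynomial by a character of modulus 1. A convolution is an average of
  translates.\<close>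

lemma Vnorm_conv_le:
  fixes \<theta> K :: "'a::euclidean_space \<Rightarrow> complex"
  assumes K: "integrable lborel K" and [measurable]: "\<theta> \<in> borel_measurable borel"
    and e: "Vnorm \<theta> \<le> ereal e"
  shows "Vnorm (conv \<theta> K) \<le> ereal (e * (LBINT x. cmod (K x)))"
proof (rule Vnorm_least)
  fix s :: 'a and S c assume S: "finite S" "S \<subseteq> cball s (1/4)" "\<And>x. cmod (\<Sum>q\<in>S. c q * cis (x \<bullet> q)) \<le> 1"
  have B: "cmod (\<theta> t) \<le> e" for t using order_trans[OF Vnorm_point e] by simp
  have i: "integrable lborel (\<lambda>y. c q * (\<theta> (q - y) * K y))" for q
    by (intro integrable_mult_right integrable_bounded_mult[OF K B]) measurable
  have le: "cmod (\<Sum>q\<in>S. c q * \<theta> (q - y)) \<le> e" for y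
  proof -
    have inj: "inj_on (\<lambda>q. q - y) S" by (simp add: inj_on_def)
    have "ereal (cmod (\<Sum>q\<in>(\<lambda>q. q - y) ` S. c (q + y) * \<theta> q)) \<le> Vnorm \<theta>"
    proof (rule Vnorm_upper)
      show "finite ((\<lambda>q. q - y) ` S)" using S by simp
      show "(\<lambda>q. q - y) ` S \<subseteq> cball (s - y) (1/4)" using S(2) by (auto simp: dist_norm)
      fix x
      have "cis (x \<bullet> (q - y)) = cis (- (x \<bullet> y)) * cis (x \<bullet> q)" for q
        by (simp add: cis_mult inner_diff_right)
      then have "(\<Sum>q\<in>(\<lambda>q. q - y) ` S. c (q + y) * cis (x \<bullet> q)) = (\<Sum>q\<in>S. cis (- (x \<bullet> y)) * (c q * cis (x \<bullet> q)))"
        unfolding sum.reindex[OF inj] by (intro sum.cong refl) simp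
      also have "\<dots> = cis (- (x \<bullet> y)) * (\<Sum>q\<in>S. c q * cis (x \<bullet> q))"
        by (rule sum_distrib_left[symmetric])
      finally have "(\<Sum>q\<in>(\<lambda>q. q - y) ` S. c (q + y) * cis (x \<bullet> q)) = cis (- (x \<bullet> y)) * (\<Sum>q\<in>S. c q * cis (x \<bullet> q))" .
      then show "cmod (\<Sum>q\<in>(\<lambda>q. q - y) ` S. c (q + y) * cis (x \<bullet> q)) \<le> 1"
        using S(3)[of x] by (simp add: norm_mult)
    qed
    then have "ereal (cmod (\<Sum>q\<in>S. c q * \<theta> (q - y))) \<le> Vnorm \<theta>"
      unfolding sum.reindex[OF inj] by simp
    from order_trans[OF this e] show ?thesis by simp
  qed
  have "(\<Sum>q\<in>S. c q * conv \<theta> K q) = (\<Sum>q\<in>S. LBINT y. c q * (\<theta> (q - y) * K y))"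
    by (simp add: conv_def)
  also have "\<dots> = (LBINT y. (\<Sum>q\<in>S. c q * \<theta> (q - y)) * K y)"
    using i by (subst Bochner_Integration.integral_sum[symmetric]) (auto simp: sum_distrib_right mult.assoc)
  also have "cmod \<dots> \<le> (LBINT y. e * cmod (K y))"
  proof (rule order_trans[OF integral_norm_bound], rule integral_mono')
    fix y
    show "cmod ((\<Sum>q\<in>S. c q * \<theta> (q - y)) * K y) \<le> e * cmod (K y)"
      unfolding norm_mult using le by (intro mult_right_mono) auto
    show "0 \<le> e * cmod (K y)" using order_trans[OF norm_ge_zero B] by simp
  qed (use K in auto)
  finally show "ereal (cmod (\<Sum>q\<in>S. c q * conv \<theta> K q)) \<le> ereal (e * (LBINT x. cmod (K x)))"
    by simp
qed

text \<open>\<open>FT (f m)\<close> converges uniformly and \<open>FT u\<close> is integrable, so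
  the pairings converge. The limit does not depend on the chosen sequence, which gives access to
  products formed with an unknown one.\<close>

lemma loc_int_seq_pairing:
  fixes \<phi> u :: "'a::euclidean_space \<Rightarrow> complex"
  assumes \<phi>: "\<phi> \<in> Cb" and n: "n \<ge> 1" and f: "loc_int_seq (\<lambda>t. \<phi> t * FT (en n) t) f" and u: "nice u"
  shows "(\<lambda>m. LBINT x. f m x * u x) \<longlonglongrightarrow> pair_ft \<phi> (conv u (en n))"
proof -
  let ?c = "ft_const TYPE('a)"
  let ?\<psi> = "\<lambda>t. \<phi> t * FT (en n) t"
  have fi: "integrable lborel (f m)" for m using f by (simp add: loc_int_seq_def)
  have V: "(\<lambda>m. Vnorm (\<lambda>t. ?\<psi> t - FT (f m) t)) \<longlonglongrightarrow> 0" using f by (simp add: loc_int_seq_def)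
  have ui: "integrable lborel (FT u)" "integrable lborel u" using u by (auto simp: nice_def integrable_Cc)
  have lhs: "?c * (LBINT x. f m x * u x) = (LBINT r. FT (f m) (- r) * FT u r)" for m
  proof -
    have "(LBINT x. f m x * u x) = (LBINT x. f m x * (LBINT r. cis (x \<bullet> r) * FT u r))"
      by (simp only: nice_inversion[OF u, symmetric])
    also have "\<dots> = (LBINT r. FT u r * (LBINT x. cis (x \<bullet> r) * f m x))"
      by (rule Fubini_bounded_kernel[where C = 1])
        (use ui fi in \<open>auto intro: lborel.sigma_finite_measure_axioms\<close>)
    also have "?c * \<dots> = (LBINT r. FT (f m) (- r) * FT u r)"
      by (subst integral_mult_right_zero[symmetric]) (simp add: FT_def[of "f m"] mult_ac)
    finally show ?thesis .
  qed
  have rhs: "?c * pair_ft \<phi> (conv u (en n)) = (LBINT r. ?\<psi> (- r) * FT u r)"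
    unfolding pair_ft_conv_en[OF n ui(2)] by (simp add: FT_en_even[OF n] mult_ac)
  have i1: "integrable lborel (\<lambda>r. FT (f m) (- r) * FT u r)" for m
    by (rule integrable_bounded_mult[OF ui(1) norm_FT_le]) (use measurable_FT[OF fi[of m]] in measurable)
  obtain B where B: "B \<ge> 0" "\<And>t. cmod (\<phi> t) \<le> B" using Cb_bounded[OF \<phi>] by metis
  have [measurable]: "\<phi> \<in> borel_measurable borel" "FT (en n :: 'a \<Rightarrow> complex) \<in> borel_measurable borel"
    by (rule Cb_measurable[OF \<phi>], rule measurable_FT[OF integrable_en[OF n]])
  have i2: "integrable lborel (\<lambda>r. ?\<psi> (- r) * FT u r)"
  proof (rule integrable_bounded_mult[OF ui(1)])
    show "cmod (?\<psi> (- r)) \<le> B * cmod ?c" for r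
      unfolding norm_mult using B norm_FT_en_le[OF n] by (intro mult_mono) auto
  qed measurable
  have "(\<lambda>m. (LBINT r. FT (f m) (- r) * FT u r)) \<longlonglongrightarrow> (LBINT r. ?\<psi> (- r) * FT u r)"
  proof (rule LIMSEQ_I)
    fix e :: real assume e: "e > 0"
    define A where "A = (LBINT r. cmod (FT u r))"
    have A: "A \<ge> 0" by (simp add: A_def)
    define d where "d = e / (A + 1)"
    have d: "d > 0" "d * A < e" using e A by (auto simp: d_def field_simps)
    have "\<forall>\<^sub>F m in sequentially. Vnorm (\<lambda>t. ?\<psi> t - FT (f m) t) < ereal d"
      using order_tendstoD(2)[OF V] d by simp
    then obtain N where N: "\<And>m. m \<ge> N \<Longrightarrow> Vnorm (\<lambda>t. ?\<psi> t - FT (f m) t) < ereal d"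
      by (auto simp: eventually_sequentially)
    show "\<exists>N. \<forall>m\<ge>N. norm ((LBINT r. FT (f m) (- r) * FT u r) - (LBINT r. ?\<psi> (- r) * FT u r)) < e"
    proof (intro exI allI impI)
      fix m assume m: "m \<ge> N"
      have pt: "cmod (?\<psi> t - FT (f m) t) \<le> d" for t
        using le_less_trans[OF Vnorm_point[of "\<lambda>t. ?\<psi> t - FT (f m) t" t] N[OF m]] by simp
      have "norm ((LBINT r. FT (f m) (- r) * FT u r) - (LBINT r. ?\<psi> (- r) * FT u r))
          = cmod (LBINT r. (FT (f m) (- r) - ?\<psi> (- r)) * FT u r)"
        using i1[of m] i2 by (simp add: left_diff_distrib)
      also have "\<dots> \<le> (LBINT r. d * cmod (FT u r))"
      proof (rule order_trans[OF integral_norm_bound], rule integral_mono')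
        fix r
        show "cmod ((FT (f m) (- r) - ?\<psi> (- r)) * FT u r) \<le> d * cmod (FT u r)"
          unfolding norm_mult[of _ "FT u r"] using pt[of "- r"] by (intro mult_right_mono) (auto simp: norm_minus_commute)
      qed (use ui d in auto)
      also have "\<dots> < e" using d(2) by (simp add: A_def)
      finally show "norm ((LBINT r. FT (f m) (- r) * FT u r) - (LBINT r. ?\<psi> (- r) * FT u r)) < e" .
    qed
  qed
  then have "(\<lambda>m. ?c * (LBINT x. f m x * u x)) \<longlonglongrightarrow> ?c * pair_ft \<phi> (conv u (en n))"
    unfolding lhs rhs .
  then have "(\<lambda>m. (1 / ?c) * (?c * (LBINT x. f m x * u x))) \<longlonglongrightarrow> (1 / ?c) * (?c * pair_ft \<phi> (conv u (en n)))"
    by (rule tendsto_mult_left)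
  then show ?thesis by simp
qed

lemma tendsto_integral_mult_bounded:
  fixes g :: "'b \<Rightarrow> complex"
  assumes F: "\<And>m. integrable M (F m)" and g: "integrable M g"
    and lim: "(\<lambda>m. \<integral>x. cmod (F m x - g x) \<partial>M) \<longlonglongrightarrow> 0"
    and [measurable]: "u \<in> borel_measurable M" and B: "\<And>x. cmod (u x) \<le> B"
  shows "(\<lambda>m. \<integral>x. F m x * u x \<partial>M) \<longlonglongrightarrow> (\<integral>x. g x * u x \<partial>M)"
proof (rule LIM_zero_cancel, rule Lim_null_comparison)
  have i: "integrable M (\<lambda>x. F m x * u x)" for m
    by (subst mult.commute) (rule integrable_bounded_mult[OF F B]; measurable)
  have i': "integrable M (\<lambda>x. g x * u x)" by (subst mult.commute) (rule integrable_bounded_mult[OF g B]; measurable)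
  have "norm ((\<integral>x. F m x * u x \<partial>M) - (\<integral>x. g x * u x \<partial>M)) \<le> B * (\<integral>x. cmod (F m x - g x) \<partial>M)" for m
  proof -
    have "(\<integral>x. F m x * u x \<partial>M) - (\<integral>x. g x * u x \<partial>M) = (\<integral>x. (F m x - g x) * u x \<partial>M)"
      using i[of m] i' by (simp add: left_diff_distrib)
    also have "cmod \<dots> \<le> (\<integral>x. B * cmod (F m x - g x) \<partial>M)"
    proof (rule order_trans[OF integral_norm_bound], rule integral_mono')
      show "integrable M (\<lambda>x. B * cmod (F m x - g x))" using F[of m] g by simp
      fix x
      show "cmod ((F m x - g x) * u x) \<le> B * cmod (F m x - g x)"
        using B[of x] by (simp add: norm_mult mult.commute[of "cmod (F m x - g x)"] mult_right_mono)
      show "0 \<le> B * cmod (F m x - g x)" using order_trans[OF norm_ge_zero B[of x]] by simp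
    qed
    finally show ?thesis by simp
  qed
  then show "\<forall>\<^sub>F m in sequentially. norm ((\<integral>x. F m x * u x \<partial>M) - (\<integral>x. g x * u x \<partial>M)) \<le> B * (\<integral>x. cmod (F m x - g x) \<partial>M)"
    by simp
  show "(\<lambda>m. B * (\<integral>x. cmod (F m x - g x) \<partial>M)) \<longlonglongrightarrow> 0"
    using tendsto_mult_left[OF lim, of B] by simp
qed

text \<open>With \<open>h = 1\<close> on the ball, \<open>L\<close> of \<open>conv u (en n)\<close>
  is the integral of \<open>u\<close> against the product \<open>g\<close>, whose L1 norm (c) bounds
  uniformly in \<open>n\<close>. Letting \<open>n\<close> grow gives the bound for
  \<open>L u\<close>.\<close>

lemma locally_bdd_of_F_locally_bounded:
  fixes \<phi> :: "'a::euclidean_space \<Rightarrow> complex"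
  assumes \<phi>: "\<phi> \<in> Cb" and F: "F_locally_bounded \<phi>"
  shows "locally_bdd \<phi>"
  unfolding locally_bdd_def
proof
  fix R
  let ?c = "ft_const TYPE('a)"
  define h :: "'a \<Rightarrow> complex" where "h = cutoff R"
  have h: "h \<in> Cc" using nice_cutoff[of R, where 'a = 'a] by (simp add: h_def nice_def)
  have h1: "cmod (h x) \<le> 1" for x unfolding h_def by (rule norm_cutoff_le)
  have [measurable]: "h \<in> borel_measurable borel" by (rule Cc_measurable[OF h])
  obtain C where C: "\<And>n g. n \<ge> 1 \<Longrightarrow> loc_mult (\<lambda>t. \<phi> t * FT (en n) t) h g \<Longrightarrow> (LBINT x. cmod (g x)) \<le> C"
    using F h unfolding F_locally_bounded_def by blast
  have "cmod (pair_ft \<phi> u) \<le> C * M" if u: "nice u" "supp_in R u" "\<And>x. cmod (u x) \<le> M" for u M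
  proof -
    have ui: "integrable lborel u" "integrable lborel (FT u)" using u(1) by (auto simp: nice_def integrable_Cc)
    have M: "M \<ge> 0" using u(3)[of 0] norm_ge_zero order_trans by blast
    have *: "cmod (pair_ft \<phi> (conv u (en n))) \<le> C * M" if n: "n \<ge> 1" for n
    proof -
      obtain f where f: "loc_int_seq (\<lambda>t. \<phi> t * FT (en n) t) f"
        using F n unfolding F_locally_bounded_def loc_integrable_def by blast
      have fi: "integrable lborel (f m)" for m using f by (simp add: loc_int_seq_def)
      have hf: "integrable lborel (\<lambda>x. h x * f m x)" for m
        by (rule integrable_bounded_mult[OF fi h1]) measurable
      \<comment> \<open>The bound in (c) speaks about products that exist; completeness of L1
        produces one from the Cauchy condition.\<close>
      obtain g where g: "integrable lborel g" "(\<lambda>m. LBINT x. cmod (h x * f m x - g x)) \<longlonglongrightarrow> 0"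
        using L1_complete[of lborel "\<lambda>m x. h x * f m x", OF hf] f h unfolding loc_int_seq_def by blast
      have "loc_mult (\<lambda>t. \<phi> t * FT (en n) t) h g"
        using g f unfolding loc_mult_def by blast
      then have gC: "(LBINT x. cmod (g x)) \<le> C" by (rule C[OF n])
      have "h x * u x = u x" for x
        using u(2) cutoff_eq_1[of x R] by (cases "norm x \<le> R") (auto simp: supp_in_def h_def)
      then have "(h x * f m x) * u x = f m x * u x" for m x by (metis mult.assoc mult.commute)
      moreover have "(\<lambda>m. LBINT x. (h x * f m x) * u x) \<longlonglongrightarrow> (LBINT x. g x * u x)"
        by (rule tendsto_integral_mult_bounded[OF hf g _ u(3)]) (use ui in auto)
      ultimately have "(\<lambda>m. LBINT x. f m x * u x) \<longlonglongrightarrow> (LBINT x. g x * u x)"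
        by (simp only:)
      then have "pair_ft \<phi> (conv u (en n)) = (LBINT x. g x * u x)"
        by (rule LIMSEQ_unique[OF loc_int_seq_pairing[OF \<phi> n f u(1)]])
      also have "cmod \<dots> \<le> (LBINT x. M * cmod (g x))"
      proof (rule order_trans[OF integral_norm_bound], rule integral_mono')
        fix x
        show "cmod (g x * u x) \<le> M * cmod (g x)"
          using u(3)[of x] by (simp add: norm_mult mult.commute[of "cmod (g x)"] mult_right_mono)
      qed (use g M in auto)
      also have "\<dots> = M * (LBINT x. cmod (g x))" by simp
      also have "\<dots> \<le> M * C" by (intro mult_left_mono gC M)
      finally show ?thesis by (simp add: mult.commute)
    qed
    have lim: "(\<lambda>n. ?c * pair_ft \<phi> (conv u (en (Suc n)))) \<longlonglongrightarrow> ?c * pair_ft \<phi> u"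
      using pair_ft_en_tendsto[OF \<phi> ui(2)] pair_ft_conv_en[OF _ ui(1), of "Suc _" \<phi>] by simp
    have lim': "(\<lambda>n. pair_ft \<phi> (conv u (en (Suc n)))) \<longlonglongrightarrow> pair_ft \<phi> u"
      using tendsto_mult_left[OF lim, of "1 / ?c"] by simp
    show ?thesis
      by (rule tendsto_upperbound[OF tendsto_norm[OF lim']]) (auto intro!: * always_eventually)
  qed
  then show "\<exists>C. pair_ft_bound \<phi> R C"
    unfolding pair_ft_bound_def by blast
qed

text \<open>The conjugate sign of \<open>g\<close> is measurable, hence almost everywhere a limit of
  continuous functions. After these are forced into the unit disc, dominated convergence recovers
  the L1 norm.\<close>

lemma L1_norm_le_dual:
  fixes g :: "'a::euclidean_space \<Rightarrow> complex"
  assumes g: "integrable lborel g"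
    and C: "\<And>s. continuous_on UNIV s \<Longrightarrow> (\<And>x. cmod (s x) \<le> 1) \<Longrightarrow> cmod (LBINT x. g x * s x) \<le> C"
  shows "(LBINT x. cmod (g x)) \<le> C"
proof -
  have [measurable]: "g \<in> borel_measurable borel" using g by auto
  define s where "s x = cnj (g x) / of_real (cmod (g x))" for x
  have s [measurable]: "s \<in> borel_measurable borel" unfolding s_def[abs_def] by measurable
  have s1: "cmod (s x) \<le> 1" for x by (simp add: s_def norm_divide)
  have "s \<in> borel_measurable lebesgue" using s by (intro measurable_completion) simp
  then have "s measurable_on UNIV" by (simp add: measurable_on_iff_borel_measurable lebesgue_on_UNIV_eq)
  then obtain N t where N: "negligible N" and t: "\<And>k. continuous_on UNIV (t k)"
    and lim: "\<And>x. x \<notin> N \<Longrightarrow> (\<lambda>k. t k x) \<longlonglongrightarrow> s x"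
    by (auto simp: measurable_on_def)
  \<comment> \<open>Radial retraction onto the closed unit disc: continuous, and the identity on the
    values of \<open>s\<close>.\<close>
  define t' where "t' k x = t k x / of_real (max 1 (cmod (t k x)))" for k x
  have t': "continuous_on UNIV (t' k)" for k
    unfolding t'_def by (intro continuous_intros t) auto
  have t'1: "cmod (t' k x) \<le> 1" for k x by (auto simp: t'_def norm_divide divide_le_eq_1 max_def)
  have [measurable]: "t' k \<in> borel_measurable borel" for k by (intro borel_measurable_continuous_onI t')
  have lim': "(\<lambda>k. t' k x) \<longlonglongrightarrow> s x" if x: "x \<notin> N" for x
  proof -
    have "(\<lambda>k. t k x / of_real (max 1 (cmod (t k x)))) \<longlonglongrightarrow> s x / of_real (max 1 (cmod (s x)))"
      by (intro tendsto_intros lim x) auto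
    then show ?thesis unfolding t'_def max.absorb1[OF s1] by simp
  qed
  have "AE x in lebesgue. x \<notin> N" using N by (intro AE_not_in) (simp add: negligible_iff_null_sets)
  then have ae: "AE x in lebesgue. (\<lambda>k. g x * t' k x) \<longlonglongrightarrow> g x * s x"
    by eventually_elim (intro tendsto_intros lim')
  have "AE x in lborel. (\<lambda>k. g x * t' k x) \<longlonglongrightarrow> g x * s x"
    using ae by (subst (asm) AE_completion_iff)
  then have "(\<lambda>k. LBINT x. g x * t' k x) \<longlonglongrightarrow> (LBINT x. g x * s x)"
    by (intro integral_dominated_convergence[where w = "\<lambda>x. cmod (g x)"])
      (use g t'1 in \<open>auto simp: norm_mult mult_left_le\<close>)
  then have "cmod (LBINT x. g x * s x) \<le> C"
    by (intro tendsto_upperbound[OF tendsto_norm]) (auto intro!: always_eventually C t' t'1)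
  moreover have "g x * s x = of_real (cmod (g x))" for x
  proof -
    have "g x * s x = g x * cnj (g x) / of_real (cmod (g x))" by (simp add: s_def)
    also have "\<dots> = of_real (cmod (g x))" by (simp add: complex_norm_square[symmetric] power2_eq_square)
    finally show ?thesis .
  qed
  ultimately show ?thesis by simp
qed

text \<open>Since \<open>g\<close> arises from an arbitrary sequence, it is controlled only through
  pairings. By duality it is tested with a continuous \<open>s\<close>. The product of
  \<open>h\<close> and \<open>s\<close> lies in \<open>Cc\<close> but perhaps outside the domain of
  \<open>L\<close>, so it is mollified; local L1 bounds on the sequence absorb the error.\<close>

lemma integral_loc_mult_le:
  fixes \<phi> :: "'a::euclidean_space \<Rightarrow> complex"
  assumes \<phi>: "\<phi> \<in> Cb" "locally_bdd \<phi>" and h: "h \<in> Cc"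
  shows "\<exists>C. \<forall>n\<ge>1. \<forall>g. loc_mult (\<lambda>t. \<phi> t * FT (en n) t) h g \<longrightarrow> (LBINT x. cmod (g x)) \<le> C"
proof -
  obtain R where R: "supp_in R h" using Cc_supp[OF h] by metis
  obtain B where B: "\<And>x. cmod (h x) \<le> B" using Cc_bounded[OF h] by metis
  have [measurable]: "h \<in> borel_measurable borel" by (rule Cc_measurable[OF h])
  \<comment> \<open>One unit of radius for the mollification by \<open>en j\<close> that yields
    \<open>u\<close>, another for \<open>en n\<close>.\<close>
  obtain C where C: "C \<ge> 0" "pair_ft_bound \<phi> (R + 1 + 1) C"
    using locally_bddD[OF \<phi>(2)] .
  have "(LBINT x. cmod (g x)) \<le> C * B"
    if n: "n \<ge> 1" and g: "loc_mult (\<lambda>t. \<phi> t * FT (en n) t) h g" for n g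
  proof -
    obtain f where gi: "integrable lborel g" and f: "loc_int_seq (\<lambda>t. \<phi> t * FT (en n) t) f"
      and lim: "(\<lambda>m. LBINT x. cmod (h x * f m x - g x)) \<longlonglongrightarrow> 0"
      using g unfolding loc_mult_def by blast
    have fi: "integrable lborel (f m)" for m using f by (simp add: loc_int_seq_def)
    have hf: "integrable lborel (\<lambda>x. h x * f m x)" for m
      by (rule integrable_bounded_mult[OF fi B]) measurable
    \<comment> \<open>Equal to 1 on a ball that contains the supports of both \<open>v\<close> and
      \<open>u\<close>, so \<open>w x * f m x\<close> controls the mollification error.\<close>
    define w :: "'a \<Rightarrow> complex" where "w = cutoff (R + 1)"
    have w: "w \<in> Cc" using nice_cutoff[of "R + 1", where 'a = 'a] by (simp add: w_def nice_def)
    have [measurable]: "w \<in> borel_measurable borel" by (rule Cc_measurable[OF w])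
    have w1: "cmod (w x) \<le> 1" for x unfolding w_def by (rule norm_cutoff_le)
    have wf: "integrable lborel (\<lambda>x. w x * f m x)" for m
      by (rule integrable_bounded_mult[OF fi w1]) measurable
    obtain N where N: "\<And>m. m \<ge> N \<Longrightarrow> (LBINT x. cmod (w x * f m x - w x * f N x)) < 1"
      using f w unfolding loc_int_seq_def by (metis le_refl zero_less_one)
    \<comment> \<open>From index \<open>N\<close> on, the Cauchy condition keeps the local L1 norms
      within distance 1 of the norm at \<open>N\<close>.\<close>
    define A where "A = 1 + (LBINT x. cmod (w x * f N x))"
    have A: "(LBINT x. cmod (w x * f m x)) \<le> A" if "m \<ge> N" for m
    proof -
      have "(LBINT x. cmod (w x * f m x)) \<le> (LBINT x. cmod (w x * f m x - w x * f N x) + cmod (w x * f N x))"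
      proof (rule integral_mono)
        fix x
        show "cmod (w x * f m x) \<le> cmod (w x * f m x - w x * f N x) + cmod (w x * f N x)"
          using norm_triangle_ineq[of "w x * f m x - w x * f N x" "w x * f N x"] by simp
      qed (use wf[of m] wf[of N] in auto)
      also have "\<dots> = (LBINT x. cmod (w x * f m x - w x * f N x)) + (LBINT x. cmod (w x * f N x))"
        using wf[of m] wf[of N] by (intro Bochner_Integration.integral_add) auto
      finally show ?thesis using N[OF that] by (simp add: A_def)
    qed
    have A0: "A \<ge> 0" unfolding A_def by (intro add_nonneg_nonneg) auto
    show ?thesis
    proof (rule L1_norm_le_dual[OF gi])
      fix s :: "'a \<Rightarrow> complex" assume s: "continuous_on UNIV s" and s1: "\<And>x. cmod (s x) \<le> 1"
      have [measurable]: "s \<in> borel_measurable borel" by (intro borel_measurable_continuous_onI s)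
      define v where "v x = h x * s x" for x
      have v: "v \<in> Cc" unfolding v_def by (rule Cc_mult_continuous[OF h s])
      have vB: "cmod (v x) \<le> B" for x
        using mult_mono[OF B[of x] s1[of x]] order_trans[OF norm_ge_zero B[of x]] by (simp add: v_def norm_mult)
      have vR: "supp_in R v" using R by (simp add: supp_in_def v_def)
      have [measurable]: "v \<in> borel_measurable borel" by (rule Cc_measurable[OF v])
      have lim_s: "(\<lambda>m. LBINT x. f m x * v x) \<longlonglongrightarrow> (LBINT x. g x * s x)"
      proof -
        have "(\<lambda>m. LBINT x. (h x * f m x) * s x) \<longlonglongrightarrow> (LBINT x. g x * s x)"
          by (rule tendsto_integral_mult_bounded[OF hf gi lim _ s1]) measurable
        then show ?thesis by (simp add: v_def mult_ac)
      qed
      show "cmod (LBINT x. g x * s x) \<le> C * B"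
      \<comment> \<open>The mollification \<open>u\<close> depends on \<open>e\<close>, while the
        bound \<open>C * B\<close> does not.\<close>
      proof (rule field_le_epsilon)
        fix e :: real assume e: "e > 0"
        define d where "d = e / (A + 1)"
        have d: "d > 0" "d * A \<le> e" using e A0 by (auto simp: d_def field_simps)
        obtain j where j: "j \<ge> 1" "\<And>x. cmod (conv v (en j) x - v x) \<le> d"
          using conv_en_uniform[OF v d(1)] by blast
        define u where "u = conv v (en j)"
        have u: "nice u" unfolding u_def by (rule nice_conv_en[OF integrable_Cc[OF v] vR j(1)])
        have uR: "supp_in (R + 1) u" unfolding u_def by (rule supp_in_conv_en[OF vR j(1)])
        have uB: "cmod (u x) \<le> B" for x unfolding u_def by (rule norm_conv_en_le[OF j(1) vB])
        have uc: "u \<in> Cc" using u by (simp add: nice_def)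
        have [measurable]: "u \<in> borel_measurable borel" by (rule Cc_measurable[OF uc])
        have close: "cmod ((LBINT x. f m x * v x) - (LBINT x. f m x * u x)) \<le> e" if m: "m \<ge> N" for m
        proof -
          have i: "integrable lborel (\<lambda>x. f m x * v x)" "integrable lborel (\<lambda>x. f m x * u x)"
            by (subst mult.commute, rule integrable_bounded_mult[OF fi vB], measurable)
              (subst mult.commute, rule integrable_bounded_mult[OF fi uB], measurable)
          have "(LBINT x. f m x * v x) - (LBINT x. f m x * u x) = (LBINT x. f m x * v x - f m x * u x)"
            using i by simp
          also have "cmod \<dots> \<le> (LBINT x. d * cmod (w x * f m x))"
          proof (rule order_trans[OF integral_norm_bound], rule integral_mono')
            fix x
            show "cmod (f m x * v x - f m x * u x) \<le> d * cmod (w x * f m x)"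
            proof (cases "norm x \<le> R + 1")
              case True
              then have "w x = 1" unfolding w_def by (rule cutoff_eq_1)
              moreover have "cmod (f m x * v x - f m x * u x) = cmod (f m x) * cmod (u x - v x)"
                by (simp add: norm_mult[symmetric] norm_minus_commute right_diff_distrib)
              ultimately show ?thesis
                using j(2)[of x] by (simp add: u_def mult.commute[of d] mult_left_mono)
            next
              case False
              then have "v x = 0" "u x = 0" using vR uR by (auto simp: supp_in_def)
              then show ?thesis using d by simp
            qed
          qed (use wf[of m] d in auto)
          also have "\<dots> = d * (LBINT x. cmod (w x * f m x))" by simp
          also have "\<dots> \<le> d * A" using d A[OF m] by (intro mult_left_mono) auto
          finally show ?thesis using d(2) by linarith
        qed
        have "(\<lambda>m. (LBINT x. f m x * v x) - (LBINT x. f m x * u x))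
            \<longlonglongrightarrow> (LBINT x. g x * s x) - pair_ft \<phi> (conv u (en n))"
          by (intro tendsto_diff lim_s loc_int_seq_pairing[OF \<phi>(1) n f u])
        then have "cmod ((LBINT x. g x * s x) - pair_ft \<phi> (conv u (en n))) \<le> e"
          using close by (intro tendsto_upperbound[OF tendsto_norm]) (auto intro!: eventually_sequentiallyI[of N])
        moreover have "cmod (pair_ft \<phi> (conv u (en n))) \<le> C * B"
          by (intro pair_ft_boundD[OF C(2)] nice_conv_en[OF integrable_Cc[OF uc] uR n] supp_in_conv_en[OF uR n] norm_conv_en_le[OF n uB])
        ultimately show "cmod (LBINT x. g x * s x) \<le> C * B + e"
          using norm_triangle_sub[of "LBINT x. g x * s x" "pair_ft \<phi> (conv u (en n))"] by linarith
      qed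
    qed
  qed
  then show ?thesis by blast
qed

section \<open>Construction of the locally integrable elements in (c)\<close>

lemma tendsto_zero_ereal:
  assumes "\<And>n. 0 \<le> X n" "\<And>e::real. e > 0 \<Longrightarrow> \<forall>\<^sub>F n in sequentially. X n \<le> ereal e"
  shows "X \<longlonglongrightarrow> 0"
proof (rule order_tendstoI)
  fix a :: ereal assume "a < 0"
  then show "\<forall>\<^sub>F n in sequentially. a < X n" using assms(1) by (intro always_eventually allI) (rule less_le_trans)
next
  fix a :: ereal assume "0 < a"
  then obtain e where e: "0 < ereal e" "ereal e < a" using ereal_dense2 by blast
  from assms(2)[of e] e show "\<forall>\<^sub>F n in sequentially. X n < a"
    by (auto elim!: eventually_mono intro: le_less_trans)
qed

lemma A_alg_approx:
  assumes "\<psi> \<in> A_alg" and e: "e > 0"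
  shows "\<exists>f. integrable lborel f \<and> Vnorm (\<lambda>t. \<psi> t - FT f t) \<le> ereal e"
proof -
  obtain f where f: "\<And>n. integrable lborel (f n)" "(\<lambda>n. Vnorm (\<lambda>t. \<psi> t - FT (f n) t)) \<longlonglongrightarrow> 0"
    using assms unfolding A_alg_def by blast
  have "\<forall>\<^sub>F n in sequentially. Vnorm (\<lambda>t. \<psi> t - FT (f n) t) < ereal e"
    using order_tendstoD(2)[OF f(2)] e by simp
  then obtain n where "Vnorm (\<lambda>t. \<psi> t - FT (f n) t) < ereal e"
    by (auto simp: eventually_sequentially)
  then show ?thesis using f(1)[of n] by (intro exI[of _ "f n"]) auto
qed

text \<open>Through this fact the multiplier property of \<phi> enters: it places the product of
  \<phi> and \<open>FT (en n)\<close> in \<open>A_alg\<close>.\<close>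

lemma FT_en_in_A_alg:
  assumes n: "n \<ge> 1"
  shows "FT (en n :: 'a::euclidean_space \<Rightarrow> complex) \<in> A_alg"
proof -
  have "FT (en n :: 'a \<Rightarrow> complex) \<in> Cb"
    unfolding Cb_def using continuous_FT[OF integrable_en[OF n]] norm_FT_en_le[OF n]
    by (auto simp: bounded_iff intro!: exI[of _ "cmod (ft_const TYPE('a))"])
  moreover have "Vnorm (\<lambda>t::'a. 0) = 0"
    using Vnorm_least[of "\<lambda>_::'a. 0" 0] Vnorm_nonneg[of "\<lambda>_::'a. 0"] by (simp add: zero_ereal_def[symmetric] antisym)
  ultimately show ?thesis
    unfolding A_alg_def using integrable_en[OF n] by (auto intro!: exI[of _ "\<lambda>_. en n"])
qed

text \<open>Dilates of one cutoff are used rather than cutoffs of growing radius, because dilation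
  leaves the L1 norm of the transform unchanged.\<close>

definition window :: "nat \<Rightarrow> 'a::euclidean_space \<Rightarrow> complex" where
  "window m x = cutoff 1 (x /\<^sub>R real (Suc m))"

lemma FT_window:
  "FT (window m) t = of_real (real (Suc m) ^ DIM('a)) * FT (cutoff 1) (real (Suc m) *\<^sub>R t)" for t :: "'a::euclidean_space"
proof -
  let ?s = "real (Suc m)"
  have eq: "cis (- (x \<bullet> t)) * window m x = (\<lambda>y. cis (- (y \<bullet> (?s *\<^sub>R t))) * cutoff 1 y) (inverse ?s *\<^sub>R x)" for x
  proof -
    have "(inverse ?s *\<^sub>R x) \<bullet> (?s *\<^sub>R t) = x \<bullet> t" by (simp del: of_nat_Suc)
    then show ?thesis by (simp only: window_def)
  qed
  have "(LBINT x. cis (- (x \<bullet> t)) * window m x)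
     = of_real (?s ^ DIM('a)) * (LBINT y. cis (- (y \<bullet> (?s *\<^sub>R t))) * cutoff 1 y)"
    unfolding eq by (subst lborel_integral_scale) (simp_all add: power_inverse divide_inverse mult.commute del: of_nat_Suc)
  then show ?thesis by (simp add: FT_def)
qed

lemma
  shows nice_window: "nice (window m :: 'a::euclidean_space \<Rightarrow> complex)"
    and integral_norm_FT_window: "(\<integral>t. cmod (FT (window m) t) \<partial>(lborel :: 'a measure)) = (\<integral>t. cmod (FT (cutoff 1) t) \<partial>(lborel :: 'a measure))"
    and norm_window_le: "cmod (window m (x :: 'a)) \<le> 1"
    and window_eq_1: "norm (x :: 'a) \<le> real (Suc m) \<Longrightarrow> window m x = 1"
proof -
  let ?s = "real (Suc m)"
  have c: "nice (cutoff 1 :: 'a \<Rightarrow> complex)" by (rule nice_cutoff)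
  have cont: "continuous_on UNIV (window m :: 'a \<Rightarrow> complex)"
    unfolding window_def using c
    by (intro continuous_on_compose2[OF Cc_continuous[of "cutoff 1"]] continuous_intros) (auto simp: nice_def)
  have "supp_in (3 * ?s) (window m :: 'a \<Rightarrow> complex)"
    using supp_in_cutoff[of 1, where 'a = 'a] unfolding supp_in_def window_def
    by (auto simp: field_simps simp del: of_nat_Suc)
  from CcI[OF cont this] have "window m \<in> (Cc :: ('a \<Rightarrow> complex) set)" .
  moreover have "integrable lborel (\<lambda>t :: 'a. of_real (?s ^ DIM('a)) * FT (cutoff 1) (?s *\<^sub>R t))"
    by (intro integrable_mult_right, subst lborel_integrable_scale) (use c in \<open>auto simp: nice_def\<close>)
  ultimately show "nice (window m :: 'a \<Rightarrow> complex)" by (simp add: nice_def FT_window[abs_def])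
  have "complex_of_real (\<integral>t. cmod (FT (window m) t) \<partial>(lborel :: 'a measure))
      = (\<integral>t. of_real (?s ^ DIM('a)) * (\<lambda>t. complex_of_real (cmod (FT (cutoff 1) t))) (?s *\<^sub>R t) \<partial>(lborel :: 'a measure))"
    by (simp add: FT_window norm_mult norm_power del: of_nat_Suc of_real_power flip: integral_complex_of_real)
  also have "\<dots> = complex_of_real (\<integral>t. cmod (FT (cutoff 1) t) \<partial>(lborel :: 'a measure))"
    unfolding integral_mult_right_zero by (subst lborel_integral_scale) (simp_all del: of_nat_Suc)
  finally show "(\<integral>t. cmod (FT (window m) t) \<partial>(lborel :: 'a measure)) = (\<integral>t. cmod (FT (cutoff 1) t) \<partial>(lborel :: 'a measure))"
    by (simp only: of_real_eq_iff)
  show "cmod (window m (x :: 'a)) \<le> 1" unfolding window_def by (rule norm_cutoff_le)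
  show "window m x = 1" if "norm (x :: 'a) \<le> ?s"
    unfolding window_def using that by (intro cutoff_eq_1) (simp add: field_simps)
qed

text \<open>Replace \<psi> by a nearby \<open>FT f\<close> with \<open>f\<close> integrable.
  Windowing \<open>f\<close> converges in L1 by dominated convergence. The error of the replacement
  stays small after convolution with the transform of the window, whose L1 norm does not depend on
  \<open>m\<close>.\<close>

lemma Vnorm_window_tendsto:
  fixes \<psi> :: "'a::euclidean_space \<Rightarrow> complex"
  assumes \<psi>: "\<psi> \<in> A_alg"
  shows "(\<lambda>m. Vnorm (\<lambda>t. \<psi> t - khat_conv (window m) \<psi> t)) \<longlonglongrightarrow> 0"
proof (rule tendsto_zero_ereal[OF Vnorm_nonneg])
  fix e :: real assume e: "e > 0"
  let ?c = "cmod (ft_const TYPE('a))"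
  define A where "A = (\<integral>t. cmod (FT (cutoff 1) t) \<partial>(lborel :: 'a measure))"
  have A: "A \<ge> 0" by (simp add: A_def)
  \<comment> \<open>Two of the three error terms are at most \<open>d\<close>; the convolved one is
    at most \<open>d * A\<close>.\<close>
  define d where "d = e / (2 + A)"
  have "d > 0" "d * (2 + A) = e" using e A by (auto simp: d_def)
  then have d: "d > 0" "d + d + d * A = e" by (simp_all add: algebra_simps)
  obtain f where f: "integrable lborel f" and fd: "Vnorm (\<lambda>t. \<psi> t - FT f t) \<le> ereal d"
    using A_alg_approx[OF \<psi> d(1)] by blast
  have [measurable]: "f \<in> borel_measurable borel" "FT f \<in> borel_measurable borel" "\<psi> \<in> borel_measurable borel"
    using f \<psi> by (auto simp: A_alg_def Cb_measurable intro: measurable_FT)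
  have win [measurable]: "window m \<in> borel_measurable (borel :: 'a measure)" for m
    using nice_window[of m, where 'a = 'a] by (simp add: nice_def Cc_measurable)
  have wf: "integrable lborel (\<lambda>x. window m x * f x)" for m
    by (rule integrable_bounded_mult[OF f norm_window_le]) measurable
  have "(\<lambda>m. LBINT x. cmod (f x - window m x * f x)) \<longlonglongrightarrow> (\<integral>x. cmod (0 :: complex) \<partial>(lborel :: 'a measure))"
  proof (rule integral_dominated_convergence[where w = "\<lambda>x. 2 * cmod (f x)"])
    show "AE x in lborel. (\<lambda>m. cmod (f x - window m x * f x)) \<longlonglongrightarrow> cmod 0"
    proof (intro AE_I2 tendsto_norm tendsto_eventually eventually_sequentiallyI)
      fix x :: 'a and m assume "m \<ge> nat \<lceil>norm x\<rceil>"
      then have "norm x \<le> real (Suc m)" by linarith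
      then show "f x - window m x * f x = 0" by (simp add: window_eq_1)
    qed
    show "AE x in lborel. norm (cmod (f x - window m x * f x)) \<le> 2 * cmod (f x)" for m
    proof (intro AE_I2)
      fix x
      have "cmod (f x - window m x * f x) \<le> cmod (f x) + cmod (window m x) * cmod (f x)"
        using norm_triangle_ineq4[of "f x" "window m x * f x"] by (simp add: norm_mult)
      also have "cmod (window m x) * cmod (f x) \<le> 1 * cmod (f x)" by (intro mult_right_mono norm_window_le) auto
      finally show "norm (cmod (f x - window m x * f x)) \<le> 2 * cmod (f x)" by simp
    qed
  qed (use f in auto)
  then have "(\<lambda>m. ?c * (LBINT x. cmod (f x - window m x * f x))) \<longlonglongrightarrow> ?c * 0"
    by (intro tendsto_mult_left) simp
  then have "\<forall>\<^sub>F m in sequentially. ?c * (LBINT x. cmod (f x - window m x * f x)) < d"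
    using d(1) by (intro order_tendstoD(2)) auto
  then show "\<forall>\<^sub>F m in sequentially. Vnorm (\<lambda>t. \<psi> t - khat_conv (window m) \<psi> t) \<le> ereal e"
  proof eventually_elim
    case (elim m)
    let ?K = "FT (window m :: 'a \<Rightarrow> complex)"
    have K: "integrable lborel ?K" using nice_window[of m, where 'a = 'a] by (simp add: nice_def)
    obtain B where B: "\<And>t. cmod (\<psi> t) \<le> B" using Cb_bounded[of \<psi>] \<psi> by (auto simp: A_alg_def)
    have i: "integrable lborel (\<lambda>y. FT f (t - y) * ?K y)" "integrable lborel (\<lambda>y. \<psi> (t - y) * ?K y)" for t
      by (rule integrable_bounded_mult[OF K norm_FT_le], measurable) (rule integrable_bounded_mult[OF K B], measurable)
    have "\<psi> t - khat_conv (window m) \<psi> t = (\<psi> t - FT f t) + (FT (\<lambda>x. f x - window m x * f x) t + conv (\<lambda>t. FT f t - \<psi> t) ?K t)" for t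
    proof -
      have "FT (\<lambda>x. f x - window m x * f x) t = FT f t - conv (FT f) ?K t"
        by (simp add: FT_diff[OF f wf] FT_nice_mult[OF nice_window f] khat_conv_eq_conv)
      moreover have "conv (\<lambda>t. FT f t - \<psi> t) ?K t = conv (FT f) ?K t - conv \<psi> ?K t"
        unfolding conv_def using i[of t] by (simp add: left_diff_distrib)
      ultimately show ?thesis by (simp add: khat_conv_eq_conv)
    qed
    then have "Vnorm (\<lambda>t. \<psi> t - khat_conv (window m) \<psi> t)
      = Vnorm (\<lambda>t. (\<psi> t - FT f t) + (FT (\<lambda>x. f x - window m x * f x) t + conv (\<lambda>t. FT f t - \<psi> t) ?K t))"
      by (simp only:)
    also have "\<dots> \<le> Vnorm (\<lambda>t. \<psi> t - FT f t) + (Vnorm (FT (\<lambda>x. f x - window m x * f x)) + Vnorm (conv (\<lambda>t. FT f t - \<psi> t) ?K))"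
      by (intro order_trans[OF Vnorm_add_le] add_left_mono Vnorm_add_le)
    also have "\<dots> \<le> ereal d + (ereal d + ereal (d * A))"
    proof (intro add_mono fd)
      show "Vnorm (FT (\<lambda>x. f x - window m x * f x)) \<le> ereal d"
        using f wf elim by (intro order_trans[OF Vnorm_FT_le]) auto
      show "Vnorm (conv (\<lambda>t. FT f t - \<psi> t) ?K) \<le> ereal (d * A)"
        unfolding A_def integral_norm_FT_window[of m, symmetric]
        by (rule Vnorm_conv_le[OF K]) (use fd in \<open>auto simp: Vnorm_diff_commute[of "FT f" \<psi>]\<close>)
    qed
    finally show ?case using d(2) by (simp add: add.assoc)
  qed
qed

lemma F_locally_bounded_of_locally_bdd:
  fixes \<phi> :: "'a::euclidean_space \<Rightarrow> complex"
  assumes \<phi>: "\<phi> \<in> MA" "locally_bdd \<phi>"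
  shows "F_locally_bounded \<phi>"
proof -
  have Cb: "\<phi> \<in> Cb" using \<phi> by (simp add: MA_def)
  have "loc_integrable (\<lambda>t. \<phi> t * FT (en n) t)" if n: "n \<ge> 1" for n
  proof -
    let ?\<psi> = "\<lambda>t. \<phi> t * FT (en n) t"
    have "\<forall>\<psi>\<in>A_alg. (\<lambda>t. \<phi> t * \<psi> t) \<in> A_alg" using \<phi>(1) by (simp add: MA_def)
    from bspec[OF this FT_en_in_A_alg[OF n]] have \<psi>: "?\<psi> \<in> A_alg" .
    define f where "f m x = window m x * smoothed \<phi> n x" for m x
    have w: "window m \<in> (Cc :: ('a \<Rightarrow> complex) set)" for m using nice_window[of m, where 'a = 'a] by (simp add: nice_def)
    have fi: "integrable lborel (f m)" for m
      unfolding f_def[abs_def] by (intro integrable_Cc Cc_mult_continuous w continuous_smoothed Cb n)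
    have "FT (f m) t = khat_conv (window m) ?\<psi> t" for m t
      unfolding f_def[abs_def] smoothed_def
      by (rule FT_mult_eq_khat_conv[OF integrable_Cc[OF w] integrable_mult_FT_en[OF Cb n]])
    then have "(\<lambda>m. Vnorm (\<lambda>t. ?\<psi> t - FT (f m) t)) \<longlonglongrightarrow> 0"
      using Vnorm_window_tendsto[OF \<psi>] by simp
    moreover have "\<exists>N. \<forall>m\<ge>N. \<forall>n\<ge>N. (LBINT x. cmod (h x * f m x - h x * f n x)) < e"
      if h: "h \<in> Cc" and e: "e > 0" for h and e :: real
    proof -
      obtain R where R: "supp_in R h" using Cc_supp[OF h] by metis
      \<comment> \<open>Once the window equals 1 on the support of \<open>h\<close> the product no
        longer depends on \<open>m\<close>, so the Cauchy condition holds with difference 0.\<close>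
      have "h x * f m x = h x * smoothed \<phi> n x" if m: "m \<ge> nat \<lceil>R\<rceil>" for m x
      proof (cases "norm x \<le> R")
        case True
        then have "norm x \<le> real (Suc m)" using m by linarith
        then show ?thesis by (simp add: f_def window_eq_1)
      next
        case False
        then have "h x = 0" using R by (simp add: supp_in_def)
        then show ?thesis by simp
      qed
      then have "h x * f m x - h x * f l x = 0" if "m \<ge> nat \<lceil>R\<rceil>" "l \<ge> nat \<lceil>R\<rceil>" for m l x
        using that by (simp only: diff_self)
      then have "(LBINT x. cmod (h x * f m x - h x * f l x)) = 0" if "m \<ge> nat \<lceil>R\<rceil>" "l \<ge> nat \<lceil>R\<rceil>" for m l
        using that by (simp only: norm_zero integral_zero)
      then show ?thesis using e by metis
    qed
    ultimately have "loc_int_seq ?\<psi> f" using fi unfolding loc_int_seq_def by blast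
    then show ?thesis using \<psi> unfolding loc_integrable_def by blast
  qed
  then show ?thesis
    unfolding F_locally_bounded_def using integral_loc_mult_le[OF Cb \<phi>(2)] by blast
qed

theorem theorem8p6:
  fixes \<phi> :: "'a::euclidean_space \<Rightarrow> complex"
  assumes "\<phi> \<in> MA"
  shows "((\<exists>\<nu>. radon_functional \<nu> \<and> transformable_with_density \<nu> \<phi>)
           \<longleftrightarrow> (\<forall>k\<in>Cc \<inter> B_FS. khat_conv k \<phi> \<in> B_hat))
       \<and> ((\<forall>k\<in>Cc \<inter> B_FS. khat_conv k \<phi> \<in> B_hat) \<longleftrightarrow> F_locally_bounded \<phi>)"
proof -
  have Cb: "\<phi> \<in> Cb" using assms by (simp add: MA_def)
  have "(\<exists>\<nu>. radon_functional \<nu> \<and> transformable_with_density \<nu> \<phi>) \<longleftrightarrow> locally_bdd \<phi>"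
    using radon_of_locally_bdd[OF Cb] locally_bdd_of_radon[OF Cb] by blast
  moreover have "(\<forall>k\<in>Cc \<inter> B_FS. khat_conv k \<phi> \<in> B_hat) \<longleftrightarrow> locally_bdd \<phi>"
    using B_hat_of_locally_bdd[OF Cb] locally_bdd_of_B_hat[OF Cb] by blast
  moreover have "F_locally_bounded \<phi> \<longleftrightarrow> locally_bdd \<phi>"
    using F_locally_bounded_of_locally_bdd[OF assms] locally_bdd_of_F_locally_bounded[OF Cb] by blast
  ultimately show ?thesis by blast
qed

end
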